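(* Let $(R,\mathfrak m)$ be a $d$-dimensional regular local ring with $d\ge 2$, and fix $d$ elements $x_1,\dots,x_d$ with $\mathfrak m=(x_1,\dots,x_d)R$. Let $R=R_0\subset R_1\subset R_2\subset\cdots$ be an infinite sequence of regular local rings $(R_i,\mathfrak m_i)$ such that $R_{i+1}$ is a monomial local quadratic transformation of $R_i$ for each $i\ge 0$ (with respect to the fixed $x_1,\dots,x_d$ and the induced variables). For $1\le k\le d$, let $\mathfrak D_k$ be the set of nonnegative integers $i$ for which the transform from $R_i$ to $R_{i+1}$ is in the $x_k$-direction. Assume that $\mathfrak D_1,\dots,\mathfrak D_d$ are all infinite, so that $V=\bigcup_{i\ge0}R_i$ is a rank one valuation domain. Then $V$ has rational rank $d=\dim R$, and $V$ is zero-dimensional over $R$. If $v$ is a valuation associated to $V$, then $v(x_1),\dots,v(x_d)$ are rationally independent. In particular, $v$ is a monomial valuation (with respect to $x_1,\dots,x_d$).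
   Context: Monomial sequences: put $x_{0,k}=x_k$. Given $(R_i,\mathfrak m_i)$ with $\mathfrak m_i=(x_{i,1},\dots,x_{i,d})R_i$ and $k\in\{1,\dots,d\}$, the monomial local quadratic transformation of $R_i$ in the $x_k$-direction is $R_{i+1}=R_i[\mathfrak m_i/x_{i,k}]_{(x_{i+1,1},\dots,x_{i+1,d})}$, where $x_{i+1,k}=x_{i,k}$ and $x_{i+1,l}=x_{i,l}/x_{i,k}$ for $l\ne k$; its maximal ideal is $\mathfrak m_{i+1}=(x_{i+1,1},\dots,x_{i+1,d})R_{i+1}$. A monomial local quadratic transformation of $R_i$ is one of these $d$ rings. If all $\mathfrak D_k$ are infinite, then $\bigcup_{i\ge 0}R_i$ is a valuation domain of rank one (Krull dimension one), birationally dominating $R$. The rational rank of $v$ is $\dim_{\mathbb Q}(\Gamma_v\otimes_{\mathbb Z}\mathbb Q)$, where $\Gamma_v$ is the value group. $V$ is zero-dimensional over $R$ if its residue field is algebraic over $R/\mathfrak m$. Rationally independent means linearly independent over $\mathbb Q$. A monomial in $x_1,\dots,x_d$ is an element $x_1^{\alpha_1}\cdots x_d^{\alpha_d}$ with $\alpha_k\in\mathbb Z_{\ge0}$. Every nonzero $f\in R$ can be written as a finite sum $f=\lambda_1g_1+\cdots+\lambda_tg_t$ with $g_i$ distinct monomials and $\lambda_i$ units of $R$; $v$ is a monomial valuation with respect to $x_1,\dots,x_d$ if for every such expression $v(f)=\min_i v(g_i)$. *)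

theory Defs
  imports "HOL-Algebra.Algebra" "HOL-Library.Extended_Nat"
begin

text \<open>
  All rings of the statement are subrings of one field \<open>K\<close>, the fraction field of \<open>R\<close>.  They
  are given by their carriers; the ring with carrier \<open>A\<close> is \<open>K\<lparr>carrier := A\<rparr>\<close>.
\<close>

section \<open>Regular local rings\<close>

text \<open>Supremum of the lengths \<open>n\<close> of chains \<open>P 0 \<subset> \<dots> \<subset> P n\<close> of prime ideals.\<close>

definition krull_dim :: "('a, 'b) ring_scheme \<Rightarrow> enat" where
  "krull_dim R = (SUP n \<in> {n. \<exists>P :: nat \<Rightarrow> 'a set.
     (\<forall>i\<le>n. primeideal (P i) R) \<and> (\<forall>i<n. P i \<subset> P (Suc i))}. enat n)"

definition local_ring :: "('a, 'b) ring_scheme \<Rightarrow> 'a set \<Rightarrow> bool" where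
  "local_ring R m \<longleftrightarrow> cring R \<and> {I. maximalideal I R} = {m}"

definition regular_local_ring :: "('a, 'b) ring_scheme \<Rightarrow> 'a set \<Rightarrow> bool" where
  "regular_local_ring R m \<longleftrightarrow>
     local_ring R m \<and> noetherian_ring R \<and>
     (\<exists>S \<subseteq> carrier R. finite S \<and> m = Idl\<^bsub>R\<^esub> S \<and> krull_dim R = enat (card S))"

definition fraction_field_of :: "('a, 'b) ring_scheme \<Rightarrow> 'a set \<Rightarrow> bool" where
  "fraction_field_of K R \<longleftrightarrow>
     subring R K \<and>
     (\<forall>f \<in> carrier K. \<exists>a \<in> R. \<exists>b \<in> R - {\<zero>\<^bsub>K\<^esub>}. f = a \<otimes>\<^bsub>K\<^esub> inv\<^bsub>K\<^esub> b)"

section \<open>Monomial local quadratic transformations\<close>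

text \<open>The localization of the subring \<open>A\<close> of \<open>K\<close> at the prime ideal \<open>P\<close> of \<open>A\<close>.\<close>

definition localization_at :: "('a, 'b) ring_scheme \<Rightarrow> 'a set \<Rightarrow> 'a set \<Rightarrow> 'a set" where
  "localization_at K A P = {a \<otimes>\<^bsub>K\<^esub> inv\<^bsub>K\<^esub> s | a s. a \<in> A \<and> s \<in> A - P}"

text \<open>
  \<open>monomial_lqt K d k R m x R' x'\<close>: the ring \<open>R'\<close> with induced variables \<open>x'\<close> is the transform, in
  the \<open>x k\<close>-direction, of the local ring \<open>(R, m)\<close> with variables \<open>x\<close>.  The condition that \<open>x k\<close> is
  nonzero only says that the quotients by \<open>x k\<close> are defined; it is automatic when \<open>(R, m)\<close> is
  regular of dimension \<open>d\<close> and \<open>x\<close> generates \<open>m\<close>, since fewer than \<open>d\<close> elements do not generate \<open>m\<close>.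
\<close>

definition monomial_lqt ::
  "('a, 'b) ring_scheme \<Rightarrow> nat \<Rightarrow> nat \<Rightarrow> 'a set \<Rightarrow> 'a set \<Rightarrow> (nat \<Rightarrow> 'a) \<Rightarrow>
     'a set \<Rightarrow> (nat \<Rightarrow> 'a) \<Rightarrow> bool" where
  "monomial_lqt K d k R m x R' x' \<longleftrightarrow>
     k \<in> {1..d} \<and> x k \<noteq> \<zero>\<^bsub>K\<^esub> \<and>
     x' k = x k \<and> (\<forall>l \<in> {1..d} - {k}. x' l = x l \<otimes>\<^bsub>K\<^esub> inv\<^bsub>K\<^esub> x k) \<and>
     (let A = generate_ring K (R \<union> {a \<otimes>\<^bsub>K\<^esub> inv\<^bsub>K\<^esub> x k | a. a \<in> m})
      in R' = localization_at K A (Idl\<^bsub>K\<lparr>carrier := A\<rparr>\<^esub> (x' ` {1..d})))"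

section \<open>Valuation rings and valuations\<close>

definition valuation_subring :: "('a, 'b) ring_scheme \<Rightarrow> 'a set \<Rightarrow> bool" where
  "valuation_subring K V \<longleftrightarrow>
     subring V K \<and> (\<forall>a \<in> carrier K - {\<zero>\<^bsub>K\<^esub>}. a \<in> V \<or> inv\<^bsub>K\<^esub> a \<in> V)"

text \<open>
  Only the values of \<open>v\<close> at nonzero elements matter.  The map \<open>v\<close> need not be onto \<open>'g\<close>; its value
  group is its image.
\<close>

definition valuation ::
  "('a, 'b) ring_scheme \<Rightarrow> ('a \<Rightarrow> 'g :: linordered_ab_group_add) \<Rightarrow> bool" where
  "valuation K v \<longleftrightarrow>
     (\<forall>a \<in> carrier K - {\<zero>\<^bsub>K\<^esub>}. \<forall>b \<in> carrier K - {\<zero>\<^bsub>K\<^esub>}.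
        v (a \<otimes>\<^bsub>K\<^esub> b) = v a + v b \<and>
        (a \<oplus>\<^bsub>K\<^esub> b \<noteq> \<zero>\<^bsub>K\<^esub> \<longrightarrow> min (v a) (v b) \<le> v (a \<oplus>\<^bsub>K\<^esub> b)))"

definition valuation_associated_to ::
  "('a, 'b) ring_scheme \<Rightarrow> 'a set \<Rightarrow> ('a \<Rightarrow> 'g :: linordered_ab_group_add) \<Rightarrow> bool" where
  "valuation_associated_to K V v \<longleftrightarrow>
     valuation K v \<and> V = {a \<in> carrier K. a = \<zero>\<^bsub>K\<^esub> \<or> 0 \<le> v a}"

definition value_group ::
  "('a, 'b) ring_scheme \<Rightarrow> ('a \<Rightarrow> 'g :: linordered_ab_group_add) \<Rightarrow> 'g monoid" where
  "value_group K v = \<lparr>carrier = v ` (carrier K - {\<zero>\<^bsub>K\<^esub>}), monoid.mult = (+), one = 0\<rparr>"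

text \<open>The value group of a valuation ring \<open>V\<close> of \<open>K\<close> without the choice of a valuation: \<open>K\<^sup>* / V\<^sup>*\<close>.\<close>

definition value_group_of_ring :: "('a, 'b) ring_scheme \<Rightarrow> 'a set \<Rightarrow> 'a set monoid" where
  "value_group_of_ring K V = mult_of K Mod Units (K\<lparr>carrier := V\<rparr>)"

text \<open>
  The residue field of \<open>V\<close> is algebraic over \<open>R/m\<close>.  The local ring \<open>V\<close> has to dominate \<open>(R, m)\<close> for
  \<open>R/m\<close> to embed into the residue field; its image there is the image of \<open>R\<close>.
\<close>

definition zero_dimensional_over ::
  "('a, 'b) ring_scheme \<Rightarrow> 'a set \<Rightarrow> 'a set \<Rightarrow> 'a set \<Rightarrow> bool" where
  "zero_dimensional_over K V R m \<longleftrightarrow>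
     (\<exists>M. local_ring (K\<lparr>carrier := V\<rparr>) M \<and> R \<subseteq> V \<and> M \<inter> R = m \<and>
        (let \<kappa> = K\<lparr>carrier := V\<rparr> Quot M
         in \<forall>z \<in> carrier \<kappa>.
              ring.algebraic \<kappa> ((\<lambda>r. M +>\<^bsub>K\<lparr>carrier := V\<rparr>\<^esub> r) ` R) z))"

section \<open>Rational rank\<close>

text \<open>
  The tensor product of an abelian group \<open>G\<close> with the group of rational numbers: the free abelian
  group on \<open>carrier G \<times> \<rat>\<close> modulo the bilinearity relations.  \<open>G\<close> is written multiplicatively, and
  so is the tensor product, as groups in HOL-Algebra are.
\<close>

definition tensor_base :: "('g, 'm) monoid_scheme \<Rightarrow> (('g \<times> rat) \<Rightarrow>\<^sub>0 int) monoid" where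
  "tensor_base G = free_Abelian_group (carrier G \<times> UNIV)"

definition tensor_null :: "('g, 'm) monoid_scheme \<Rightarrow> (('g \<times> rat) \<Rightarrow>\<^sub>0 int) set" where
  "tensor_null G = generate (tensor_base G)
     ({frag_of (g \<otimes>\<^bsub>G\<^esub> h, q) - frag_of (g, q) - frag_of (h, q) | g h q.
         g \<in> carrier G \<and> h \<in> carrier G} \<union>
      {frag_of (g, q + r) - frag_of (g, q) - frag_of (g, r) | g q r. g \<in> carrier G})"

definition rat_tensor :: "('g, 'm) monoid_scheme \<Rightarrow> (('g \<times> rat) \<Rightarrow>\<^sub>0 int) set monoid" where
  "rat_tensor G = tensor_base G Mod tensor_null G"

definition pure_tensor ::
  "('g, 'm) monoid_scheme \<Rightarrow> 'g \<Rightarrow> rat \<Rightarrow> (('g \<times> rat) \<Rightarrow>\<^sub>0 int) set" where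
  "pure_tensor G g q = tensor_null G #>\<^bsub>tensor_base G\<^esub> frag_of (g, q)"

text \<open>
  Scalar multiplication on cosets, induced by \<open>(g, q) \<mapsto> (g, c * q)\<close>.  The image of a coset is in
  general only contained in a coset; adding \<open>tensor_null G\<close> gives that coset.
\<close>

definition rat_scale ::
  "('g, 'm) monoid_scheme \<Rightarrow> rat \<Rightarrow> (('g \<times> rat) \<Rightarrow>\<^sub>0 int) set \<Rightarrow> (('g \<times> rat) \<Rightarrow>\<^sub>0 int) set"
  where
  "rat_scale G c T =
     tensor_null G <#>\<^bsub>tensor_base G\<^esub> (frag_extend (\<lambda>(g, q). frag_of (g, c * q)) ` T)"

definition rat_combination ::
  "('g, 'm) monoid_scheme \<Rightarrow> 'i set \<Rightarrow> ('i \<Rightarrow> rat) \<Rightarrow> ('i \<Rightarrow> (('g \<times> rat) \<Rightarrow>\<^sub>0 int) set) \<Rightarrow>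
     (('g \<times> rat) \<Rightarrow>\<^sub>0 int) set" where
  "rat_combination G I c t = finprod (rat_tensor G) (\<lambda>i. rat_scale G (c i) (t i)) I"

text \<open>Linear independence over \<open>\<rat>\<close> of a finite family of elements of the tensor product.\<close>

definition rat_lin_indep ::
  "('g, 'm) monoid_scheme \<Rightarrow> 'i set \<Rightarrow> ('i \<Rightarrow> (('g \<times> rat) \<Rightarrow>\<^sub>0 int) set) \<Rightarrow> bool" where
  "rat_lin_indep G I t \<longleftrightarrow>
     (\<forall>c. rat_combination G I c t = \<one>\<^bsub>rat_tensor G\<^esub> \<longrightarrow> (\<forall>i\<in>I. c i = 0))"

text \<open>The tensor product has dimension \<open>n\<close> over \<open>\<rat>\<close>: it has a basis of \<open>n\<close> elements.\<close>

definition has_rational_rank :: "('g, 'm) monoid_scheme \<Rightarrow> nat \<Rightarrow> bool" where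
  "has_rational_rank G n \<longleftrightarrow>
     (\<exists>B \<subseteq> carrier (rat_tensor G). finite B \<and> card B = n \<and>
        rat_lin_indep G B (\<lambda>b. b) \<and>
        (\<forall>t \<in> carrier (rat_tensor G). \<exists>c. t = rat_combination G B c (\<lambda>b. b)))"

text \<open>
  An abelian group need not be a rational vector space: a finite family in \<open>G\<close> is rationally
  independent if its image under \<open>g \<mapsto> g \<otimes> 1\<close> is linearly independent over \<open>\<rat>\<close>.
\<close>

definition rationally_independent ::
  "('g, 'm) monoid_scheme \<Rightarrow> 'i set \<Rightarrow> ('i \<Rightarrow> 'g) \<Rightarrow> bool" where
  "rationally_independent G I g \<longleftrightarrow> rat_lin_indep G I (\<lambda>i. pure_tensor G (g i) 1)"

section \<open>Monomial valuations\<close>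

definition monomials :: "('a, 'b) ring_scheme \<Rightarrow> nat \<Rightarrow> (nat \<Rightarrow> 'a) \<Rightarrow> 'a set" where
  "monomials K d x = {\<Otimes>\<^bsub>K\<^esub>k\<in>{1..d}. x k [^]\<^bsub>K\<^esub> \<alpha> k | \<alpha> :: nat \<Rightarrow> nat. True}"

text \<open>
  The set \<open>G\<close> consists of the distinct monomials of an expression of \<open>f\<close>, and \<open>\<mu> g\<close> is the unit
  coefficient of \<open>g\<close>.
\<close>

definition monomial_valuation ::
  "('a, 'b) ring_scheme \<Rightarrow> 'a set \<Rightarrow> nat \<Rightarrow> (nat \<Rightarrow> 'a) \<Rightarrow>
     ('a \<Rightarrow> 'g :: linordered_ab_group_add) \<Rightarrow> bool" where
  "monomial_valuation K R d x v \<longleftrightarrow>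
     (\<forall>f \<in> R - {\<zero>\<^bsub>K\<^esub>}. \<forall>G \<mu>.
        finite G \<and> G \<noteq> {} \<and> G \<subseteq> monomials K d x \<and>
        \<mu> \<in> G \<rightarrow> Units (K\<lparr>carrier := R\<rparr>) \<and>
        f = (\<Oplus>\<^bsub>K\<^esub>g\<in>G. \<mu> g \<otimes>\<^bsub>K\<^esub> g) \<longrightarrow>
        v f = Min (v ` G))"

end

theory Submission
  imports Defs
begin

text \<open>
  Every Laurent monomial in the variables \<open>x 0\<close> is a Laurent monomial in the variables \<open>x n\<close> of each
  later ring, and a transformation in the \<open>k\<close>-direction changes its exponent vector only at \<open>k\<close>, where
  the sum of all exponents is put.  The theorem rests on a combinatorial fact about this process
  (\<open>pos_trichotomy\<close>): if every direction recurs, then a nonzero exponent vector eventually has all its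
  entries positive or all its entries negative.  For the sign, let \<open>P\<close> and \<open>N\<close> be the sums of the
  absolute values of the positive and of the negative entries.  The number \<open>min P N\<close> never increases.
  If it stayed constant and nonzero, then from some stage on the sign of the sum of the entries would
  not change, and no entry of the opposite sign could be hit any more; but every entry is hit infinitely
  often.  So one of \<open>P\<close> and \<open>N\<close> reaches zero, and afterwards each step writes the (nonzero) sum into one
  more entry.  The exponent vectors that become positive thus define a total order on the group of
  exponent vectors, and this order is archimedean.

  Consequently the monomial with exponent vector \<open>\<gamma> \<noteq> 0\<close> lies in the maximal ideal \<open>M\<close> of the union \<open>V\<close>,
  or its inverse does; in particular it is not a unit of \<open>V\<close>.  The second ingredient is that every
  nonzero element of the field is a unit of \<open>V\<close> times a Laurent monomial
  (\<open>field_unit_times_monomial\<close>).  It suffices to consider \<open>f\<close> in the first ring.  In an expression of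
  \<open>f\<close> by monomials look at the least monomial for the order just described.  If its coefficient is a
  unit, the rest of the expression is that monomial times an element of \<open>M\<close>, and \<open>f\<close> is a unit times
  this monomial.  Otherwise the coefficient is absorbed in larger monomials.  If this went on forever,
  then \<open>f\<close> would lie in all powers of the maximal ideal, since only finitely many monomials are smaller
  than a given one; this contradicts Krull's intersection theorem (\<open>krull_intersection_monomial\<close>).

  Both facts together identify the value group of \<open>V\<close> with the group of exponent vectors, which is free
  on the \<open>d\<close> classes of the variables.  This gives the rational rank and the rational independence
  (\<open>value_map_basis\<close>); totality of the order gives the valuation ring, and the archimedean property
  gives dimension one.  Distinct monomials have distinct values, so the value of a sum of monomials with
  unit coefficients is the least value of a term (\<open>value_of_monomial_sum\<close>).  Finally, a monomial
  transformation does not change the residue field (\<open>monomial_lqt_step\<close>): the new ring is a localization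
  of an algebra that the new variables generate over the old ring, so modulo these variables each of
  its elements is a fraction of elements of the old ring.  Hence \<open>V\<close> and the first ring have the same
  residue field.
\<close>

section \<open>Exponent vectors under blow-ups\<close>

locale blow_up_directions =
  fixes I :: "'i set" and dir :: "nat \<Rightarrow> 'i"
  assumes finite_I: "finite I"
    and dir_in: "dir n \<in> I"
    and dir_infinite: "k \<in> I \<Longrightarrow> infinite {n. dir n = k}"
begin

text \<open>
  \<open>expo n \<gamma>\<close> is the exponent vector, with respect to the variables of stage \<open>n\<close>, of the Laurent
  monomial that has the exponents \<open>\<gamma>\<close> in the first variables: each old variable other than the one
  of the direction \<open>dir n\<close> is a new variable times the variable of that direction.
\<close>

primrec expo :: "nat \<Rightarrow> ('i \<Rightarrow> int) \<Rightarrow> ('i \<Rightarrow> int)" where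
  "expo 0 \<gamma> = \<gamma>"
| "expo (Suc n) \<gamma> = (expo n \<gamma>)(dir n := \<Sum>k\<in>I. expo n \<gamma> k)"

lemma expo_add: "expo n (\<lambda>k. \<gamma> k + \<delta> k) = (\<lambda>k. expo n \<gamma> k + expo n \<delta> k)"
  by (induction n) (auto simp: sum.distrib)

lemma expo_cmul: "expo n (\<lambda>k. c * \<gamma> k) = (\<lambda>k. c * expo n \<gamma> k)"
  by (induction n) (auto simp: sum_distrib_left)

lemma expo_uminus: "expo n (\<lambda>k. - \<gamma> k) = (\<lambda>k. - expo n \<gamma> k)"
  using expo_cmul[of n "-1" \<gamma>] by simp

lemma expo_diff: "expo n (\<lambda>k. \<gamma> k - \<delta> k) = (\<lambda>k. expo n \<gamma> k - expo n \<delta> k)"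
  using expo_add[of n \<gamma> "\<lambda>k. - \<delta> k"] by (simp add: expo_uminus)

lemma expo_sum: "expo n (\<lambda>k. \<Sum>j\<in>J. f j k) = (\<lambda>k. \<Sum>j\<in>J. expo n (f j) k)"
proof (induction n)
  case (Suc n)
  then show ?case by (auto simp: fun_eq_iff intro: sum.swap)
qed simp

lemma direction_recurs:
  assumes "k \<in> I" shows "\<exists>j\<ge>n. dir j = k"
  using dir_infinite[OF assms] by (auto simp: infinite_nat_iff_unbounded_le)

lemma expo_nonneg_mono:
  assumes "\<forall>k\<in>I. 0 \<le> expo n \<gamma> k" "n \<le> j"
  shows "\<forall>k\<in>I. 0 \<le> expo j \<gamma> k"
  using assms(2,1) by (induction j rule: dec_induct) (auto intro: sum_nonneg)

lemma expo_pos_mono: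
  assumes "\<forall>k\<in>I. 0 < expo n \<gamma> k" "n \<le> j"
  shows "\<forall>k\<in>I. 0 < expo j \<gamma> k"
  using assms(2,1)
proof (induction j rule: dec_induct)
  case (step j)
  then have "0 < (\<Sum>k\<in>I. expo j \<gamma> k)"
    using finite_I dir_in by (intro sum_pos) auto
  with step show ?case by auto
qed simp

lemma expo_zero_imp_zero:
  assumes "\<forall>k\<in>I. expo n \<gamma> k = 0"
  shows "\<forall>k\<in>I. \<gamma> k = 0"
  using assms
proof (induction n)
  case (Suc n)
  have other: "expo n \<gamma> k = 0" if "k \<in> I" "k \<noteq> dir n" for k
    using Suc.prems that by auto
  have "(\<Sum>k\<in>I. expo n \<gamma> k) = expo n \<gamma> (dir n) + (\<Sum>k\<in>I - {dir n}. expo n \<gamma> k)"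
    by (rule sum.remove[OF finite_I dir_in])
  also have "(\<Sum>k\<in>I - {dir n}. expo n \<gamma> k) = 0"
    using other by (intro sum.neutral) auto
  finally have "expo n \<gamma> (dir n) = 0" using Suc.prems dir_in by auto
  with other have "\<forall>k\<in>I. expo n \<gamma> k = 0" by blast
  then show ?case by (rule Suc.IH)
qed simp

definition neg_mass :: "('i \<Rightarrow> int) \<Rightarrow> int" where
  "neg_mass \<gamma> = (\<Sum>k\<in>I. max 0 (- \<gamma> k))"

definition pos_mass :: "('i \<Rightarrow> int) \<Rightarrow> int" where
  "pos_mass \<gamma> = (\<Sum>k\<in>I. max 0 (\<gamma> k))"

lemma sum_eq_pos_minus_neg: "(\<Sum>k\<in>I. \<gamma> k) = pos_mass \<gamma> - neg_mass \<gamma>"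
  unfolding pos_mass_def neg_mass_def sum_subtractf[symmetric]
  by (intro sum.cong) auto

lemma pos_mass_uminus: "pos_mass (\<lambda>k. - \<gamma> k) = neg_mass \<gamma>"
  and neg_mass_uminus: "neg_mass (\<lambda>k. - \<gamma> k) = pos_mass \<gamma>"
  by (simp_all add: pos_mass_def neg_mass_def)

lemma mass_nonneg: "0 \<le> neg_mass \<gamma>" "0 \<le> pos_mass \<gamma>"
  by (auto simp: neg_mass_def pos_mass_def intro: sum_nonneg)

lemma neg_mass_0_iff: "neg_mass \<gamma> = 0 \<longleftrightarrow> (\<forall>k\<in>I. 0 \<le> \<gamma> k)"
  unfolding neg_mass_def using finite_I
  by (subst sum_nonneg_eq_0_iff) (auto simp: max_def)

lemma neg_mass_update:
  assumes "k \<in> I" "0 \<le> c"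
  shows "neg_mass (\<gamma>(k := c)) = neg_mass \<gamma> - max 0 (- \<gamma> k)"
proof -
  have "(\<Sum>l\<in>I - {k}. max 0 (- (\<gamma>(k := c)) l)) = (\<Sum>l\<in>I - {k}. max 0 (- \<gamma> l))"
    by (intro sum.cong) auto
  then show ?thesis
    unfolding neg_mass_def using assms
    by (subst (1 2) sum.remove[OF finite_I \<open>k \<in> I\<close>]) simp
qed

text \<open>
  While the sum of the entries is nonnegative, a step in a direction with a nonnegative entry keeps the
  negative mass, and a step at a negative entry, which must come at some time, lowers it.  If the sum
  becomes negative before, then the positive mass has dropped below the negative mass of stage \<open>n\<close>.
\<close>

lemma min_mass_decreases:
  assumes "neg_mass (expo n \<gamma>) \<le> pos_mass (expo n \<gamma>)" "0 < neg_mass (expo n \<gamma>)"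
  shows "\<exists>j>n. min (pos_mass (expo j \<gamma>)) (neg_mass (expo j \<gamma>)) < neg_mass (expo n \<gamma>)"
proof (rule ccontr)
  let ?P = "\<lambda>j. pos_mass (expo j \<gamma>)" and ?N = "\<lambda>j. neg_mass (expo j \<gamma>)"
  assume "\<not> (\<exists>j>n. min (?P j) (?N j) < ?N n)"
  then have large: "?N n \<le> ?P j \<and> ?N n \<le> ?N j" if "j > n" for j
    using that by fastforce
  obtain k where k: "k \<in> I" "expo n \<gamma> k < 0"
    using assms(2) neg_mass_0_iff[of "expo n \<gamma>"] by fastforce
  have one_step: "0 \<le> expo j \<gamma> (dir j) \<and> ?N (Suc j) = ?N n"
    if "j \<ge> n" "?N j = ?N n" "?N j \<le> ?P j" for j
  proof -
    have "?N (Suc j) = ?N j - max 0 (- expo j \<gamma> (dir j))"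
      using that by (simp add: neg_mass_update dir_in sum_eq_pos_minus_neg del: fun_upd_apply)
    with that large[of "Suc j"] show ?thesis by (auto simp: max_def split: if_splits)
  qed
  have inv: "?N j = ?N n \<and> ?N j \<le> ?P j \<and> expo j \<gamma> k = expo n \<gamma> k" if "j \<ge> n" for j
    using that
  proof (induction j rule: dec_induct)
    case base
    then show ?case using assms(1) by simp
  next
    case (step j)
    have "0 \<le> expo j \<gamma> (dir j)" "?N (Suc j) = ?N n" using one_step[of j] step by auto
    moreover have "?N n \<le> ?P (Suc j)" using large[of "Suc j"] step.hyps by simp
    moreover have "expo (Suc j) \<gamma> k = expo j \<gamma> k"
      using step.IH k(2) \<open>0 \<le> expo j \<gamma> (dir j)\<close> by auto
    ultimately show ?case using step.IH by (simp del: expo.simps)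
  qed
  obtain j where "j \<ge> n" "dir j = k" using direction_recurs[OF k(1)] by blast
  then show False using inv[of j] one_step[of j] k(2) by auto
qed

text \<open>
  At a stage where the smaller of the two masses is least, this mass vanishes, because otherwise it
  would decrease; the case of a negative sum is reduced to the other one by changing all signs.
\<close>

lemma eventually_nonneg_or_nonpos:
  "\<exists>j. (\<forall>k\<in>I. 0 \<le> expo j \<gamma> k) \<or> (\<forall>k\<in>I. expo j \<gamma> k \<le> 0)"
proof -
  let ?P = "\<lambda>j. pos_mass (expo j \<gamma>)" and ?N = "\<lambda>j. neg_mass (expo j \<gamma>)"
  obtain n where n: "\<And>j. nat (min (?P n) (?N n)) \<le> nat (min (?P j) (?N j))"
    using ex_has_least_nat[of "\<lambda>_. True" 0 "\<lambda>j. nat (min (?P j) (?N j))"] by blast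
  then have least: "min (?P n) (?N n) \<le> min (?P j) (?N j)" for j
    using mass_nonneg[of "expo j \<gamma>"] mass_nonneg[of "expo n \<gamma>"] n[of j] by linarith
  have "?P n = 0 \<or> ?N n = 0"
  proof (rule ccontr)
    assume "\<not> (?P n = 0 \<or> ?N n = 0)"
    then have gt: "0 < ?P n" "0 < ?N n" using mass_nonneg by (smt (verit))+
    show False
    proof (cases "?N n \<le> ?P n")
      case True
      then obtain j where "min (?P j) (?N j) < ?N n" using min_mass_decreases gt(2) by blast
      with True least[of j] show False by linarith
    next
      case False
      then obtain j where "min (?N j) (?P j) < ?P n"
        using min_mass_decreases[of n "\<lambda>k. - \<gamma> k", unfolded expo_uminus pos_mass_uminus neg_mass_uminus] gt(1)
        by force
      with False least[of j] show False by linarith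
    qed
  qed
  then show ?thesis
    using neg_mass_0_iff[of "expo n \<gamma>"] neg_mass_0_iff[of "\<lambda>k. - expo n \<gamma> k"]
    by (auto simp: neg_mass_uminus)
qed

text \<open>
  Once the entries are nonnegative and not all zero, their sum is positive and is written into every
  entry at least once.
\<close>

lemma nonneg_eventually_pos:
  assumes nonneg: "\<forall>k\<in>I. 0 \<le> expo n \<gamma> k" and "l \<in> I" "expo n \<gamma> l \<noteq> 0"
  shows "\<exists>j. \<forall>k\<in>I. 0 < expo j \<gamma> k"
proof -
  have nonneg': "\<forall>k\<in>I. 0 \<le> expo j \<gamma> k" if "n \<le> j" for j
    using expo_nonneg_mono[OF nonneg that] .
  have total_pos: "0 < (\<Sum>k\<in>I. expo j \<gamma> k)" if j: "n \<le> j" for j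
  proof -
    have "\<exists>k\<in>I. expo j \<gamma> k \<noteq> 0"
    proof (rule ccontr)
      assume "\<not> (\<exists>k\<in>I. expo j \<gamma> k \<noteq> 0)"
      then have "\<forall>k\<in>I. \<gamma> k = 0" using expo_zero_imp_zero[of j \<gamma>] by blast
      then have "expo i \<gamma> k = 0" if "k \<in> I" for i k
        using that by (induction i arbitrary: k) auto
      with assms show False by blast
    qed
    then obtain k where "k \<in> I" "expo j \<gamma> k > 0" using nonneg'[OF j] by force
    then show ?thesis
      using finite_I nonneg'[OF j] by (intro sum_pos2[of I k]) auto
  qed
  have stays: "0 < expo j \<gamma> k" if "0 < expo i \<gamma> k" "n \<le> i" "i \<le> j" for i j k
    using that(3)
  proof (induction j rule: dec_induct)
    case (step j)
    then show ?case using total_pos[of j] that(2) by simp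
  qed (rule that(1))
  have "\<exists>j\<ge>n. 0 < expo j \<gamma> k" if "k \<in> I" for k
  proof -
    obtain i where "i \<ge> n" "dir i = k" using direction_recurs[OF \<open>k \<in> I\<close>] by blast
    then have "0 < expo (Suc i) \<gamma> k" using total_pos by auto
    with \<open>i \<ge> n\<close> show ?thesis by (intro exI[of _ "Suc i"]) auto
  qed
  then obtain f where f: "\<And>k. k \<in> I \<Longrightarrow> n \<le> f k \<and> 0 < expo (f k) \<gamma> k" by metis
  have "0 < expo (Max (f ` I)) \<gamma> k" if "k \<in> I" for k
    using stays[of "f k" k "Max (f ` I)"] f[OF that] that finite_I by simp
  then show ?thesis by blast
qed

text \<open>
  The positive cone of the order on exponent vectors that the sequence of directions induces; it will
  be the order of the values of monomials.
\<close>

definition pos :: "('i \<Rightarrow> int) \<Rightarrow> bool" where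
  "pos \<gamma> \<longleftrightarrow> (\<exists>j. \<forall>k\<in>I. 0 < expo j \<gamma> k)"

lemma pos_trichotomy:
  "(\<forall>k\<in>I. \<gamma> k = 0) \<or> pos \<gamma> \<or> pos (\<lambda>k. - \<gamma> k)"
proof -
  obtain j where j: "(\<forall>k\<in>I. 0 \<le> expo j \<gamma> k) \<or> (\<forall>k\<in>I. expo j \<gamma> k \<le> 0)"
    using eventually_nonneg_or_nonpos by blast
  show ?thesis
  proof (cases "\<forall>k\<in>I. expo j \<gamma> k = 0")
    case True
    then show ?thesis using expo_zero_imp_zero by blast
  next
    case False
    then obtain l where "l \<in> I" "expo j \<gamma> l \<noteq> 0" by blast
    with j show ?thesis
      using nonneg_eventually_pos[of j \<gamma> l] nonneg_eventually_pos[of j "\<lambda>k. - \<gamma> k" l]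
      by (auto simp: pos_def expo_uminus)
  qed
qed

lemma pos_add:
  assumes "pos \<gamma>" "pos \<delta>" shows "pos (\<lambda>k. \<gamma> k + \<delta> k)"
proof -
  obtain i j where "\<forall>k\<in>I. 0 < expo i \<gamma> k" "\<forall>k\<in>I. 0 < expo j \<delta> k"
    using assms by (auto simp: pos_def)
  then have "\<forall>k\<in>I. 0 < expo (max i j) \<gamma> k" "\<forall>k\<in>I. 0 < expo (max i j) \<delta> k"
    using expo_pos_mono by (meson max.cobounded1 max.cobounded2)+
  then show ?thesis unfolding pos_def expo_add by (meson add_pos_pos)
qed

lemma pos_not_zero: "pos \<gamma> \<Longrightarrow> \<exists>k\<in>I. \<gamma> k \<noteq> 0"
proof (rule ccontr)
  assume "pos \<gamma>" "\<not> (\<exists>k\<in>I. \<gamma> k \<noteq> 0)"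
  then have "expo i \<gamma> k = 0" if "k \<in> I" for i k
    using that by (induction i arbitrary: k) auto
  with \<open>pos \<gamma>\<close> dir_in show False by (force simp: pos_def)
qed

lemma pos_cong: "(\<And>k. k \<in> I \<Longrightarrow> \<gamma> k = \<delta> k) \<Longrightarrow> pos \<gamma> \<longleftrightarrow> pos \<delta>"
proof -
  assume eq: "\<And>k. k \<in> I \<Longrightarrow> \<gamma> k = \<delta> k"
  have "\<forall>k\<in>I. expo i \<gamma> k = expo i \<delta> k" for i
    by (induction i) (use eq in \<open>auto intro: sum.cong\<close>)
  then show ?thesis by (simp add: pos_def)
qed

lemma pos_nonneg:
  assumes "\<forall>k\<in>I. 0 \<le> \<gamma> k" "\<exists>k\<in>I. \<gamma> k \<noteq> 0" shows "pos \<gamma>"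
  using assms nonneg_eventually_pos[of 0 \<gamma>] by (auto simp: pos_def)

lemma pos_archimedean:
  assumes "pos \<gamma>" shows "\<exists>n::nat. pos (\<lambda>k. int n * \<gamma> k - \<delta> k)"
proof -
  obtain j where j: "\<forall>k\<in>I. 0 < expo j \<gamma> k" using assms by (auto simp: pos_def)
  define n where "n = nat (\<Sum>l\<in>I. \<bar>expo j \<delta> l\<bar>) + 1"
  have "0 < expo j (\<lambda>k. int n * \<gamma> k - \<delta> k) k" if "k \<in> I" for k
  proof -
    have "\<bar>expo j \<delta> k\<bar> \<le> (\<Sum>l\<in>I. \<bar>expo j \<delta> l\<bar>)"
      using that finite_I by (intro member_le_sum) auto
    then have "expo j \<delta> k < int n * 1" unfolding n_def by simp
    also have "int n * 1 \<le> int n * expo j \<gamma> k"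
      using j that by (intro mult_left_mono) (auto simp: int_one_le_iff_zero_less)
    finally show ?thesis by (simp add: expo_diff expo_cmul)
  qed
  then show ?thesis unfolding pos_def by blast
qed

text \<open>
  At a stage where all variables have become monomials with positive exponents only, the exponents of a
  monomial are at least its original degree.  Hence all but finitely many monomials exceed a given one.
\<close>

lemma pos_large_degree:
  obtains B where "\<And>\<beta>. \<forall>k\<in>I. 0 \<le> \<beta> k \<Longrightarrow> B < (\<Sum>k\<in>I. \<beta> k) \<Longrightarrow> pos (\<lambda>k. \<beta> k - \<alpha> k)"
proof -
  let ?e = "\<lambda>l k. if k = l then 1 else 0 :: int"
  have "pos (?e l)" if "l \<in> I" for l
    using that by (intro pos_nonneg) auto
  then obtain f where f: "\<And>l. l \<in> I \<Longrightarrow> \<forall>k\<in>I. 0 < expo (f l) (?e l) k"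
    unfolding pos_def by metis
  define j where "j = Max (f ` I)"
  have e: "0 < expo j (?e l) k" if "l \<in> I" "k \<in> I" for l k
    using expo_pos_mono[OF f[OF \<open>l \<in> I\<close>]] that finite_I by (simp add: j_def)
  define B where "B = (\<Sum>l\<in>I. \<bar>expo j \<alpha> l\<bar>)"
  have "pos (\<lambda>k. \<beta> k - \<alpha> k)" if \<beta>: "\<forall>k\<in>I. 0 \<le> \<beta> k" "B < (\<Sum>k\<in>I. \<beta> k)" for \<beta>
  proof -
    define \<beta>' where "\<beta>' = (\<lambda>k. \<Sum>l\<in>I. \<beta> l * ?e l k)"
    have "expo j \<alpha> k < expo j \<beta>' k" if "k \<in> I" for k
    proof -
      have "\<bar>expo j \<alpha> k\<bar> \<le> B"
        unfolding B_def using that finite_I by (intro member_le_sum) auto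
      moreover have "(\<Sum>l\<in>I. \<beta> l) \<le> (\<Sum>l\<in>I. \<beta> l * expo j (?e l) k)"
      proof (rule sum_mono)
        fix l assume "l \<in> I"
        then have "0 \<le> \<beta> l" "1 \<le> expo j (?e l) k" using e[of l k] that \<beta> by auto
        then show "\<beta> l \<le> \<beta> l * expo j (?e l) k"
          using mult_left_mono[of 1 "expo j (?e l) k" "\<beta> l"] by simp
      qed
      moreover have "expo j \<beta>' k = (\<Sum>l\<in>I. \<beta> l * expo j (?e l) k)"
        unfolding \<beta>'_def expo_sum expo_cmul ..
      ultimately show ?thesis using \<beta>(2) by linarith
    qed
    then have "pos (\<lambda>k. \<beta>' k - \<alpha> k)" unfolding pos_def expo_diff by (meson diff_gt_0_iff_gt)
    moreover have "\<beta>' k = \<beta> k" if "k \<in> I" for k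
    proof -
      have "\<beta>' k = (\<Sum>l\<in>I. if k = l then \<beta> l else 0)" unfolding \<beta>'_def by (intro sum.cong) auto
      then show ?thesis using that finite_I by simp
    qed
    ultimately show ?thesis by (subst pos_cong[where \<delta> = "\<lambda>k. \<beta>' k - \<alpha> k"]) auto
  qed
  then show ?thesis using that by blast
qed

end

section \<open>Laurent monomials in an abelian group\<close>

text \<open>
  Laurent monomials are formed in an arbitrary abelian group, since they are needed both in the
  multiplicative group of the field and in the value group.
\<close>

definition laurent_monomial :: "('g, 'm) monoid_scheme \<Rightarrow> 'i set \<Rightarrow> ('i \<Rightarrow> 'g) \<Rightarrow> ('i \<Rightarrow> int) \<Rightarrow> 'g"
  where "laurent_monomial G I y \<gamma> = finprod G (\<lambda>k. y k [^]\<^bsub>G\<^esub> \<gamma> k) I"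

context comm_group
begin

lemma laurent_monomial_closed:
  "y \<in> I \<rightarrow> carrier G \<Longrightarrow> laurent_monomial G I y \<gamma> \<in> carrier G"
  unfolding laurent_monomial_def by (intro finprod_closed) auto

lemma laurent_monomial_add:
  assumes "y \<in> I \<rightarrow> carrier G"
  shows "laurent_monomial G I y (\<lambda>k. \<gamma> k + \<delta> k) =
    laurent_monomial G I y \<gamma> \<otimes> laurent_monomial G I y \<delta>"
proof -
  have "laurent_monomial G I y (\<lambda>k. \<gamma> k + \<delta> k) = finprod G (\<lambda>k. y k [^] \<gamma> k \<otimes> y k [^] \<delta> k) I"
    unfolding laurent_monomial_def using assms by (intro finprod_cong') (auto simp: int_pow_mult Pi_iff)
  also have "\<dots> = laurent_monomial G I y \<gamma> \<otimes> laurent_monomial G I y \<delta>"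
    unfolding laurent_monomial_def using assms by (intro finprod_multf) auto
  finally show ?thesis .
qed

lemma laurent_monomial_cong:
  "y \<in> I \<rightarrow> carrier G \<Longrightarrow> (\<And>k. k \<in> I \<Longrightarrow> \<gamma> k = \<delta> k) \<Longrightarrow>
    laurent_monomial G I y \<gamma> = laurent_monomial G I y \<delta>"
  unfolding laurent_monomial_def by (intro finprod_cong') auto

lemma laurent_monomial_zero: "(\<And>k. k \<in> I \<Longrightarrow> \<gamma> k = 0) \<Longrightarrow> laurent_monomial G I y \<gamma> = \<one>"
  unfolding laurent_monomial_def by (rule finprod_one_eqI) simp

lemma laurent_monomial_single:
  assumes y: "y \<in> I \<rightarrow> carrier G" and "finite I" "k \<in> I"
  shows "laurent_monomial G I y (\<lambda>l. if l = k then c else 0) = y k [^] c"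
proof -
  have "laurent_monomial G I y (\<lambda>l. if l = k then c else 0) =
    finprod G (\<lambda>l. if k = l then y l [^] c else \<one>) I"
    unfolding laurent_monomial_def using assms by (intro finprod_cong') (auto simp: Pi_iff)
  also have "\<dots> = y k [^] c"
    using assms by (intro finprod_singleton) (auto simp: Pi_iff)
  finally show ?thesis .
qed

lemma laurent_monomial_remove:
  assumes y: "y \<in> I \<rightarrow> carrier G" and "finite I" "k \<in> I"
  shows "laurent_monomial G I y \<gamma> = y k [^] \<gamma> k \<otimes> laurent_monomial G (I - {k}) y \<gamma>"
proof -
  have "finprod G (\<lambda>k. y k [^] \<gamma> k) (insert k (I - {k})) =
    y k [^] \<gamma> k \<otimes> laurent_monomial G (I - {k}) y \<gamma>"
    unfolding laurent_monomial_def using assms by (intro finprod_insert) auto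
  then show ?thesis using \<open>k \<in> I\<close> by (simp add: laurent_monomial_def insert_absorb)
qed

lemma laurent_monomial_const:
  assumes "finite I" "g \<in> carrier G"
  shows "laurent_monomial G I (\<lambda>_. g) \<gamma> = g [^] (\<Sum>k\<in>I. \<gamma> k)"
  unfolding laurent_monomial_def using assms by induction (auto simp: int_pow_mult)

text \<open>The effect on exponents of a monomial transformation in the \<open>k\<close>-direction.\<close>

lemma laurent_monomial_substitute:
  assumes y: "y \<in> I \<rightarrow> carrier G" and fin: "finite I" and k: "k \<in> I"
    and xk: "x k = y k" and x: "\<And>l. l \<in> I \<Longrightarrow> l \<noteq> k \<Longrightarrow> x l = y l \<otimes> y k"
  shows "laurent_monomial G I x \<gamma> = laurent_monomial G I y (\<gamma>(k := \<Sum>l\<in>I. \<gamma> l))"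
proof -
  let ?J = "I - {k}"
  have yk: "y k \<in> carrier G" and yJ: "y \<in> ?J \<rightarrow> carrier G" using y k by auto
  have xI: "x \<in> I \<rightarrow> carrier G"
  proof
    fix l assume "l \<in> I"
    then show "x l \<in> carrier G" using y yk xk x by (cases "l = k") auto
  qed
  have "laurent_monomial G ?J x \<gamma> = finprod G (\<lambda>l. y l [^] \<gamma> l \<otimes> y k [^] \<gamma> l) ?J"
    unfolding laurent_monomial_def using yJ yk x
    by (intro finprod_cong') (auto simp: int_pow_distrib Pi_iff)
  also have "\<dots> = laurent_monomial G ?J y \<gamma> \<otimes> laurent_monomial G ?J (\<lambda>_. y k) \<gamma>"
    unfolding laurent_monomial_def using yJ yk by (intro finprod_multf) auto
  finally have J: "laurent_monomial G ?J x \<gamma> =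
      laurent_monomial G ?J y \<gamma> \<otimes> y k [^] (\<Sum>l\<in>?J. \<gamma> l)"
    using fin yk by (simp add: laurent_monomial_const)
  have yJ_closed: "laurent_monomial G ?J y \<gamma> \<in> carrier G" using yJ by (rule laurent_monomial_closed)
  have "laurent_monomial G I x \<gamma> =
      y k [^] \<gamma> k \<otimes> (laurent_monomial G ?J y \<gamma> \<otimes> y k [^] (\<Sum>l\<in>?J. \<gamma> l))"
    using laurent_monomial_remove[OF xI fin k] J xk by simp
  also have "\<dots> = y k [^] \<gamma> k \<otimes> y k [^] (\<Sum>l\<in>?J. \<gamma> l) \<otimes> laurent_monomial G ?J y \<gamma>"
    using yk yJ_closed by (simp add: m_ac)
  also have "y k [^] \<gamma> k \<otimes> y k [^] (\<Sum>l\<in>?J. \<gamma> l) = y k [^] (\<Sum>l\<in>I. \<gamma> l)"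
    using yk sum.remove[OF fin k, of \<gamma>] by (simp add: int_pow_mult)
  also have "laurent_monomial G ?J y \<gamma> = laurent_monomial G ?J y (\<gamma>(k := \<Sum>l\<in>I. \<gamma> l))"
    using yJ by (rule laurent_monomial_cong) auto
  finally show ?thesis
    using laurent_monomial_remove[OF y fin k, of "\<gamma>(k := \<Sum>l\<in>I. \<gamma> l)"] by simp
qed

lemma laurent_monomial_hom:
  assumes "comm_group H" "h \<in> hom G H" "y \<in> I \<rightarrow> carrier G" "finite I"
  shows "h (laurent_monomial G I y \<gamma>) = laurent_monomial H I (\<lambda>k. h (y k)) \<gamma>"
proof -
  interpret H: comm_group H by (rule assms)
  have "h (laurent_monomial G J y \<gamma>) = laurent_monomial H J (\<lambda>k. h (y k)) \<gamma>" if "J \<subseteq> I" for J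
    using finite_subset[OF that \<open>finite I\<close>] that
  proof (induction J)
    case empty
    show ?case
      using hom_one[OF assms(2) is_group H.is_group] laurent_monomial_zero[of "{}" \<gamma> y]
        H.laurent_monomial_zero[of "{}" \<gamma> "\<lambda>k. h (y k)"] by simp
  next
    case (insert k J)
    have y: "y \<in> insert k J \<rightarrow> carrier G" using insert.prems assms(3) by auto
    then have hy: "(\<lambda>k. h (y k)) \<in> insert k J \<rightarrow> carrier H" using assms(2) by (auto simp: hom_def)
    have fin: "finite (insert k J)" and k: "k \<in> insert k J" and Jk: "insert k J - {k} = J"
      using insert.hyps by auto
    have "y \<in> J \<rightarrow> carrier G" "y k \<in> carrier G" using y by auto
    then show ?case
      unfolding laurent_monomial_remove[OF y fin k, unfolded Jk]
        H.laurent_monomial_remove[OF hy fin k, unfolded Jk]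
      using insert hom_mult[OF assms(2), of "y k [^] \<gamma> k" "laurent_monomial G J y \<gamma>"]
        hom_int_pow[OF assms(2) _ is_group H.is_group, of "y k"]
      by (simp add: laurent_monomial_closed)
  qed
  then show ?thesis by blast
qed

end

section \<open>Rational rank of a free abelian group\<close>

context comm_group
begin

text \<open>
  The class of a formal sum in the tensor product.  Equality of classes is membership of the difference
  in the additive group \<open>tensor_null G\<close>, so that the cosets can be handled with the addition of formal
  sums.
\<close>

abbreviation tensor_class :: "(('a \<times> rat) \<Rightarrow>\<^sub>0 int) \<Rightarrow> (('a \<times> rat) \<Rightarrow>\<^sub>0 int) set" where
  "tensor_class y \<equiv> tensor_null G #>\<^bsub>tensor_base G\<^esub> y"

lemma tensor_base_comm_group: "comm_group (tensor_base G)"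
  unfolding tensor_base_def by (rule abelian_free_Abelian_group)

lemma tensor_null_subgroup: "subgroup (tensor_null G) (tensor_base G)"
  unfolding tensor_null_def
proof (rule group.generate_is_subgroup)
  show "group (tensor_base G)" using tensor_base_comm_group by (rule comm_group.axioms(2))
  have diff: "a - b \<in> carrier (tensor_base G)"
    if "a \<in> carrier (tensor_base G)" "b \<in> carrier (tensor_base G)" for a b
    using that keys_diff[of a b] by (auto simp: tensor_base_def)
  have frag: "frag_of (g, q) \<in> carrier (tensor_base G)" if "g \<in> carrier G" for g q
    using that by (simp add: tensor_base_def)
  show "{frag_of (g \<otimes> h, q) - frag_of (g, q) - frag_of (h, q) | g h q.
         g \<in> carrier G \<and> h \<in> carrier G} \<union>
      {frag_of (g, q + r) - frag_of (g, q) - frag_of (g, r) | g q r. g \<in> carrier G}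
      \<subseteq> carrier (tensor_base G)"
    by (auto intro!: diff frag)
qed

lemma tensor_null_0: "0 \<in> tensor_null G"
  and tensor_null_add: "a \<in> tensor_null G \<Longrightarrow> b \<in> tensor_null G \<Longrightarrow> a + b \<in> tensor_null G"
  and tensor_null_keys: "a \<in> tensor_null G \<Longrightarrow> Poly_Mapping.keys a \<subseteq> carrier G \<times> UNIV"
  using subgroup.one_closed[OF tensor_null_subgroup]
    subgroup.m_closed[OF tensor_null_subgroup] subgroup.mem_carrier[OF tensor_null_subgroup]
  by (simp_all add: tensor_base_def)

lemma tensor_null_uminus: "a \<in> tensor_null G \<Longrightarrow> - a \<in> tensor_null G"
  using subgroup.m_inv_closed[OF tensor_null_subgroup, of a] tensor_null_keys[of a]
  by (simp add: tensor_base_def)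

lemma tensor_null_diff: "a \<in> tensor_null G \<Longrightarrow> b \<in> tensor_null G \<Longrightarrow> a - b \<in> tensor_null G"
  using tensor_null_add[of a "- b"] tensor_null_uminus[of b] by simp

lemma tensor_class_conv: "tensor_class y = (\<lambda>n. n + y) ` tensor_null G"
  by (auto simp: r_coset_def tensor_base_def)

lemma tensor_class_eq_iff: "tensor_class a = tensor_class b \<longleftrightarrow> a - b \<in> tensor_null G"
proof
  assume "tensor_class a = tensor_class b"
  then have "0 + a \<in> (\<lambda>n. n + b) ` tensor_null G"
    unfolding tensor_class_conv using tensor_null_0 by (metis imageI)
  then show "a - b \<in> tensor_null G" by auto
next
  assume *: "a - b \<in> tensor_null G"
  have "n + a \<in> (\<lambda>n. n + b) ` tensor_null G" if "n \<in> tensor_null G" for n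
    using tensor_null_add[OF that *] by (intro image_eqI[of _ _ "n + (a - b)"]) auto
  moreover have "n + b \<in> (\<lambda>n. n + a) ` tensor_null G" if "n \<in> tensor_null G" for n
    using tensor_null_diff[OF that *] by (intro image_eqI[of _ _ "n - (a - b)"]) auto
  ultimately show "tensor_class a = tensor_class b" unfolding tensor_class_conv by blast
qed

lemma rat_tensor_comm_group: "comm_group (rat_tensor G)"
  unfolding rat_tensor_def
  by (rule comm_group.abelian_FactGroup[OF tensor_base_comm_group tensor_null_subgroup])

lemma rat_tensor_one: "\<one>\<^bsub>rat_tensor G\<^esub> = tensor_class 0"
  by (simp add: rat_tensor_def tensor_class_conv)

lemma carrier_rat_tensor:
  "carrier (rat_tensor G) = tensor_class ` {y. Poly_Mapping.keys y \<subseteq> carrier G \<times> UNIV}"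
  unfolding rat_tensor_def carrier_FactGroup by (simp add: tensor_base_def free_Abelian_group_def)

lemma rat_tensor_mult:
  "tensor_class a \<otimes>\<^bsub>rat_tensor G\<^esub> tensor_class b = tensor_class (a + b)"
proof -
  have "tensor_class a \<otimes>\<^bsub>rat_tensor G\<^esub> tensor_class b =
    {h + k | h k. h \<in> tensor_class a \<and> k \<in> tensor_class b}"
    by (auto simp: rat_tensor_def set_mult_def tensor_base_def)
  also have "\<dots> = tensor_class (a + b)"
  proof (intro Set.set_eqI iffI)
    fix z assume "z \<in> {h + k | h k. h \<in> tensor_class a \<and> k \<in> tensor_class b}"
    then obtain n n' where "n \<in> tensor_null G" "n' \<in> tensor_null G" "z = (n + a) + (n' + b)"
      by (auto simp: tensor_class_conv)
    then show "z \<in> tensor_class (a + b)"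
      unfolding tensor_class_conv
      by (intro image_eqI[of _ _ "n + n'"]) (auto simp: tensor_null_add)
  next
    fix z assume "z \<in> tensor_class (a + b)"
    then obtain n where "n \<in> tensor_null G" "z = (n + a) + (0 + b)"
      by (auto simp: tensor_class_conv add.assoc)
    then show "z \<in> {h + k | h k. h \<in> tensor_class a \<and> k \<in> tensor_class b}"
      unfolding tensor_class_conv using tensor_null_0 by blast
  qed
  finally show ?thesis .
qed

lemma pure_tensor_closed: "g \<in> carrier G \<Longrightarrow> pure_tensor G g q \<in> carrier (rat_tensor G)"
  by (auto simp: pure_tensor_def carrier_rat_tensor)

lemma pure_tensor_mult:
  assumes "g \<in> carrier G" "h \<in> carrier G"
  shows "pure_tensor G (g \<otimes> h) q = pure_tensor G g q \<otimes>\<^bsub>rat_tensor G\<^esub> pure_tensor G h q"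
proof -
  have "frag_of (g \<otimes> h, q) - frag_of (g, q) - frag_of (h, q) \<in> tensor_null G"
    unfolding tensor_null_def using assms by (blast intro: generate.incl)
  then show ?thesis
    unfolding pure_tensor_def rat_tensor_mult tensor_class_eq_iff by (simp add: diff_diff_eq)
qed

lemma pure_tensor_add:
  assumes "g \<in> carrier G"
  shows "pure_tensor G g (q + r) = pure_tensor G g q \<otimes>\<^bsub>rat_tensor G\<^esub> pure_tensor G g r"
proof -
  have "frag_of (g, q + r) - frag_of (g, q) - frag_of (g, r) \<in> tensor_null G"
    unfolding tensor_null_def using assms by (blast intro: generate.incl)
  then show ?thesis
    unfolding pure_tensor_def rat_tensor_mult tensor_class_eq_iff by (simp add: diff_diff_eq)
qed

lemma pure_tensor_hom: "(\<lambda>g. pure_tensor G g q) \<in> hom G (rat_tensor G)"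
  by (intro homI pure_tensor_closed pure_tensor_mult)

lemma pure_tensor_hom_integer:
  "g \<in> carrier G \<Longrightarrow> (\<lambda>n. pure_tensor G g (of_int n * q)) \<in> hom integer_group (rat_tensor G)"
  by (intro homI) (auto simp: pure_tensor_closed pure_tensor_add[symmetric] ring_distribs)

text \<open>
  Both sides, as functions of \<open>n\<close>, are powers of the same tensor, because \<open>\<otimes>\<close> is additive in each of
  its two arguments.
\<close>

lemma pure_tensor_int_pow:
  assumes "g \<in> carrier G"
  shows "pure_tensor G (g [^] (n :: int)) q = pure_tensor G g (of_int n * q)"
proof -
  have T: "group (rat_tensor G)" using rat_tensor_comm_group by (rule comm_group.axioms(2))
  interpret A: group_hom G "rat_tensor G" "\<lambda>g. pure_tensor G g q"
    using T pure_tensor_hom by (intro group_hom.intro group_hom_axioms.intro) (auto simp: is_group)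
  interpret B: group_hom integer_group "rat_tensor G" "\<lambda>n. pure_tensor G g (of_int n * q)"
    using T pure_tensor_hom_integer[OF assms]
    by (intro group_hom.intro group_hom_axioms.intro) auto
  have "pure_tensor G (g [^] n) q = pure_tensor G g q [^]\<^bsub>rat_tensor G\<^esub> n"
    using assms by (rule A.hom_int_pow)
  also have "\<dots> = pure_tensor G g (of_int (1 [^]\<^bsub>integer_group\<^esub> n) * q)"
    using B.hom_int_pow[of 1 n] by simp
  finally show ?thesis by simp
qed

lemma pure_tensor_finprod:
  assumes "finite I" "f \<in> I \<rightarrow> carrier G"
  shows "pure_tensor G (finprod G f I) q = finprod (rat_tensor G) (\<lambda>i. pure_tensor G (f i) q) I"
  using assms
proof (induction I)
  case empty
  have "group (rat_tensor G)" using rat_tensor_comm_group by (rule comm_group.axioms(2))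
  then show ?case
    using hom_one[OF pure_tensor_hom is_group] comm_group.axioms(1)[OF rat_tensor_comm_group]
    by (simp add: comm_monoid.finprod_empty)
next
  case (insert i I)
  interpret T: comm_group "rat_tensor G" by (rule rat_tensor_comm_group)
  have "(\<lambda>i. pure_tensor G (f i) q) \<in> insert i I \<rightarrow> carrier (rat_tensor G)"
    using insert.prems by (auto intro: pure_tensor_closed)
  then show ?case using insert
    by (simp add: pure_tensor_mult Pi_iff)
qed

text \<open>Scaling the rational entries maps each bilinearity relation to a bilinearity relation.\<close>

lemma frag_extend_scale_null:
  assumes "y \<in> tensor_null G"
  shows "frag_extend (\<lambda>(g, q). frag_of (g, c * q)) y \<in> tensor_null G" (is "?S y \<in> _")
proof -
  let ?A = "{frag_of (g \<otimes> h, q) - frag_of (g, q) - frag_of (h, q) | g h q.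
         g \<in> carrier G \<and> h \<in> carrier G}"
    and ?B = "{frag_of (g, q + r) - frag_of (g, q) - frag_of (g, r) | g q r. g \<in> carrier G}"
  have gen: "?S y \<in> tensor_null G" "y \<in> tensor_null G" if "y \<in> ?A \<union> ?B" for y
  proof -
    show "y \<in> tensor_null G" unfolding tensor_null_def using that by (rule generate.incl)
    from that have "?S y \<in> ?A \<union> ?B"
    proof
      assume "y \<in> ?A"
      then have "?S y \<in> ?A" by (force simp: frag_extend_diff)
      then show ?thesis by blast
    next
      assume "y \<in> ?B"
      then have "?S y \<in> ?B" by (force simp: frag_extend_diff ring_distribs)
      then show ?thesis by blast
    qed
    then show "?S y \<in> tensor_null G" unfolding tensor_null_def by (rule generate.incl)
  qed
  have "y \<in> generate (tensor_base G) (?A \<union> ?B)" using assms by (simp add: tensor_null_def)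
  then show ?thesis
  proof (induction y rule: generate.induct)
    case (inv h)
    then have "inv\<^bsub>tensor_base G\<^esub> h = - h"
      using tensor_null_keys[OF gen(2)] by (simp add: tensor_base_def)
    then show ?case using gen(1)[OF inv] tensor_null_uminus by (simp add: frag_extend_minus)
  next
    case (eng h1 h2)
    then show ?case using tensor_null_add by (simp add: tensor_base_def frag_extend_add)
  qed (use gen tensor_null_0 in \<open>auto simp: tensor_base_def\<close>)
qed

lemma rat_scale_pure_tensor: "rat_scale G c (pure_tensor G g q) = pure_tensor G g (c * q)"
proof -
  let ?S = "frag_extend (\<lambda>(g :: 'a, q). frag_of (g, c * q))"
  have "rat_scale G c (pure_tensor G g q) =
    {n + ?S (n' + frag_of (g, q)) | n n'. n \<in> tensor_null G \<and> n' \<in> tensor_null G}"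
    unfolding rat_scale_def pure_tensor_def tensor_class_conv
    by (auto simp: set_mult_def tensor_base_def)
  also have "\<dots> = (\<lambda>n. n + frag_of (g, c * q)) ` tensor_null G"
  proof (intro Set.set_eqI iffI)
    fix z assume "z \<in> {n + ?S (n' + frag_of (g, q)) | n n'. n \<in> tensor_null G \<and> n' \<in> tensor_null G}"
    then obtain n n' where "n \<in> tensor_null G" "n' \<in> tensor_null G"
      "z = (n + ?S n') + frag_of (g, c * q)"
      by (auto simp: frag_extend_add add.assoc)
    then show "z \<in> (\<lambda>n. n + frag_of (g, c * q)) ` tensor_null G"
      using frag_extend_scale_null tensor_null_add by blast
  next
    fix z assume "z \<in> (\<lambda>n. n + frag_of (g, c * q)) ` tensor_null G"
    then obtain n where "n \<in> tensor_null G" "z = n + ?S (0 + frag_of (g, q))"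
      by auto
    then show "z \<in> {n + ?S (n' + frag_of (g, q)) | n n'. n \<in> tensor_null G \<and> n' \<in> tensor_null G}"
      using tensor_null_0 by blast
  qed
  finally show ?thesis by (simp add: pure_tensor_def tensor_class_conv)
qed

lemma rat_combination_pure_tensor:
  assumes "e \<in> I \<rightarrow> carrier G"
  shows "rat_combination G I c (\<lambda>i. pure_tensor G (e i) 1) =
    finprod (rat_tensor G) (\<lambda>i. pure_tensor G (e i) (c i)) I"
  unfolding rat_combination_def by (simp add: rat_scale_pure_tensor)

lemma finprod_pure_tensor:
  assumes "finite I" "e \<in> I \<rightarrow> carrier G"
  shows "finprod (rat_tensor G) (\<lambda>i. pure_tensor G (e i) (c i)) I =
    tensor_class (\<Sum>i\<in>I. frag_of (e i, c i))"
  using assms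
proof (induction I)
  case empty
  show ?case
    using comm_group.axioms(1)[OF rat_tensor_comm_group]
    by (simp add: comm_monoid.finprod_empty rat_tensor_one)
next
  case (insert i I)
  interpret T: comm_group "rat_tensor G" by (rule rat_tensor_comm_group)
  have "(\<lambda>i. pure_tensor G (e i) (c i)) \<in> insert i I \<rightarrow> carrier (rat_tensor G)"
    using insert.prems by (auto intro: pure_tensor_closed)
  then show ?case using insert
    by (simp add: Pi_iff) (simp add: pure_tensor_def rat_tensor_mult)
qed

text \<open>
  A coordinate of the group extends to a rational functional on formal sums that respects the
  bilinearity relations.  These functionals detect linear independence in the tensor product.
\<close>

lemma rational_functional:
  fixes \<phi> :: "'a \<Rightarrow> int"
  assumes "\<And>g h. g \<in> carrier G \<Longrightarrow> h \<in> carrier G \<Longrightarrow> \<phi> (g \<otimes> h) = \<phi> g + \<phi> h"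
  obtains \<Phi> :: "(('a \<times> rat) \<Rightarrow>\<^sub>0 int) \<Rightarrow> rat" where
    "\<And>a b. \<Phi> (a + b) = \<Phi> a + \<Phi> b"
    "\<And>g q. \<Phi> (frag_of (g, q)) = of_int (\<phi> g) * q"
    "\<And>y. y \<in> tensor_null G \<Longrightarrow> \<Phi> y = 0"
proof -
  let ?Q = "\<lparr>carrier = UNIV, monoid.mult = (+), one = 0 :: rat\<rparr>"
  have inv_ex: "\<exists>y. y + x = (0::rat)" for x by (rule exI[of _ "- x"]) simp
  interpret Q: comm_group ?Q
    by (rule comm_groupI) (use inv_ex in \<open>auto simp: add.assoc add.commute\<close>)
  obtain \<Phi> where \<Phi>: "\<Phi> \<in> hom (free_Abelian_group UNIV) ?Q"
    "\<And>x. \<Phi> (frag_of x) = of_int (\<phi> (fst x)) * snd x"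
    using Q.free_Abelian_group_universal[of "\<lambda>x. of_int (\<phi> (fst x)) * snd x" UNIV] by auto
  have add: "\<Phi> (a + b) = \<Phi> a + \<Phi> b" for a b
    using hom_mult[OF \<Phi>(1), of a b] by simp
  have zero: "\<Phi> 0 = 0" using add[of 0 0] by simp
  have minus: "\<Phi> (- a) = - \<Phi> a" for a using add[of "- a" a] zero by simp
  have diff: "\<Phi> (a - b) = \<Phi> a - \<Phi> b" for a b using add[of a "- b"] minus[of b] by simp
  have "\<Phi> y = 0" if "y \<in> tensor_null G" for y
  proof -
    let ?X = "{frag_of (g \<otimes> h, q) - frag_of (g, q) - frag_of (h, q) | g h q.
         g \<in> carrier G \<and> h \<in> carrier G} \<union>
      {frag_of (g, q + r) - frag_of (g, q) - frag_of (g, r) | g q r. g \<in> carrier G}"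
    have gen: "\<Phi> y = 0" if "y \<in> ?X" for y
      using that assms by (auto simp: diff \<Phi>(2) ring_distribs)
    have "y \<in> generate (tensor_base G) ?X" using that by (simp add: tensor_null_def)
    then show ?thesis
    proof (induction y rule: generate.induct)
      case (inv h)
      have "h \<in> tensor_null G" unfolding tensor_null_def using inv by (rule generate.incl)
      then have "inv\<^bsub>tensor_base G\<^esub> h = - h"
        using tensor_null_keys by (simp add: tensor_base_def)
      then show ?case using gen[OF inv] by (simp add: minus)
    qed (auto simp: tensor_base_def zero add gen)
  qed
  with add \<Phi>(2) show ?thesis by (intro that[of \<Phi>]) auto
qed

text \<open>
  If \<open>G\<close> is free on the family \<open>e\<close>, with coordinates \<open>\<phi>\<close>, then the tensors \<open>e k \<otimes> 1\<close> form a basis of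
  the tensor product: the coordinates prove independence, and \<open>g \<otimes> q\<close> is the sum of the tensors
  \<open>e k \<otimes> (\<phi> k g * q)\<close>.
\<close>

lemma
  fixes \<phi> :: "'i \<Rightarrow> 'a \<Rightarrow> int"
  assumes fin: "finite I" and e: "e \<in> I \<rightarrow> carrier G"
    and \<phi>_mult: "\<And>k g h. k \<in> I \<Longrightarrow> g \<in> carrier G \<Longrightarrow> h \<in> carrier G \<Longrightarrow> \<phi> k (g \<otimes> h) = \<phi> k g + \<phi> k h"
    and \<phi>_e: "\<And>k l. k \<in> I \<Longrightarrow> l \<in> I \<Longrightarrow> \<phi> k (e l) = (if k = l then 1 else 0)"
    and basis: "\<And>g. g \<in> carrier G \<Longrightarrow> g = laurent_monomial G I e (\<lambda>k. \<phi> k g)"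
  shows free_basis_rationally_independent: "rationally_independent G I e"
    and free_basis_rational_rank: "has_rational_rank G (card I)"
proof -
  interpret T: comm_group "rat_tensor G" by (rule rat_tensor_comm_group)
  let ?t = "\<lambda>k. pure_tensor G (e k) 1"
  note comb = rat_combination_pure_tensor[OF e]
  have indep: "\<forall>k\<in>I. c k = 0" if c: "rat_combination G I c ?t = \<one>\<^bsub>rat_tensor G\<^esub>" for c
  proof
    fix k assume k: "k \<in> I"
    from rational_functional[OF \<phi>_mult[OF k]]
    obtain \<Phi> where \<Phi>: "\<And>a b. \<Phi> (a + b) = \<Phi> a + \<Phi> b"
      "\<And>g q. \<Phi> (frag_of (g, q)) = of_int (\<phi> k g) * q"
      "\<And>y. y \<in> tensor_null G \<Longrightarrow> \<Phi> y = 0" by metis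
    have "(\<Sum>i\<in>I. frag_of (e i, c i)) \<in> tensor_null G"
      using c finprod_pure_tensor[OF fin e] comb
      by (simp add: rat_tensor_one tensor_class_eq_iff)
    then have "0 = \<Phi> (\<Sum>i\<in>I. frag_of (e i, c i))" using \<Phi>(3) by simp
    also have "\<dots> = (\<Sum>i\<in>I. \<Phi> (frag_of (e i, c i)))"
      using fin by induction (use \<Phi>(1) \<Phi>(3)[OF tensor_null_0] in auto)
    also have "\<dots> = (\<Sum>i\<in>I. if k = i then c i else 0)"
      using k \<phi>_e by (intro sum.cong) (auto simp: \<Phi>(2))
    also have "\<dots> = c k" using fin k by simp
    finally show "c k = 0" by simp
  qed
  then show "rationally_independent G I e"
    by (simp add: rationally_independent_def rat_lin_indep_def)
  have t: "?t \<in> I \<rightarrow> carrier (rat_tensor G)" using e by (auto intro: pure_tensor_closed)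
  \<comment> \<open>The rank is stated with a set of tensors, so equal tensors must be excluded: they would satisfy
    the relation with coefficients \<open>1\<close> and \<open>-1\<close>.\<close>
  have inj: "inj_on ?t I"
  proof (rule inj_onI, rule ccontr)
    fix i j assume ij: "i \<in> I" "j \<in> I" "?t i = ?t j" "i \<noteq> j"
    define c where "c = (\<lambda>k. if k = i then 1 else if k = j then -1 else 0 :: rat)"
    have pure0: "pure_tensor G (e k) 0 = \<one>\<^bsub>rat_tensor G\<^esub>" if "k \<in> I" for k
      using pure_tensor_int_pow[of "e k" 0 1] pure_tensor_finprod[of "{}" "\<lambda>_. \<one>" 1] that e by auto
    have "rat_combination G I c ?t =
      finprod (rat_tensor G) (\<lambda>k. pure_tensor G (e k) (c k)) {i, j}"
      unfolding comb using fin ij e pure0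
      by (intro T.finprod_mono_neutral_cong_right) (auto simp: c_def Pi_iff intro: pure_tensor_closed)
    also have "\<dots> = pure_tensor G (e i) 1 \<otimes>\<^bsub>rat_tensor G\<^esub> pure_tensor G (e j) (-1)"
      using ij e by (simp add: c_def Pi_iff pure_tensor_closed)
    also have "\<dots> = pure_tensor G (e j) (1 + -1)"
      using ij e pure_tensor_add[of "e j" 1 "-1"] by (auto simp del: add.right_inverse)
    also have "\<dots> = \<one>\<^bsub>rat_tensor G\<^esub>" using pure0 ij by simp
    finally show False using indep[of c] ij by (auto simp: c_def)
  qed
  have reindex: "rat_combination G (?t ` I) c (\<lambda>b. b) = rat_combination G I (\<lambda>k. c (?t k)) ?t" for c
    unfolding rat_combination_def using inj e
    by (subst T.finprod_reindex) (auto simp: rat_scale_pure_tensor Pi_iff intro: pure_tensor_closed)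
  define W where "W = range (\<lambda>c. finprod (rat_tensor G) (\<lambda>k. pure_tensor G (e k) (c k)) I)"
  have pure_in: "pure_tensor G g q \<in> W" if g: "g \<in> carrier G" for g q
  proof -
    have "pure_tensor G g q = pure_tensor G (finprod G (\<lambda>k. e k [^] \<phi> k g) I) q"
      using basis[OF g] by (simp add: laurent_monomial_def)
    also have "\<dots> = finprod (rat_tensor G) (\<lambda>k. pure_tensor G (e k [^] \<phi> k g) q) I"
      using e by (intro pure_tensor_finprod fin) auto
    also have "\<dots> = finprod (rat_tensor G) (\<lambda>k. pure_tensor G (e k) (of_int (\<phi> k g) * q)) I"
      using e by (intro T.finprod_cong') (auto simp: pure_tensor_int_pow Pi_iff intro: pure_tensor_closed)
    finally show ?thesis unfolding W_def by (rule range_eqI[where x = "\<lambda>k. of_int (\<phi> k g) * q"])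
  qed
  have W_mult: "a \<otimes>\<^bsub>rat_tensor G\<^esub> b \<in> W" if ab: "a \<in> W" "b \<in> W" for a b
  proof -
    obtain c c' where "a = finprod (rat_tensor G) (\<lambda>k. pure_tensor G (e k) (c k)) I"
      "b = finprod (rat_tensor G) (\<lambda>k. pure_tensor G (e k) (c' k)) I"
      using ab unfolding W_def by blast
    then have "a \<otimes>\<^bsub>rat_tensor G\<^esub> b =
      finprod (rat_tensor G) (\<lambda>k. pure_tensor G (e k) (c k) \<otimes>\<^bsub>rat_tensor G\<^esub> pure_tensor G (e k) (c' k)) I"
      using e by (simp add: T.finprod_multf Pi_iff pure_tensor_closed)
    also have "\<dots> = finprod (rat_tensor G) (\<lambda>k. pure_tensor G (e k) (c k + c' k)) I"
      using e by (intro T.finprod_cong') (auto simp: pure_tensor_add Pi_iff intro: pure_tensor_closed)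
    finally show ?thesis unfolding W_def by (rule range_eqI[where x = "\<lambda>k. c k + c' k"])
  qed
  have pure_neg: "tensor_class (- frag_of (g, q)) = pure_tensor G g (- q)" if "g \<in> carrier G" for g q
  proof -
    have "frag_of (g, 0 + 0) - frag_of (g, 0) - frag_of (g, 0) \<in> tensor_null G"
      "frag_of (g, q + - q) - frag_of (g, q) - frag_of (g, - q) \<in> tensor_null G"
      unfolding tensor_null_def using that by (blast intro: generate.incl)+
    from tensor_null_add[OF this(2) this(1)] show ?thesis
      unfolding pure_tensor_def tensor_class_eq_iff by (simp add: algebra_simps)
  qed
  have span: "tensor_class y \<in> W" if "Poly_Mapping.keys y \<subseteq> carrier G \<times> UNIV" for y
  proof -
    have "tensor_class y \<in> W \<and> tensor_class (- y) \<in> W"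
      using that
    proof (induction y rule: frag_induction)
      case zero
      have "tensor_class 0 = pure_tensor G \<one> 0"
        using pure_tensor_finprod[of "{}" "\<lambda>_. \<one>" 0] by (simp add: rat_tensor_one)
      then show ?case using pure_in[of \<one> 0] by simp
    next
      case (one x)
      then show ?case using pure_in pure_neg by (auto simp: pure_tensor_def[symmetric])
    next
      case (diff a b)
      then have "tensor_class (a + - b) \<in> W" "tensor_class (b + - a) \<in> W"
        unfolding rat_tensor_mult[symmetric] by (blast intro: W_mult)+
      then show ?case by simp
    qed
    then show ?thesis ..
  qed
  show "has_rational_rank G (card I)"
    unfolding has_rational_rank_def
  proof (intro exI[of _ "?t ` I"] conjI ballI)
    show "?t ` I \<subseteq> carrier (rat_tensor G)" using t by auto
    show "finite (?t ` I)" using fin by simp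
    show "card (?t ` I) = card I" using inj by (rule card_image)
    show "rat_lin_indep G (?t ` I) (\<lambda>b. b)"
      unfolding rat_lin_indep_def reindex using indep by blast
    fix y assume "y \<in> carrier (rat_tensor G)"
    then have "y \<in> W" using span by (auto simp: carrier_rat_tensor)
    then obtain c where c: "y = finprod (rat_tensor G) (\<lambda>k. pure_tensor G (e k) (c k)) I"
      unfolding W_def by blast
    have inv: "inv_into I ?t (?t k) = k" if "k \<in> I" for k
      using inj that by (rule inv_into_f_f)
    have "rat_combination G I (\<lambda>k. c (inv_into I ?t (?t k))) ?t = y"
      unfolding comb c using e inv
      by (intro T.finprod_cong') (simp_all add: Pi_iff pure_tensor_closed)
    then show "\<exists>c. y = rat_combination G (?t ` I) c (\<lambda>b. b)"
      unfolding reindex by (intro exI[of _ "\<lambda>b. c (inv_into I ?t b)"]) simp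
  qed
qed

end

section \<open>Valuations of a field\<close>

context field
begin

lemma valuation_mult:
  fixes v :: "'a \<Rightarrow> 'g :: linordered_ab_group_add"
  assumes "valuation R v" "a \<in> carrier R - {\<zero>}" "b \<in> carrier R - {\<zero>}"
  shows "v (a \<otimes> b) = v a + v b"
  using assms unfolding valuation_def by blast

lemma valuation_add:
  fixes v :: "'a \<Rightarrow> 'g :: linordered_ab_group_add"
  assumes "valuation R v" "a \<in> carrier R - {\<zero>}" "b \<in> carrier R - {\<zero>}" "a \<oplus> b \<noteq> \<zero>"
  shows "min (v a) (v b) \<le> v (a \<oplus> b)"
  using assms unfolding valuation_def by blast

lemma valuation_one:
  fixes v :: "'a \<Rightarrow> 'g :: linordered_ab_group_add"
  assumes "valuation R v" shows "v \<one> = 0"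
  using valuation_mult[OF assms, of \<one> \<one>] by simp

lemma valuation_inv:
  fixes v :: "'a \<Rightarrow> 'g :: linordered_ab_group_add"
  assumes v: "valuation R v" and a: "a \<in> carrier R - {\<zero>}"
  shows "v (inv a) = - v a"
proof -
  have "a \<in> Units R" using a field_Units by simp
  then have "inv a \<in> carrier R - {\<zero>}" "a \<otimes> inv a = \<one>"
    using Units_inv_Units field_Units by auto
  then have "v a + v (inv a) = 0"
    using valuation_mult[OF v a, of "inv a"] valuation_one[OF v] by simp
  then show ?thesis by (simp add: eq_neg_iff_add_eq_0 add.commute)
qed

lemma valuation_uminus:
  fixes v :: "'a \<Rightarrow> 'g :: linordered_ab_group_add"
  assumes v: "valuation R v" and a: "a \<in> carrier R - {\<zero>}"
  shows "v (\<ominus> a) = v a"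
proof -
  have one: "\<ominus> \<one> \<in> carrier R - {\<zero>}"
    using one_not_zero by (metis Diff_iff a_inv_closed minus_minus minus_zero one_closed singletonD singletonI)
  have "v (\<ominus> \<one>) + v (\<ominus> \<one>) = v (\<ominus> \<one> \<otimes> \<ominus> \<one>)" using valuation_mult[OF v one one] by simp
  also have "\<ominus> \<one> \<otimes> \<ominus> \<one> = \<one>" by (simp add: l_minus)
  finally have "v (\<ominus> \<one>) = 0" using valuation_one[OF v] by (simp add: double_zero)
  moreover have "\<ominus> a = \<ominus> \<one> \<otimes> a" using a by (simp add: l_minus)
  ultimately show ?thesis using valuation_mult[OF v one a] by simp
qed

lemma valuation_add_distinct:
  fixes v :: "'a \<Rightarrow> 'g :: linordered_ab_group_add"
  assumes v: "valuation R v" and a: "a \<in> carrier R - {\<zero>}" and b: "b \<in> carrier R - {\<zero>}"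
    and ne: "v a \<noteq> v b"
  shows "a \<oplus> b \<noteq> \<zero>" "v (a \<oplus> b) = min (v a) (v b)"
proof -
  have less: "a \<oplus> b \<noteq> \<zero> \<and> v (a \<oplus> b) = v a"
    if a: "a \<in> carrier R - {\<zero>}" and b: "b \<in> carrier R - {\<zero>}" and "v a < v b" for a b
  proof -
    have nz: "a \<oplus> b \<noteq> \<zero>"
    proof
      assume "a \<oplus> b = \<zero>"
      then have "a = \<ominus> b" using a b by (intro minus_equality[symmetric]) auto
      then show False using valuation_uminus[OF v b] \<open>v a < v b\<close> by simp
    qed
    have ab: "a \<oplus> b \<in> carrier R - {\<zero>}" using nz a b by simp
    have mb: "\<ominus> b \<in> carrier R - {\<zero>}" using b minus_minus[of b] by auto
    have a_eq: "(a \<oplus> b) \<oplus> \<ominus> b = a" using a b by (simp add: a_assoc r_neg)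
    have "min (v (a \<oplus> b)) (v b) \<le> v a"
      using valuation_add[OF v ab mb] a_eq a valuation_uminus[OF v b] by auto
    then have "v (a \<oplus> b) \<le> v a" using \<open>v a < v b\<close> by (simp add: min_le_iff_disj not_le[symmetric])
    moreover have "v a \<le> v (a \<oplus> b)"
      using valuation_add[OF v a b nz] \<open>v a < v b\<close> by simp
    ultimately show ?thesis using nz by simp
  qed
  show "a \<oplus> b \<noteq> \<zero>" "v (a \<oplus> b) = min (v a) (v b)"
    using less[OF a b] less[OF b a] ne a b a_comm[of a b] by (auto simp: neq_iff min_def)
qed

text \<open>
  The sum of all terms but one has the value of one of these terms, which differs from the value of the
  remaining term; so nothing cancels.
\<close>

lemma valuation_finsum_distinct:
  fixes v :: "'a \<Rightarrow> 'g :: linordered_ab_group_add"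
  assumes v: "valuation R v" and "finite G" "G \<noteq> {}" "t \<in> G \<rightarrow> carrier R - {\<zero>}" "inj_on (v \<circ> t) G"
  shows "finsum R t G \<noteq> \<zero> \<and> v (finsum R t G) = Min (v ` t ` G)"
  using assms(2-)
proof (induction G rule: finite_ne_induct)
  case (singleton g)
  then show ?case by auto
next
  case (insert g G)
  have tG: "t \<in> G \<rightarrow> carrier R" "t g \<in> carrier R - {\<zero>}" using insert.prems by auto
  have IH: "finsum R t G \<noteq> \<zero>" "v (finsum R t G) = Min (v ` t ` G)"
    using insert by (auto simp: inj_on_def)
  have "Min (v ` t ` G) \<in> v ` t ` G" using insert.hyps by (intro Min_in) auto
  then obtain g' where g': "g' \<in> G" "v (finsum R t G) = v (t g')" unfolding IH(2) by blast
  then have "v (t g) \<noteq> v (finsum R t G)"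
    using insert.hyps(3) insert.prems(2) by (metis comp_apply inj_onD insertI1 insertI2)
  moreover have "finsum R t G \<in> carrier R - {\<zero>}" using IH(1) tG by simp
  moreover have "finsum R t (insert g G) = t g \<oplus> finsum R t G"
    using insert.hyps tG by (intro finsum_insert) auto
  ultimately show ?case
    using valuation_add_distinct[OF v tG(2)] IH(2) insert.hyps by simp
qed

end

section \<open>Ideals and local subrings of a field\<close>

lemma (in cring) subring_idealI:
  assumes S: "subring S R" and J: "J \<subseteq> S" "\<zero> \<in> J"
    and add: "\<And>a b. a \<in> J \<Longrightarrow> b \<in> J \<Longrightarrow> a \<oplus> b \<in> J"
    and mult: "\<And>r a. r \<in> S \<Longrightarrow> a \<in> J \<Longrightarrow> r \<otimes> a \<in> J"
  shows "ideal J (R\<lparr>carrier := S\<rparr>)"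
proof (rule idealI)
  note SR = subringE(1)[OF S]
  have uminus: "\<ominus> a \<in> J" if "a \<in> J" for a
  proof -
    have "\<ominus> \<one> \<otimes> a \<in> J" using that mult subringE(3,5)[OF S] by blast
    then show ?thesis using that J SR by (simp add: l_minus subset_iff)
  qed
  show "ring (R\<lparr>carrier := S\<rparr>)" using S subring_iff[OF SR] by simp
  then interpret S: ring "R\<lparr>carrier := S\<rparr>" .
  show "subgroup J (add_monoid (R\<lparr>carrier := S\<rparr>))"
  proof
    show "inv\<^bsub>add_monoid (R\<lparr>carrier := S\<rparr>)\<^esub> a \<in> J" if "a \<in> J" for a
    proof -
      have "\<ominus>\<^bsub>R\<lparr>carrier := S\<rparr>\<^esub> a = \<ominus> a"
        using that J SR uminus[OF that] by (intro S.minus_equality) (auto simp: l_neg subset_iff)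
      then show ?thesis using uminus[OF that] by (simp add: a_inv_def)
    qed
  qed (use J add subringE(7)[OF S] in auto)
  show "x \<otimes>\<^bsub>R\<lparr>carrier := S\<rparr>\<^esub> a \<in> J" if "a \<in> J" "x \<in> carrier (R\<lparr>carrier := S\<rparr>)" for a x
    using mult that by simp
  then show "a \<otimes>\<^bsub>R\<lparr>carrier := S\<rparr>\<^esub> x \<in> J" if "a \<in> J" "x \<in> carrier (R\<lparr>carrier := S\<rparr>)" for a x
  proof -
    have "a \<in> carrier R" "x \<in> carrier R" using that J SR by auto
    then show ?thesis using mult[of x a] that m_comm[of x a] by simp
  qed
qed

lemma subring_idealD:
  assumes "ideal J (R\<lparr>carrier := S\<rparr>)"
  shows "J \<subseteq> S" "\<zero>\<^bsub>R\<^esub> \<in> J" "\<And>a b. a \<in> J \<Longrightarrow> b \<in> J \<Longrightarrow> a \<oplus>\<^bsub>R\<^esub> b \<in> J"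
    "\<And>r a. r \<in> S \<Longrightarrow> a \<in> J \<Longrightarrow> r \<otimes>\<^bsub>R\<^esub> a \<in> J"
proof -
  interpret ideal J "R\<lparr>carrier := S\<rparr>" by (rule assms)
  show "J \<subseteq> S" using a_subset by simp
  show "\<zero>\<^bsub>R\<^esub> \<in> J" using additive_subgroup.zero_closed[OF is_additive_subgroup] by simp
  show "\<And>a b. a \<in> J \<Longrightarrow> b \<in> J \<Longrightarrow> a \<oplus>\<^bsub>R\<^esub> b \<in> J"
    using additive_subgroup.a_closed[OF is_additive_subgroup] by simp
  show "\<And>r a. r \<in> S \<Longrightarrow> a \<in> J \<Longrightarrow> r \<otimes>\<^bsub>R\<^esub> a \<in> J" using I_l_closed by simp
qed

text \<open>
  A non-unit lies in a maximal ideal; the noetherian property supplies a maximal element among the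
  proper ideals that contain it.
\<close>

lemma local_ring_nonunit:
  assumes "local_ring R m" "noetherian_ring R" "a \<in> carrier R" "a \<notin> m"
  shows "a \<in> Units R"
proof (rule ccontr)
  assume not_unit: "a \<notin> Units R"
  interpret cring R using assms by (simp add: local_ring_def)
  interpret noetherian_ring R by (rule assms)
  define \<J> where "\<J> = {J. ideal J R \<and> a \<in> J \<and> \<one>\<^bsub>R\<^esub> \<notin> J}"
  have "\<one>\<^bsub>R\<^esub> \<notin> PIdl\<^bsub>R\<^esub> a"
  proof
    assume "\<one>\<^bsub>R\<^esub> \<in> PIdl\<^bsub>R\<^esub> a"
    then obtain b where "b \<in> carrier R" "\<one>\<^bsub>R\<^esub> = b \<otimes>\<^bsub>R\<^esub> a" by (auto simp: cgenideal_def)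
    then show False using not_unit assms(3) m_comm[of a b] unfolding Units_def by auto
  qed
  then have "PIdl\<^bsub>R\<^esub> a \<in> \<J>"
    using cgenideal_ideal cgenideal_self assms(3) by (simp add: \<J>_def)
  then have "\<J> \<noteq> {}" by blast
  moreover have "\<Union>C \<in> \<J>" if "C \<noteq> {}" "subset.chain \<J> C" for C
  proof -
    have "subset.chain {I. ideal I R} C"
      using that(2) unfolding subset.chain_def \<J>_def by blast
    then have "\<Union>C \<in> C" using that(1) by (intro ideal_chain_is_trivial)
    then show ?thesis using that(2) unfolding subset.chain_def by blast
  qed
  ultimately obtain J where J: "J \<in> \<J>" and J_max: "\<And>L. L \<in> \<J> \<Longrightarrow> J \<subseteq> L \<Longrightarrow> L = J"
    using subset_Zorn_nonempty[of \<J>] by blast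
  have J': "ideal J R" "a \<in> J" "\<one>\<^bsub>R\<^esub> \<notin> J" using J by (auto simp: \<J>_def)
  have "maximalideal J R"
    using J'(1)
  proof (rule maximalidealI)
    show "carrier R \<noteq> J" using J'(3) by auto
    show "L = J \<or> L = carrier R" if L: "ideal L R" "J \<subseteq> L" for L
    proof (cases "\<one>\<^bsub>R\<^esub> \<in> L")
      case True
      then show ?thesis using ideal.one_imp_carrier[OF L(1)] by blast
    next
      case False
      then show ?thesis using J_max L J'(2) by (auto simp: \<J>_def)
    qed
  qed
  then have "J = m" using assms(1) by (auto simp: local_ring_def)
  then show False using J'(2) assms(4) by blast
qed

lemma (in field) local_subringD:
  assumes A: "subring A R" and local_A: "local_ring (R\<lparr>carrier := A\<rparr>) m"
    and noeth: "noetherian_ring (R\<lparr>carrier := A\<rparr>)"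
  shows "ideal m (R\<lparr>carrier := A\<rparr>)" "\<one> \<notin> m" "\<forall>a \<in> A - m. inv a \<in> A"
proof -
  have "maximalideal m (R\<lparr>carrier := A\<rparr>)" using local_A by (auto simp: local_ring_def)
  then interpret m: maximalideal m "R\<lparr>carrier := A\<rparr>" .
  show "ideal m (R\<lparr>carrier := A\<rparr>)" by (rule m.is_ideal)
  show "\<one> \<notin> m" using m.one_imp_carrier m.I_notcarr by auto
  show "\<forall>a \<in> A - m. inv a \<in> A"
  proof
    fix a assume "a \<in> A - m"
    then have a: "a \<in> A" "a \<notin> m" by auto
    then have "a \<in> Units (R\<lparr>carrier := A\<rparr>)"
      using local_ring_nonunit[OF local_A noeth] by simp
    then obtain b where b: "b \<in> A" "a \<otimes> b = \<one>" by (auto simp: Units_def)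
    then have "inv a = b"
      using a subringE(1)[OF A] comm_inv_char[of a b] by blast
    then show "inv a \<in> A" using b by simp
  qed
qed

section \<open>Sequences of monomial transformations\<close>

text \<open>
  The properties of a sequence of monomial transformations from which the theorem follows.  Besides the
  relations between consecutive systems of variables, the construction of the rings enters through
  \<open>R_Suc\<close> and \<open>residue_Suc\<close>; the latter says that the residue field does not grow.
\<close>

locale monomial_sequence = field K + blow_up_directions I dir
  for K :: "('a, 'b) ring_scheme" (structure) and I :: "'i set" and dir :: "nat \<Rightarrow> 'i" +
  fixes R m :: "nat \<Rightarrow> 'a set" and x :: "nat \<Rightarrow> 'i \<Rightarrow> 'a"
  assumes subring_R: "subring (R i) K"
    and ideal_m: "ideal (m i) (K\<lparr>carrier := R i\<rparr>)"
    and one_notin_m: "\<one> \<notin> m i"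
    and inv_in_R: "a \<in> R i \<Longrightarrow> a \<notin> m i \<Longrightarrow> inv a \<in> R i"
    and m_minimal: "ideal J (K\<lparr>carrier := R i\<rparr>) \<Longrightarrow> x i ` I \<subseteq> J \<Longrightarrow> m i \<subseteq> J"
    and x_in_m: "k \<in> I \<Longrightarrow> x i k \<in> m i"
    and x_dir_nonzero: "x i (dir i) \<noteq> \<zero>"
    and x_dir: "x (Suc i) (dir i) = x i (dir i)"
    and x_other: "k \<in> I \<Longrightarrow> k \<noteq> dir i \<Longrightarrow> x (Suc i) k = x i k \<otimes> inv (x i (dir i))"
    and R_Suc: "R i \<subseteq> R (Suc i)"
    and noetherian_R0: "noetherian_ring (K\<lparr>carrier := R 0\<rparr>)"
    and fractions: "f \<in> carrier K \<Longrightarrow> \<exists>a \<in> R 0. \<exists>b \<in> R 0 - {\<zero>}. f = a \<otimes> inv b"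
    and residue_Suc: "a \<in> R (Suc i) \<Longrightarrow> \<exists>r \<in> R i. a \<ominus> r \<in> m (Suc i)"
begin

sublocale H: comm_group "units_of K"
  by (rule units_comm_group)

lemmas [simp] = units_of_mult units_of_one units_of_carrier field_Units

lemma nat_pow_units_of: "a [^]\<^bsub>units_of K\<^esub> (n :: nat) = a [^] n"
  by (simp add: units_of_def nat_pow_def)

lemma R_carrier: "a \<in> R i \<Longrightarrow> a \<in> carrier K"
  using subringE(1)[OF subring_R] by blast

lemma m_R: "a \<in> m i \<Longrightarrow> a \<in> R i"
  using subring_idealD(1)[OF ideal_m] by blast

lemma m_add: "a \<in> m i \<Longrightarrow> b \<in> m i \<Longrightarrow> a \<oplus> b \<in> m i"
  and m_mult: "r \<in> R i \<Longrightarrow> a \<in> m i \<Longrightarrow> r \<otimes> a \<in> m i"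
  and zero_in_m: "\<zero> \<in> m i"
  using subring_idealD[OF ideal_m] by auto

lemma x_carrier: "k \<in> I \<Longrightarrow> x i k \<in> carrier K"
  using x_in_m m_R R_carrier by blast

text \<open>
  A variable that is zero stays zero in all later rings, but at some later stage it is the direction
  and has to be nonzero.
\<close>

lemma x_nonzero: assumes "k \<in> I" shows "x i k \<noteq> \<zero>"
proof
  assume zero: "x i k = \<zero>"
  obtain j where "i \<le> j" "dir j = k" using direction_recurs[OF assms] by blast
  from this(1) have "x j k = \<zero>"
  proof (induction j rule: dec_induct)
    case (step j)
    have "inv (x j (dir j)) \<in> carrier K"
      using x_carrier[OF dir_in] x_dir_nonzero field_Units by auto
    then show ?case using step.IH x_dir x_other[OF assms] by (cases "k = dir j") auto
  qed (rule zero)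
  then show False using x_dir_nonzero \<open>dir j = k\<close> by blast
qed

lemma x_unit: "k \<in> I \<Longrightarrow> x i k \<in> carrier (units_of K)"
  using x_carrier x_nonzero by simp

lemma x_eq_product: assumes "k \<in> I" "k \<noteq> dir i"
  shows "x i k = x (Suc i) k \<otimes> x (Suc i) (dir i)"
proof -
  have "x i (dir i) \<in> Units K" using x_unit[OF dir_in] field_Units by simp
  then show ?thesis
    using x_other[OF assms] x_dir x_carrier[OF assms(1)] x_carrier[OF dir_in]
    by (simp add: m_assoc)
qed

lemma R_mono: "i \<le> j \<Longrightarrow> R i \<subseteq> R j"
  using R_Suc by (rule lift_Suc_mono_le)

lemma m_Suc: "m i \<subseteq> m (Suc i)"
proof -
  have "x i k \<in> m (Suc i)" if "k \<in> I" for k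
  proof (cases "k = dir i")
    case True
    then show ?thesis using x_in_m[OF dir_in[of i], of "Suc i"] x_dir[of i] by simp
  next
    case False
    have "x (Suc i) k \<otimes> x (Suc i) (dir i) \<in> m (Suc i)"
      using that dir_in x_in_m m_R m_mult by blast
    then show ?thesis using x_eq_product[OF that False] by simp
  qed
  then have "m i \<subseteq> m (Suc i) \<inter> R i"
    using m_R R_Suc zero_in_m by (intro m_minimal subring_idealI[OF subring_R])
      (auto intro: x_in_m m_add m_mult subringE(2,6,7)[OF subring_R] subsetD[OF R_Suc])
  then show ?thesis by blast
qed

lemma m_mono: "i \<le> j \<Longrightarrow> m i \<subseteq> m j"
  using m_Suc by (rule lift_Suc_mono_le)

section \<open>Laurent monomials in the variables of a stage\<close>

definition laurent :: "nat \<Rightarrow> ('i \<Rightarrow> int) \<Rightarrow> 'a" where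
  "laurent i \<gamma> = laurent_monomial (units_of K) I (x i) \<gamma>"

lemma x_units: "x i \<in> I \<rightarrow> carrier (units_of K)"
  using x_unit by blast

lemma laurent_unit: "laurent i \<gamma> \<in> carrier (units_of K)"
  unfolding laurent_def by (rule H.laurent_monomial_closed[OF x_units])

lemma laurent_carrier: "laurent i \<gamma> \<in> carrier K"
  and laurent_nonzero: "laurent i \<gamma> \<noteq> \<zero>"
  using laurent_unit[of i \<gamma>] by auto

lemma laurent_add: "laurent i (\<lambda>k. \<gamma> k + \<delta> k) = laurent i \<gamma> \<otimes> laurent i \<delta>"
  using H.laurent_monomial_add[OF x_units] by (simp add: laurent_def)

lemma laurent_cong: "(\<And>k. k \<in> I \<Longrightarrow> \<gamma> k = \<delta> k) \<Longrightarrow> laurent i \<gamma> = laurent i \<delta>"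
  unfolding laurent_def by (rule H.laurent_monomial_cong[OF x_units])

lemma laurent_zero: "(\<And>k. k \<in> I \<Longrightarrow> \<gamma> k = 0) \<Longrightarrow> laurent i \<gamma> = \<one>"
  using H.laurent_monomial_zero[of I \<gamma>] by (simp add: laurent_def)

lemma laurent_uminus: "laurent i (\<lambda>k. - \<gamma> k) = inv (laurent i \<gamma>)"
proof -
  have "laurent i \<gamma> \<otimes> laurent i (\<lambda>k. - \<gamma> k) = \<one>"
    unfolding laurent_add[symmetric] by (rule laurent_zero) simp
  then show ?thesis using laurent_carrier comm_inv_char by metis
qed

lemma laurent_single_nat:
  assumes "k \<in> I" shows "laurent i (\<lambda>l. if l = k then int n else 0) = x i k [^] n"
  using H.laurent_monomial_single[OF x_units finite_I assms, of i "int n"]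
  by (simp only: laurent_def int_pow_int nat_pow_units_of)

lemma laurent_single_1: assumes "k \<in> I" shows "laurent i (\<lambda>l. if l = k then 1 else 0) = x i k"
  using laurent_single_nat[OF assms, of i "Suc 0"] x_carrier[OF assms, of i]
  by (simp only: of_nat_Suc of_nat_0 add_0_right nat_pow_Suc nat_pow_0 l_one)

lemma laurent_Suc: "laurent i \<gamma> = laurent (Suc i) (\<gamma>(dir i := \<Sum>k\<in>I. \<gamma> k))"
  unfolding laurent_def
  by (rule H.laurent_monomial_substitute[OF x_units finite_I dir_in])
    (simp_all add: x_dir x_eq_product)

lemma laurent_expo: "laurent 0 \<gamma> = laurent i (expo i \<gamma>)"
  by (induction i) (simp_all flip: laurent_Suc del: fun_upd_apply)

lemma laurent_in_R:
  assumes "\<forall>k\<in>I. 0 \<le> \<gamma> k" shows "laurent i \<gamma> \<in> R i"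
proof -
  have pow: "x i k [^]\<^bsub>units_of K\<^esub> \<gamma> k \<in> R i" if "k \<in> I" for k
  proof -
    have "x i k [^] n \<in> R i" for n :: nat
    proof (induction n)
      case (Suc n)
      then show ?case
        using x_in_m[OF that, THEN m_R] subringE(6)[OF subring_R] by (simp only: nat_pow_Suc)
    qed (simp add: subringE(3)[OF subring_R])
    moreover have "x i k [^]\<^bsub>units_of K\<^esub> \<gamma> k = x i k [^] nat (\<gamma> k)"
      using assms[rule_format, OF that] int_pow_int[of "units_of K" "x i k" "nat (\<gamma> k)"]
      by (simp only: nat_0_le nat_pow_units_of)
    ultimately show ?thesis by simp
  qed
  have "laurent_monomial (units_of K) J (x i) \<gamma> \<in> R i" if "J \<subseteq> I" for J
    using finite_subset[OF that finite_I] that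
  proof (induction J)
    case empty
    then show ?case
      using subringE(3)[OF subring_R] H.laurent_monomial_zero[of "{}" \<gamma> "x i"] by simp
  next
    case (insert k J)
    have "x i \<in> insert k J \<rightarrow> carrier (units_of K)" using insert.prems x_unit by blast
    from H.laurent_monomial_remove[OF this, of k \<gamma>] insert pow subringE(6)[OF subring_R]
    show ?case by simp
  qed
  then show ?thesis unfolding laurent_def by blast
qed

lemma laurent_in_m:
  assumes "\<forall>k\<in>I. 0 \<le> \<gamma> k" "l \<in> I" "0 < \<gamma> l" shows "laurent i \<gamma> \<in> m i"
proof -
  let ?e = "\<lambda>k. if k = l then 1 else 0 :: int"
  have "laurent i \<gamma> = laurent i (\<lambda>k. (\<gamma> k - ?e k) + ?e k)" by simp
  also have "\<dots> = laurent i (\<lambda>k. \<gamma> k - ?e k) \<otimes> x i l"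
    using assms(2) by (simp only: laurent_add laurent_single_1)
  also have "\<dots> \<in> m i" using assms by (intro m_mult laurent_in_R x_in_m) auto
  finally show ?thesis .
qed

section \<open>The union of the sequence\<close>

definition V :: "'a set" where "V = (\<Union>i. R i)"
definition M :: "'a set" where "M = (\<Union>i. m i)"

lemma V_pair:
  assumes "a \<in> V" "b \<in> V" obtains i where "a \<in> R i" "b \<in> R i"
proof -
  obtain i j where "a \<in> R i" "b \<in> R j" using assms by (auto simp: V_def)
  then show ?thesis using R_mono[of i "max i j"] R_mono[of j "max i j"] that[of "max i j"] by auto
qed

lemma VM_pair:
  assumes "a \<in> V" "b \<in> M" obtains i where "a \<in> R i" "b \<in> m i"
proof -
  obtain i j where "a \<in> R i" "b \<in> m j" using assms by (auto simp: V_def M_def)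
  then show ?thesis using R_mono[of i "max i j"] m_mono[of j "max i j"] that[of "max i j"] by auto
qed

lemma M_pair:
  assumes "a \<in> M" "b \<in> M" obtains i where "a \<in> m i" "b \<in> m i"
proof -
  obtain i j where "a \<in> m i" "b \<in> m j" using assms by (auto simp: M_def)
  then show ?thesis using m_mono[of i "max i j"] m_mono[of j "max i j"] that[of "max i j"] by auto
qed

lemma R_V: "a \<in> R i \<Longrightarrow> a \<in> V"
  and m_M: "a \<in> m i \<Longrightarrow> a \<in> M"
  and M_V: "a \<in> M \<Longrightarrow> a \<in> V"
  using m_R by (auto simp: V_def M_def)

lemma V_carrier: "a \<in> V \<Longrightarrow> a \<in> carrier K"
  using R_carrier by (auto simp: V_def)

lemma subring_V: "subring V K"
proof (rule subringI)
  show "V \<subseteq> carrier K" using V_carrier by blast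
  show "\<one> \<in> V" using subringE(3)[OF subring_R] R_V by blast
  show "\<ominus> a \<in> V" if "a \<in> V" for a
    using that subringE(5)[OF subring_R] by (auto simp: V_def)
  fix a b assume "a \<in> V" "b \<in> V"
  then obtain i where "a \<in> R i" "b \<in> R i" by (rule V_pair)
  then show "a \<otimes> b \<in> V" "a \<oplus> b \<in> V"
    using subringE(6,7)[OF subring_R, of a i b] R_V by blast+
qed

lemma M_add: "a \<in> M \<Longrightarrow> b \<in> M \<Longrightarrow> a \<oplus> b \<in> M"
  by (rule M_pair[of a b]) (auto intro: m_M m_add)

lemma M_mult: "r \<in> V \<Longrightarrow> a \<in> M \<Longrightarrow> r \<otimes> a \<in> M"
  by (rule VM_pair[of r a]) (auto intro: m_M m_mult)

lemma one_notin_M: "\<one> \<notin> M"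
  using one_notin_m by (auto simp: M_def)

lemma zero_in_M: "\<zero> \<in> M"
  using zero_in_m m_M by blast

lemma inv_in_V: "a \<in> V \<Longrightarrow> a \<notin> M \<Longrightarrow> inv a \<in> V"
  using inv_in_R by (auto simp: V_def M_def)

lemma V_mult: "a \<in> V \<Longrightarrow> b \<in> V \<Longrightarrow> a \<otimes> b \<in> V"
  and V_add: "a \<in> V \<Longrightarrow> b \<in> V \<Longrightarrow> a \<oplus> b \<in> V"
  and V_uminus: "a \<in> V \<Longrightarrow> \<ominus> a \<in> V"
  and V_one: "\<one> \<in> V"
  using subringE[OF subring_V] by auto

lemma M_uminus: "a \<in> M \<Longrightarrow> \<ominus> a \<in> M"
  using M_mult[of "\<ominus> \<one>" a] V_uminus[OF V_one] V_carrier M_V by (simp add: l_minus)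

lemma Units_V: "Units (K\<lparr>carrier := V\<rparr>) = V - M"
proof (intro equalityI subsetI)
  fix u assume "u \<in> Units (K\<lparr>carrier := V\<rparr>)"
  then obtain w where "u \<in> V" "w \<in> V" "w \<otimes> u = \<one>" by (auto simp: Units_def)
  then show "u \<in> V - M" using M_mult one_notin_M by force
next
  fix u assume u: "u \<in> V - M"
  then have "u \<in> carrier K - {\<zero>}" using V_carrier zero_in_M by blast
  then have "u \<in> Units K" using field_Units by blast
  then have "inv u \<otimes> u = \<one>" "u \<otimes> inv u = \<one>" by (rule Units_l_inv Units_r_inv)+
  then show "u \<in> Units (K\<lparr>carrier := V\<rparr>)"
    using u inv_in_V by (auto simp: Units_def intro!: bexI[of _ "inv u"])
qed

lemma Units_R_V: "u \<in> R i \<Longrightarrow> u \<notin> m i \<Longrightarrow> u \<in> V - M"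
proof -
  assume u: "u \<in> R i" "u \<notin> m i"
  then have "u \<in> carrier K - {\<zero>}" using R_carrier zero_in_m by blast
  then have "inv u \<otimes> u = \<one>" using field_Units Units_l_inv by blast
  then show "u \<in> V - M" using u inv_in_R[OF u] R_V M_mult one_notin_M by force
qed

lemma V_unit_nonzero: "u \<in> V - M \<Longrightarrow> u \<in> carrier (units_of K)"
  using V_carrier zero_in_M by auto

abbreviation monomial :: "('i \<Rightarrow> int) \<Rightarrow> 'a" where "monomial \<equiv> laurent 0"

lemma monomial_in_M: "pos \<gamma> \<Longrightarrow> monomial \<gamma> \<in> M"
proof -
  assume "pos \<gamma>"
  then obtain j where j: "\<forall>k\<in>I. 0 < expo j \<gamma> k" by (auto simp: pos_def)
  then have "laurent j (expo j \<gamma>) \<in> m j"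
    using dir_in[of 0] by (intro laurent_in_m[of _ "dir 0"]) (auto intro: less_imp_le)
  then show "monomial \<gamma> \<in> M" unfolding laurent_expo[of \<gamma> j] by (rule m_M)
qed

section \<open>Every element is a unit times a monomial\<close>

text \<open>
  Exponents outside \<open>I\<close> are set to zero, so that a monomial is given by exactly one element of this set
  and the sets of monomials of bounded degree are finite.
\<close>

definition exponents :: "('i \<Rightarrow> int) set" where
  "exponents = {\<alpha>. (\<forall>k\<in>I. 0 \<le> \<alpha> k) \<and> (\<forall>k. k \<notin> I \<longrightarrow> \<alpha> k = 0)}"

text \<open>
  The module over the first ring that the monomials with exponents in \<open>T\<close> generate; it is an ideal of
  this ring if the exponents are nonnegative.
\<close>

inductive_set monomial_span :: "('i \<Rightarrow> int) set \<Rightarrow> 'a set" for T where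
  zero: "\<zero> \<in> monomial_span T"
| add: "r \<in> R 0 \<Longrightarrow> \<alpha> \<in> T \<Longrightarrow> y \<in> monomial_span T \<Longrightarrow> r \<otimes> monomial \<alpha> \<oplus> y \<in> monomial_span T"

lemma monomial_span_carrier: "y \<in> monomial_span T \<Longrightarrow> y \<in> carrier K"
  by (induction rule: monomial_span.induct) (auto simp: R_carrier laurent_carrier)

lemma monomial_span_mono: "y \<in> monomial_span T \<Longrightarrow> T \<subseteq> T' \<Longrightarrow> y \<in> monomial_span T'"
  by (induction rule: monomial_span.induct) (auto intro: monomial_span.intros)

lemma monomial_span_add:
  "y \<in> monomial_span T \<Longrightarrow> z \<in> monomial_span T \<Longrightarrow> y \<oplus> z \<in> monomial_span T"
proof (induction rule: monomial_span.induct)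
  case zero
  then show ?case using monomial_span_carrier by simp
next
  case (add r \<alpha> y)
  then have "r \<otimes> monomial \<alpha> \<oplus> (y \<oplus> z) \<in> monomial_span T" by (intro monomial_span.add)
  then show ?case
    using add monomial_span_carrier by (simp add: a_assoc R_carrier laurent_carrier)
qed

lemma monomial_span_mult:
  assumes "s \<in> R 0" shows "y \<in> monomial_span T \<Longrightarrow> s \<otimes> y \<in> monomial_span T"
proof (induction rule: monomial_span.induct)
  case zero
  then show ?case using assms R_carrier by (simp add: monomial_span.zero)
next
  case (add r \<alpha> y)
  then have "(s \<otimes> r) \<otimes> monomial \<alpha> \<oplus> s \<otimes> y \<in> monomial_span T"
    using assms subringE(6)[OF subring_R] by (intro monomial_span.add)
  then show ?case
    using add assms monomial_span_carrier by (simp add: m_assoc r_distr R_carrier laurent_carrier)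
qed

lemma monomial_span_singleI: "r \<in> R 0 \<Longrightarrow> \<alpha> \<in> T \<Longrightarrow> r \<otimes> monomial \<alpha> \<in> monomial_span T"
  using monomial_span.add[OF _ _ monomial_span.zero, of r \<alpha> T]
  by (simp add: R_carrier laurent_carrier)

lemma monomial_span_insert:
  assumes "f \<in> monomial_span (insert \<alpha> T)"
  obtains c y where "c \<in> R 0" "y \<in> monomial_span T" "f = c \<otimes> monomial \<alpha> \<oplus> y"
proof -
  from assms have "\<exists>c\<in>R 0. \<exists>y\<in>monomial_span T. f = c \<otimes> monomial \<alpha> \<oplus> y"
  proof (induction rule: monomial_span.induct)
    case zero
    then show ?case
      using subringE(2)[OF subring_R, of 0] monomial_span.zero[of T] laurent_carrier
      by (intro bexI[of _ \<zero>]) auto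
  next
    case (add r \<beta> z)
    then obtain c y where cy: "c \<in> R 0" "y \<in> monomial_span T" "z = c \<otimes> monomial \<alpha> \<oplus> y" by blast
    note car = R_carrier[OF cy(1)] R_carrier[OF add(1)] laurent_carrier monomial_span_carrier[OF cy(2)]
    show ?case
    proof (cases "\<beta> = \<alpha>")
      case True
      have "r \<otimes> monomial \<beta> \<oplus> z = (r \<oplus> c) \<otimes> monomial \<alpha> \<oplus> y"
        unfolding True cy(3) using car by (simp add: l_distr a_assoc)
      then show ?thesis using cy add subringE(7)[OF subring_R] by blast
    next
      case False
      have "r \<otimes> monomial \<beta> \<oplus> z = c \<otimes> monomial \<alpha> \<oplus> (r \<otimes> monomial \<beta> \<oplus> y)"
        unfolding cy(3) using car by (simp add: a_ac)
      moreover have "r \<otimes> monomial \<beta> \<oplus> y \<in> monomial_span T"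
        using False add cy by (intro monomial_span.add) auto
      ultimately show ?thesis using cy(1) by blast
    qed
  qed
  then show ?thesis using that by blast
qed

text \<open>
  A non-unit coefficient is a combination of the variables, and a variable times a monomial is a monomial
  with one exponent raised by one.
\<close>

lemma monomial_span_absorb:
  assumes c: "c \<in> m 0" and T: "\<And>k. k \<in> I \<Longrightarrow> (\<lambda>l. \<alpha> l + (if l = k then 1 else 0)) \<in> T"
  shows "c \<otimes> monomial \<alpha> \<in> monomial_span T"
proof -
  define J where "J = {c \<in> R 0. c \<otimes> monomial \<alpha> \<in> monomial_span T}"
  have "ideal J (K\<lparr>carrier := R 0\<rparr>)"
  proof (rule subring_idealI[OF subring_R])
    show "J \<subseteq> R 0" by (auto simp: J_def)
    show "\<zero> \<in> J" using subringE(2)[OF subring_R] laurent_carrier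
      by (simp add: J_def monomial_span.zero)
    show "a \<oplus> b \<in> J" if "a \<in> J" "b \<in> J" for a b
      using that subringE(7)[OF subring_R] monomial_span_add[of "a \<otimes> monomial \<alpha>" T "b \<otimes> monomial \<alpha>"]
      by (auto simp: J_def l_distr R_carrier laurent_carrier)
    show "r \<otimes> a \<in> J" if "r \<in> R 0" "a \<in> J" for r a
      using that subringE(6)[OF subring_R] monomial_span_mult[of r "a \<otimes> monomial \<alpha>" T]
      by (auto simp: J_def m_assoc R_carrier laurent_carrier)
  qed
  moreover have "x 0 k \<in> J" if k: "k \<in> I" for k
  proof -
    have "monomial (\<lambda>l. \<alpha> l + (if l = k then 1 else 0)) = x 0 k \<otimes> monomial \<alpha>"
      using x_carrier[OF k] laurent_carrier by (simp add: laurent_add laurent_single_1[OF k] m_comm)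
    then show ?thesis
      using monomial_span_singleI[OF subringE(3)[OF subring_R] T[OF k]] x_in_m[OF k, THEN m_R]
        x_carrier[OF k] laurent_carrier
      by (simp add: J_def)
  qed
  ultimately have "m 0 \<subseteq> J" by (intro m_minimal) auto
  with c show ?thesis by (auto simp: J_def)
qed

text \<open>The quotient of a larger monomial by a smaller one lies in \<open>M\<close>.\<close>

lemma monomial_span_value:
  assumes "y \<in> monomial_span T" "\<And>\<beta>. \<beta> \<in> T \<Longrightarrow> pos (\<lambda>k. \<beta> k - \<alpha> k)"
  shows "\<exists>z\<in>M. y = monomial \<alpha> \<otimes> z"
  using assms(1)
proof (induction rule: monomial_span.induct)
  case zero
  then show ?case using zero_in_M laurent_carrier by (intro bexI[of _ \<zero>]) auto
next
  case (add r \<beta> y)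
  then obtain z where z: "z \<in> M" "y = monomial \<alpha> \<otimes> z" by blast
  let ?\<delta> = "\<lambda>k. \<beta> k - \<alpha> k"
  have \<delta>: "monomial ?\<delta> \<in> M" using assms(2) add by (intro monomial_in_M) auto
  have "monomial \<beta> = monomial \<alpha> \<otimes> monomial ?\<delta>"
    unfolding laurent_add[symmetric] by (rule laurent_cong) simp
  then have "r \<otimes> monomial \<beta> \<oplus> y = monomial \<alpha> \<otimes> (r \<otimes> monomial ?\<delta> \<oplus> z)"
    unfolding z(2) using R_carrier[OF add(1)] laurent_carrier V_carrier[OF M_V[OF z(1)]]
    by (simp add: r_distr m_lcomm)
  moreover have "r \<otimes> monomial ?\<delta> \<oplus> z \<in> M" using z \<delta> R_V[OF add(1)] by (intro M_add M_mult)
  ultimately show ?case by blast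
qed

text \<open>
  This is Krull's intersection theorem for the powers of the maximal ideal \<open>m 0\<close>.  Among the ideals that
  contain \<open>f \<otimes> c\<close> for all \<open>c \<in> m 0\<close>, but not \<open>f\<close>, choose a maximal one, \<open>J\<close>; there is one because \<open>f\<close> is
  not a multiple of itself by an element of \<open>m 0\<close>.  Some power of every variable \<open>a\<close> lies in \<open>J\<close>.
  Indeed, the ideals of all \<open>r\<close> with \<open>r \<otimes> a [^] n \<in> J\<close> increase with \<open>n\<close> and become stationary at some
  \<open>n\<close>.  If \<open>a [^] n \<notin> J\<close>, then \<open>f = j \<oplus> r \<otimes> a [^] n\<close> with \<open>j \<in> J\<close>, by maximality.  Now \<open>f \<otimes> a \<in> J\<close> gives
  \<open>r \<otimes> a [^] Suc n \<in> J\<close>, hence \<open>r \<otimes> a [^] n \<in> J\<close> by the choice of \<open>n\<close>, and so \<open>f \<in> J\<close>, a contradiction.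
  Therefore \<open>J\<close> contains all monomials of large degree, but not \<open>f\<close>.
\<close>

lemma krull_intersection_monomial:
  assumes f: "f \<in> R 0" "f \<noteq> \<zero>"
  obtains N :: int where "f \<notin> monomial_span {\<alpha> \<in> exponents. N \<le> (\<Sum>k\<in>I. \<alpha> k)}"
proof -
  let ?R = "K\<lparr>carrier := R 0\<rparr>"
  note R0_carrier = R_carrier[of _ 0]
  note sR = subringE[OF subring_R[of 0]]
  interpret R: noetherian_ring ?R by (rule noetherian_R0)
  define \<J> where "\<J> = {J. ideal J ?R \<and> (\<forall>c\<in>m 0. f \<otimes> c \<in> J) \<and> f \<notin> J}"
  have f_unit: "c = \<one>" if "f = f \<otimes> c" "c \<in> R 0" for c
  proof -
    have "f \<otimes> c = f \<otimes> \<one>" using that f R0_carrier by simp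
    then show ?thesis using f that(2) R0_carrier m_lcancel by blast
  qed
  have "(\<lambda>c. f \<otimes> c) ` m 0 \<in> \<J>"
    unfolding \<J>_def
  proof (intro CollectI conjI subring_idealI[OF subring_R])
    show "(\<lambda>c. f \<otimes> c) ` m 0 \<subseteq> R 0" using f m_R sR(6) by blast
    show "\<zero> \<in> (\<lambda>c. f \<otimes> c) ` m 0" using zero_in_m f R0_carrier by (intro image_eqI[of _ _ \<zero>]) auto
    show "a \<oplus> b \<in> (\<lambda>c. f \<otimes> c) ` m 0"
      if ab: "a \<in> (\<lambda>c. f \<otimes> c) ` m 0" "b \<in> (\<lambda>c. f \<otimes> c) ` m 0" for a b
    proof -
      obtain c c' where c: "c \<in> m 0" "c' \<in> m 0" "a = f \<otimes> c" "b = f \<otimes> c'" using ab by blast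
      then have "a \<oplus> b = f \<otimes> (c \<oplus> c')"
        using R_carrier[OF f(1)] R_carrier[OF m_R[OF c(1)]] R_carrier[OF m_R[OF c(2)]]
        by (simp add: r_distr)
      then show ?thesis using m_add[OF c(1,2)] by blast
    qed
    show "r \<otimes> a \<in> (\<lambda>c. f \<otimes> c) ` m 0" if ra: "r \<in> R 0" "a \<in> (\<lambda>c. f \<otimes> c) ` m 0" for r a
    proof -
      obtain c where c: "c \<in> m 0" "a = f \<otimes> c" using ra by blast
      then have "r \<otimes> a = f \<otimes> (r \<otimes> c)"
        using R_carrier[OF ra(1)] R_carrier[OF f(1)] R_carrier[OF m_R[OF c(1)]]
        by (simp add: m_lcomm)
      then show ?thesis using m_mult[OF ra(1) c(1)] by blast
    qed
    show "f \<notin> (\<lambda>c. f \<otimes> c) ` m 0" using f_unit m_R one_notin_m by blast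
  qed simp
  then have "\<J> \<noteq> {}" by blast
  moreover have "\<Union>C \<in> \<J>" if "C \<noteq> {}" "subset.chain \<J> C" for C
  proof -
    have "subset.chain {I. ideal I ?R} C"
      using that(2) unfolding subset.chain_def \<J>_def by blast
    then have "\<Union>C \<in> C" using that(1) by (intro R.ideal_chain_is_trivial)
    then show ?thesis using that(2) unfolding subset.chain_def by blast
  qed
  ultimately obtain J where J: "J \<in> \<J>" and J_max: "\<And>L. L \<in> \<J> \<Longrightarrow> J \<subseteq> L \<Longrightarrow> L = J"
    using subset_Zorn_nonempty[of \<J>] by blast
  have J_ideal: "ideal J ?R" and fJ: "f \<notin> J" and fm: "\<And>c. c \<in> m 0 \<Longrightarrow> f \<otimes> c \<in> J"
    using J by (auto simp: \<J>_def)
  note J_sub = subring_idealD[OF J_ideal]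
  have cancel: "r \<otimes> (p \<otimes> a) = (j \<oplus> r \<otimes> p) \<otimes> a \<oplus> (\<ominus> \<one> \<otimes> a) \<otimes> j"
    if "j \<in> carrier K" "r \<in> carrier K" "p \<in> carrier K" "a \<in> carrier K" for j r p a
    using that by algebra
  have pow: "\<exists>n :: nat. x 0 k [^] n \<in> J" if k: "k \<in> I" for k
  proof -
    let ?a = "x 0 k"
    have a: "?a \<in> m 0" "?a \<in> R 0" "?a \<in> carrier K" using k x_in_m m_R R0_carrier by blast+
    have an: "?a [^] n \<in> R 0" for n :: nat
    proof (induction n)
      case (Suc n)
      then show ?case using a(2) sR(6) by (simp only: nat_pow_Suc)
    qed (simp add: sR(3))
    define Q where "Q = (\<lambda>n :: nat. {r \<in> R 0. r \<otimes> ?a [^] n \<in> J})"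
    have Q_ideal: "ideal (Q n) ?R" for n
    proof (rule subring_idealI[OF subring_R])
      show "Q n \<subseteq> R 0" by (auto simp: Q_def)
      show "\<zero> \<in> Q n" using sR(2) J_sub(2) an R0_carrier by (simp add: Q_def)
      show "r \<oplus> s \<in> Q n" if "r \<in> Q n" "s \<in> Q n" for r s
        using that sR(7) J_sub(3) an R0_carrier by (auto simp: Q_def l_distr)
      show "r \<otimes> s \<in> Q n" if "r \<in> R 0" "s \<in> Q n" for r s
        using that sR(6) J_sub(4)[of r "s \<otimes> ?a [^] n"] an R0_carrier by (auto simp: Q_def m_assoc)
    qed
    have "Q n \<subseteq> Q (Suc n)" for n
    proof
      fix r assume "r \<in> Q n"
      then have "r \<in> R 0" "?a \<otimes> (r \<otimes> ?a [^] n) \<in> J" using J_sub(4)[OF a(2)] by (auto simp: Q_def)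
      moreover have "?a \<otimes> (r \<otimes> ?a [^] n) = r \<otimes> ?a [^] Suc n"
        using a an R0_carrier \<open>r \<in> R 0\<close> by (simp add: m_ac)
      ultimately show "r \<in> Q (Suc n)" by (simp add: Q_def)
    qed
    then have Q_mono: "i \<le> j \<Longrightarrow> Q i \<subseteq> Q j" for i j by (rule lift_Suc_mono_le)
    have "subset.chain {I. ideal I ?R} (range Q)"
      unfolding subset.chain_def using Q_ideal Q_mono nat_le_linear by blast
    then have "\<Union>(range Q) \<in> range Q" by (intro R.ideal_chain_is_trivial) auto
    then obtain n where "\<Union>(range Q) = Q n" by blast
    then have n: "Q (Suc n) \<subseteq> Q n" by blast
    have "?a [^] n \<in> J"
    proof (rule ccontr)
      assume notin: "?a [^] n \<notin> J"
      define L where "L = {j \<oplus> r \<otimes> ?a [^] n | j r. j \<in> J \<and> r \<in> R 0}"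
      have L_ideal: "ideal L ?R"
      proof (rule subring_idealI[OF subring_R])
        show "L \<subseteq> R 0" using J_sub(1) an sR(6,7) by (auto simp: L_def)
        show "\<zero> \<in> L" unfolding L_def using J_sub(2) sR(2) an R0_carrier
          by (intro CollectI exI[of _ \<zero>]) auto
        show "y \<oplus> z \<in> L" if yz: "y \<in> L" "z \<in> L" for y z
        proof -
          obtain j r j' r' where *: "j \<in> J" "r \<in> R 0" "y = j \<oplus> r \<otimes> ?a [^] n"
            "j' \<in> J" "r' \<in> R 0" "z = j' \<oplus> r' \<otimes> ?a [^] n" using yz by (auto simp: L_def)
          have "j \<in> carrier K" "j' \<in> carrier K" "r \<in> carrier K" "r' \<in> carrier K" "?a [^] n \<in> carrier K"
            using * J_sub(1) an R0_carrier by blast+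
          then have "y \<oplus> z = (j \<oplus> j') \<oplus> (r \<oplus> r') \<otimes> ?a [^] n"
            unfolding * by (simp add: l_distr a_ac)
          then show ?thesis unfolding L_def using * J_sub(3) sR(7) by blast
        qed
        show "s \<otimes> y \<in> L" if sy: "s \<in> R 0" "y \<in> L" for s y
        proof -
          obtain j r where *: "j \<in> J" "r \<in> R 0" "y = j \<oplus> r \<otimes> ?a [^] n"
            using sy by (auto simp: L_def)
          have "j \<in> carrier K" "s \<in> carrier K" "r \<in> carrier K" "?a [^] n \<in> carrier K"
            using * J_sub(1) an R0_carrier sy by blast+
          then have "s \<otimes> y = (s \<otimes> j) \<oplus> (s \<otimes> r) \<otimes> ?a [^] n"
            unfolding * by (simp add: r_distr m_assoc)
          then show ?thesis unfolding L_def using * J_sub(4) sR(6) sy by blast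
        qed
      qed
      have JL: "J \<subseteq> L"
      proof
        fix j assume "j \<in> J"
        moreover have "j = j \<oplus> \<zero> \<otimes> ?a [^] n" using \<open>j \<in> J\<close> J_sub(1) an R0_carrier by auto
        ultimately show "j \<in> L" unfolding L_def using sR(2) by blast
      qed
      have "?a [^] n = \<zero> \<oplus> \<one> \<otimes> ?a [^] n" using an R0_carrier by simp
      then have "?a [^] n \<in> L" unfolding L_def using J_sub(2) sR(3) by blast
      then have "L \<noteq> J" using notin by blast
      then have "L \<notin> \<J>" using J_max JL by blast
      then have "f \<in> L" using L_ideal JL fm by (auto simp: \<J>_def)
      then obtain j r where *: "j \<in> J" "r \<in> R 0" "f = j \<oplus> r \<otimes> ?a [^] n"
        by (auto simp: L_def)
      have car: "j \<in> carrier K" "r \<in> carrier K" "?a [^] n \<in> carrier K"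
        using * J_sub(1) an R0_carrier by blast+
      have "r \<otimes> ?a [^] Suc n = f \<otimes> ?a \<oplus> (\<ominus> \<one> \<otimes> ?a) \<otimes> j"
        unfolding *(3) nat_pow_Suc using cancel[OF car a(3)] .
      also have "\<dots> \<in> J"
        using J_sub(3)[OF fm[OF a(1)] J_sub(4)[OF sR(6)[OF sR(5)[OF sR(3)] a(2)] *(1)]] .
      finally have "r \<in> Q (Suc n)" using * by (simp add: Q_def)
      then have "r \<otimes> ?a [^] n \<in> J" using n by (auto simp: Q_def)
      then have "f \<in> J" unfolding *(3) using * by (intro J_sub(3))
      then show False using fJ by blast
    qed
    then show ?thesis by blast
  qed
  then obtain n where n: "\<And>k. k \<in> I \<Longrightarrow> x 0 k [^] (n k :: nat) \<in> J" by metis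
  \<comment> \<open>In a monomial of this degree, some variable has an exponent of at least \<open>n k\<close>.\<close>
  define N where "N = 1 + (\<Sum>k\<in>I. int (n k))"
  have monoJ: "monomial \<alpha> \<in> J" if \<alpha>: "\<alpha> \<in> exponents" "N \<le> (\<Sum>k\<in>I. \<alpha> k)" for \<alpha>
  proof -
    have "\<exists>k\<in>I. int (n k) \<le> \<alpha> k"
    proof (rule ccontr)
      assume "\<not> (\<exists>k\<in>I. int (n k) \<le> \<alpha> k)"
      then have "(\<Sum>k\<in>I. \<alpha> k) \<le> (\<Sum>k\<in>I. int (n k))" by (intro sum_mono) auto
      then show False using \<alpha>(2) by (simp add: N_def)
    qed
    then obtain k where k: "k \<in> I" "int (n k) \<le> \<alpha> k" by blast
    let ?\<beta> = "\<lambda>l. \<alpha> l - (if l = k then int (n k) else 0)"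
    have "monomial \<alpha> = monomial (\<lambda>l. ?\<beta> l + (if l = k then int (n k) else 0))" by simp
    also have "\<dots> = monomial ?\<beta> \<otimes> x 0 k [^] n k" by (simp only: laurent_add laurent_single_nat[OF k(1)])
    also have "\<dots> \<in> J"
      using \<alpha>(1) k by (intro J_sub(4) n laurent_in_R) (auto simp: exponents_def)
    finally show ?thesis .
  qed
  have "y \<in> J" if "y \<in> monomial_span {\<alpha> \<in> exponents. N \<le> (\<Sum>k\<in>I. \<alpha> k)}" for y
    using that by (induction rule: monomial_span.induct) (auto intro: J_sub(2-4) monoJ)
  then show ?thesis using that fJ by blast
qed

definition unit_times_monomial :: "'a \<Rightarrow> bool" where
  "unit_times_monomial f \<longleftrightarrow> (\<exists>u \<gamma>. u \<in> V - M \<and> f = u \<otimes> monomial \<gamma>)"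

lemma pos_unit_vector: "k \<in> I \<Longrightarrow> pos (\<lambda>l. if l = k then 1 else 0)"
  by (rule pos_nonneg) auto

text \<open>
  If the coefficient \<open>c\<close> of the least monomial is a unit, then \<open>f\<close> is this monomial times the sum of \<open>c\<close>
  and an element of \<open>M\<close>; otherwise the term is absorbed by the other monomials.
\<close>

lemma remove_least_monomial:
  assumes f: "f \<in> monomial_span (insert \<alpha> T)" "\<not> unit_times_monomial f"
    and T: "\<And>\<beta>. \<beta> \<in> T \<Longrightarrow> pos (\<lambda>k. \<beta> k - \<alpha> k)"
    and shift: "\<And>k. k \<in> I \<Longrightarrow> (\<lambda>l. \<alpha> l + (if l = k then 1 else 0)) \<in> T"
  shows "f \<in> monomial_span T"
proof -
  obtain c y where cy: "c \<in> R 0" "y \<in> monomial_span T" "f = c \<otimes> monomial \<alpha> \<oplus> y"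
    using f(1) by (rule monomial_span_insert)
  have "c \<in> m 0"
  proof (rule ccontr)
    assume "c \<notin> m 0"
    then have c: "c \<in> V - M" using cy(1) Units_R_V by blast
    obtain z where z: "z \<in> M" "y = monomial \<alpha> \<otimes> z" using monomial_span_value[OF cy(2) T] by blast
    have car: "c \<in> carrier K" "z \<in> carrier K" using c z M_V V_carrier by auto
    have "c \<oplus> z \<notin> M"
    proof
      assume "c \<oplus> z \<in> M"
      then have "(c \<oplus> z) \<oplus> \<ominus> z \<in> M" using z M_uminus M_add by blast
      moreover have "(c \<oplus> z) \<oplus> \<ominus> z = c" using car by (simp add: a_assoc r_neg)
      ultimately show False using c by simp
    qed
    then have "c \<oplus> z \<in> V - M" using c z M_V V_add by blast
    moreover have "f = (c \<oplus> z) \<otimes> monomial \<alpha>"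
      unfolding cy(3) z(2) using car laurent_carrier[of 0 \<alpha>] by (simp add: l_distr m_comm)
    ultimately show False using f(2) unfolding unit_times_monomial_def by blast
  qed
  then have "c \<otimes> monomial \<alpha> \<in> monomial_span T" using shift by (rule monomial_span_absorb)
  then show ?thesis unfolding cy(3) using cy(2) by (rule monomial_span_add)
qed

lemma exponents_total:
  assumes "\<alpha> \<in> exponents" "\<beta> \<in> exponents" "\<alpha> \<noteq> \<beta>"
  shows "pos (\<lambda>k. \<alpha> k - \<beta> k) \<or> pos (\<lambda>k. \<beta> k - \<alpha> k)"
proof -
  obtain k where "\<alpha> k \<noteq> \<beta> k" using assms(3) by blast
  moreover from this have "k \<in> I" using assms(1,2) unfolding exponents_def by force
  ultimately have "\<exists>k\<in>I. \<alpha> k - \<beta> k \<noteq> 0" by auto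
  then show ?thesis using pos_trichotomy[of "\<lambda>k. \<alpha> k - \<beta> k"] by auto
qed

lemma pos_diff_trans:
  "pos (\<lambda>k. \<alpha> k - \<beta> k) \<Longrightarrow> pos (\<lambda>k. \<beta> k - \<gamma> k) \<Longrightarrow> pos (\<lambda>k. \<alpha> k - \<gamma> k)"
  using pos_add[of "\<lambda>k. \<alpha> k - \<beta> k" "\<lambda>k. \<beta> k - \<gamma> k"] by simp

lemma not_pos_diff_self: "\<not> pos (\<lambda>k. \<alpha> k - \<alpha> k)"
  using pos_not_zero[of "\<lambda>k. \<alpha> k - \<alpha> k"] by auto

text \<open>
  The monomials of a finite initial segment \<open>S\<close> of the order are discarded one by one, beginning with
  the least.  In the induction the largest element of \<open>S\<close> is the least of the monomials that are left
  when the others have been discarded.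
\<close>

lemma in_span_of_large_monomials:
  assumes "finite S" "S \<subseteq> exponents"
    and "\<And>\<alpha> \<beta>. \<alpha> \<in> S \<Longrightarrow> \<beta> \<in> exponents \<Longrightarrow> pos (\<lambda>k. \<alpha> k - \<beta> k) \<Longrightarrow> \<beta> \<in> S"
    and f: "f \<in> R 0" "\<not> unit_times_monomial f"
  shows "f \<in> monomial_span (exponents - S)"
  using assms(1-3)
proof (induction "card S" arbitrary: S)
  case 0
  have "(\<lambda>_. 0) \<in> exponents - S" using 0 by (auto simp: exponents_def)
  from monomial_span_singleI[OF f(1) this] show ?case
    using f(1) R_carrier laurent_zero[of "\<lambda>_. 0" 0] by simp
next
  case (Suc n)
  then have "S \<noteq> {}" by auto
  have "asymp_on S (\<lambda>\<alpha> \<beta>. pos (\<lambda>k. \<beta> k - \<alpha> k))"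
    using pos_diff_trans not_pos_diff_self by (intro asymp_onI) blast
  moreover have "transp_on S (\<lambda>\<alpha> \<beta>. pos (\<lambda>k. \<beta> k - \<alpha> k))"
    using pos_diff_trans by (intro transp_onI) blast
  ultimately have "\<exists>\<alpha>\<in>S. \<forall>\<beta>\<in>S. \<beta> \<noteq> \<alpha> \<longrightarrow> \<not> pos (\<lambda>k. \<beta> k - \<alpha> k)"
    using \<open>S \<noteq> {}\<close> by (rule Finite_Set.bex_max_element[OF Suc.prems(1)])
  then obtain \<alpha> where \<alpha>: "\<alpha> \<in> S" and \<alpha>_max: "\<And>\<beta>. \<beta> \<in> S \<Longrightarrow> \<not> pos (\<lambda>k. \<beta> k - \<alpha> k)"
    using not_pos_diff_self by metis
  have "f \<in> monomial_span (exponents - (S - {\<alpha>}))"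
  proof (rule Suc.hyps(1))
    show "n = card (S - {\<alpha>})" using Suc.hyps(2) \<alpha> Suc.prems(1) by simp
    show "finite (S - {\<alpha>})" "S - {\<alpha>} \<subseteq> exponents" using Suc.prems by auto
    show "\<beta> \<in> S - {\<alpha>}"
      if "\<gamma> \<in> S - {\<alpha>}" "\<beta> \<in> exponents" "pos (\<lambda>k. \<gamma> k - \<beta> k)" for \<gamma> \<beta>
      using that Suc.prems(3)[of \<gamma> \<beta>] \<alpha>_max[of \<gamma>] by auto
  qed
  moreover have "exponents - (S - {\<alpha>}) = insert \<alpha> (exponents - S)"
    using \<alpha> Suc.prems(2) by auto
  ultimately have "f \<in> monomial_span (insert \<alpha> (exponents - S))" by simp
  then show ?case using f(2)
  proof (rule remove_least_monomial)
    show "pos (\<lambda>k. \<beta> k - \<alpha> k)" if "\<beta> \<in> exponents - S" for \<beta>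
      using that exponents_total[of \<beta> \<alpha>] Suc.prems(2,3) \<alpha> by blast
    fix k assume k: "k \<in> I"
    have "pos (\<lambda>l. (\<alpha> l + (if l = k then 1 else 0)) - \<alpha> l)" using pos_unit_vector[OF k] by simp
    then have "(\<lambda>l. \<alpha> l + (if l = k then 1 else 0)) \<notin> S" using \<alpha>_max by blast
    moreover have "(\<lambda>l. \<alpha> l + (if l = k then 1 else 0)) \<in> exponents"
      using \<alpha> Suc.prems(2) k by (auto simp: exponents_def)
    ultimately show "(\<lambda>l. \<alpha> l + (if l = k then 1 else 0)) \<in> exponents - S" by blast
  qed
qed

lemma finite_exponents_bounded: "finite {\<alpha> \<in> exponents. (\<Sum>k\<in>I. \<alpha> k) \<le> B}"
proof (rule finite_subset)
  show "{\<alpha> \<in> exponents. (\<Sum>k\<in>I. \<alpha> k) \<le> B} \<subseteq>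
    {\<alpha>. \<forall>k. (k \<in> I \<longrightarrow> \<alpha> k \<in> {0..B}) \<and> (k \<notin> I \<longrightarrow> \<alpha> k = 0)}"
  proof safe
    fix \<alpha> k assume \<alpha>: "\<alpha> \<in> exponents" "(\<Sum>k\<in>I. \<alpha> k) \<le> B"
    show "\<alpha> k \<in> {0..B}" if "k \<in> I"
    proof -
      have "\<alpha> k \<le> (\<Sum>k\<in>I. \<alpha> k)"
        using that \<alpha> finite_I by (intro member_le_sum) (auto simp: exponents_def)
      then show ?thesis using \<alpha> that by (auto simp: exponents_def)
    qed
    show "\<alpha> k = 0" if "k \<notin> I" using \<alpha> that by (simp add: exponents_def)
  qed
  show "finite {\<alpha>. \<forall>k. (k \<in> I \<longrightarrow> \<alpha> k \<in> {0..B}) \<and> (k \<notin> I \<longrightarrow> \<alpha> k = 0)}"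
    using finite_I by (intro finite_set_of_finite_funs) auto
qed

lemma nonzero_unit_times_monomial:
  assumes f: "f \<in> R 0" "f \<noteq> \<zero>" shows "unit_times_monomial f"
proof (rule ccontr)
  assume not: "\<not> unit_times_monomial f"
  obtain N where N: "f \<notin> monomial_span {\<alpha> \<in> exponents. N \<le> (\<Sum>k\<in>I. \<alpha> k)}"
    using f by (rule krull_intersection_monomial)
  \<comment> \<open>\<open>S\<close> is the initial segment generated by the monomials of degree at most \<open>N\<close>; it is finite
    because only finitely many monomials are not larger than a given one.\<close>
  define A where "A = {\<alpha> \<in> exponents. (\<Sum>k\<in>I. \<alpha> k) \<le> N}"
  define S where "S = {\<beta> \<in> exponents. \<exists>\<alpha>\<in>A. \<not> pos (\<lambda>k. \<beta> k - \<alpha> k)}"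
  have "finite {\<beta> \<in> exponents. \<not> pos (\<lambda>k. \<beta> k - \<alpha> k)}" for \<alpha>
  proof -
    obtain B where B: "\<And>\<beta>. \<forall>k\<in>I. 0 \<le> \<beta> k \<Longrightarrow> B < (\<Sum>k\<in>I. \<beta> k) \<Longrightarrow> pos (\<lambda>k. \<beta> k - \<alpha> k)"
      using pos_large_degree[of \<alpha>] by blast
    have "{\<beta> \<in> exponents. \<not> pos (\<lambda>k. \<beta> k - \<alpha> k)} \<subseteq> {\<beta> \<in> exponents. (\<Sum>k\<in>I. \<beta> k) \<le> B}"
      using B by (force simp: exponents_def not_le)
    then show ?thesis using finite_exponents_bounded finite_subset by blast
  qed
  moreover have "finite A" unfolding A_def by (rule finite_exponents_bounded)
  moreover have "S = (\<Union>\<alpha>\<in>A. {\<beta> \<in> exponents. \<not> pos (\<lambda>k. \<beta> k - \<alpha> k)})" by (auto simp: S_def)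
  ultimately have "finite S" by simp
  then have "f \<in> monomial_span (exponents - S)"
  proof (rule in_span_of_large_monomials[OF _ _ _ f(1) not])
    show "S \<subseteq> exponents" by (auto simp: S_def)
    fix \<alpha> \<beta> assume "\<alpha> \<in> S" "\<beta> \<in> exponents" "pos (\<lambda>k. \<alpha> k - \<beta> k)"
    then show "\<beta> \<in> S" unfolding S_def using pos_diff_trans[of \<alpha> \<beta>] by blast
  qed
  moreover have "exponents - S \<subseteq> {\<alpha> \<in> exponents. N \<le> (\<Sum>k\<in>I. \<alpha> k)}"
  proof
    fix \<alpha> assume \<alpha>: "\<alpha> \<in> exponents - S"
    then have "\<alpha> \<notin> A" using not_pos_diff_self[of \<alpha>] unfolding S_def by blast
    with \<alpha> show "\<alpha> \<in> {\<alpha> \<in> exponents. N \<le> (\<Sum>k\<in>I. \<alpha> k)}" by (auto simp: A_def)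
  qed
  ultimately show False using N monomial_span_mono by blast
qed

lemma field_unit_times_monomial:
  assumes "f \<in> carrier K" "f \<noteq> \<zero>" shows "unit_times_monomial f"
proof -
  obtain a b where ab: "a \<in> R 0" "b \<in> R 0" "b \<noteq> \<zero>" "f = a \<otimes> inv b" using fractions assms(1) by blast
  have b_unit: "b \<in> Units K" using ab R_carrier by auto
  then have "a \<noteq> \<zero>" using assms(2) ab(4) by auto
  then obtain u \<gamma> w \<delta> where uw: "u \<in> V - M" "a = u \<otimes> monomial \<gamma>" "w \<in> V - M" "b = w \<otimes> monomial \<delta>"
    using ab nonzero_unit_times_monomial unfolding unit_times_monomial_def by metis
  have w: "w \<in> Units K" "monomial \<delta> \<in> Units K" "u \<in> Units K" "monomial \<gamma> \<in> Units K"
    using uw V_unit_nonzero laurent_unit[of 0] by (auto simp: units_of_carrier simp del: field_Units)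
  note car = w[THEN Units_closed] w(1)[THEN Units_inv_closed] laurent_carrier
  let ?g = "u \<otimes> inv w \<otimes> monomial (\<lambda>k. \<gamma> k - \<delta> k)"
  have "monomial \<gamma> = monomial (\<lambda>k. \<gamma> k - \<delta> k) \<otimes> monomial \<delta>"
    unfolding laurent_add[symmetric] by simp
  then have "a = u \<otimes> (inv w \<otimes> w) \<otimes> monomial (\<lambda>k. \<gamma> k - \<delta> k) \<otimes> monomial \<delta>"
    unfolding uw(2) using w(1) car by (simp add: m_assoc del: field_Units)
  also have "\<dots> = ?g \<otimes> b"
    unfolding uw(4) using car by (simp only: m_ac m_closed)
  finally have "a = ?g \<otimes> b" .
  then have "f = ?g"
    unfolding ab(4) using b_unit car Units_closed[OF b_unit] by (simp add: m_assoc del: field_Units)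
  moreover have "u \<otimes> inv w \<in> Units (K\<lparr>carrier := V\<rparr>)"
  proof -
    have "inv w \<in> V - M"
    proof -
      have "inv w \<in> V" using uw inv_in_V by blast
      moreover have "inv w \<notin> M"
      proof
        assume "inv w \<in> M"
        then have "w \<otimes> inv w \<in> M" using uw M_mult by blast
        then show False using w one_notin_M by simp
      qed
      ultimately show ?thesis by blast
    qed
    then have uV: "u \<in> Units (K\<lparr>carrier := V\<rparr>)" and wV: "inv w \<in> Units (K\<lparr>carrier := V\<rparr>)"
      using uw Units_V by blast+
    interpret V: ring "K\<lparr>carrier := V\<rparr>"
      using subring_V subring_iff[OF subringE(1)[OF subring_V]] by simp
    from V.Units_m_closed[OF uV wV] show ?thesis by simp
  qed
  ultimately show ?thesis unfolding unit_times_monomial_def Units_V by blast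
qed

section \<open>The union is a valuation ring of rank one\<close>

text \<open>The monomial or its inverse lies in \<open>M\<close> unless its exponents vanish.\<close>

lemma laurent_unit_imp_zero:
  assumes "monomial \<gamma> \<in> V - M" shows "\<forall>k\<in>I. \<gamma> k = 0"
proof -
  have "\<not> pos \<gamma>" using assms monomial_in_M by blast
  moreover have "\<not> pos (\<lambda>k. - \<gamma> k)"
  proof
    assume "pos (\<lambda>k. - \<gamma> k)"
    then have "inv (monomial \<gamma>) \<in> M" using monomial_in_M laurent_uminus by metis
    then have "monomial \<gamma> \<otimes> inv (monomial \<gamma>) \<in> M" using assms M_mult by blast
    moreover have "monomial \<gamma> \<otimes> inv (monomial \<gamma>) = \<one>"
      using laurent_unit[of 0 \<gamma>] by (intro Units_r_inv) (simp only: units_of_carrier)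
    ultimately show False using one_notin_M by simp
  qed
  ultimately show ?thesis using pos_trichotomy by blast
qed

lemma V_ring: "ring (K\<lparr>carrier := V\<rparr>)"
  using subring_V subring_iff[OF subringE(1)[OF subring_V]] by simp

lemma V_cring: "cring (K\<lparr>carrier := V\<rparr>)"
  using subcring_iff[OF subringE(1)[OF subring_V]] subcringI'[OF subring_V] by simp

lemma valuation_subring_V: "valuation_subring K V"
  unfolding valuation_subring_def
proof (intro conjI ballI subring_V)
  fix a assume a: "a \<in> carrier K - {\<zero>}"
  then obtain u \<gamma> where u: "u \<in> V - M" "a = u \<otimes> monomial \<gamma>"
    using field_unit_times_monomial unfolding unit_times_monomial_def by blast
  consider "monomial \<gamma> = \<one>" | "pos \<gamma>" | "pos (\<lambda>k. - \<gamma> k)"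
    using pos_trichotomy[of \<gamma>] laurent_zero by blast
  then show "a \<in> V \<or> inv a \<in> V"
  proof cases
    case 3
    have "u \<in> Units K" "monomial \<gamma> \<in> Units K"
      using u V_unit_nonzero[of u] laurent_unit[of 0 \<gamma>] by (auto simp del: field_Units)
    then have "inv a = inv (monomial \<gamma>) \<otimes> inv u"
      unfolding u(2) using H.inv_mult_group[of u "monomial \<gamma>"]
      by (simp add: units_of_inv Units_m_closed del: field_Units)
    then have "inv a = monomial (\<lambda>k. - \<gamma> k) \<otimes> inv u" by (simp only: laurent_uminus)
    then show ?thesis using monomial_in_M[OF 3] M_V u inv_in_V V_mult by auto
  qed (use u monomial_in_M M_V V_mult V_one in auto)
qed

lemma ideal_M: "ideal M (K\<lparr>carrier := V\<rparr>)"
  using M_V zero_in_M by (intro subring_idealI[OF subring_V]) (auto intro: M_add M_mult)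

lemma proper_ideal_V:
  assumes J: "ideal J (K\<lparr>carrier := V\<rparr>)" and "J \<noteq> V" shows "J \<subseteq> M"
proof
  fix a assume a: "a \<in> J"
  note J' = subring_idealD[OF J]
  show "a \<in> M"
  proof (rule ccontr)
    assume "a \<notin> M"
    then have a': "a \<in> V - M" using a J' by blast
    then have "inv a \<otimes> a \<in> J" using J' a inv_in_V by blast
    moreover have "inv a \<otimes> a = \<one>" using V_unit_nonzero[OF a'] by (intro Units_l_inv) simp
    ultimately have "r \<in> J" if "r \<in> V" for r using J'(4)[OF that, of \<one>] V_carrier[OF that] by simp
    then show False using J'(1) \<open>J \<noteq> V\<close> by blast
  qed
qed

lemma maximalideal_M: "maximalideal M (K\<lparr>carrier := V\<rparr>)"
  using ideal_M
proof (rule maximalidealI)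
  show "carrier (K\<lparr>carrier := V\<rparr>) \<noteq> M" using V_one one_notin_M by auto
  show "J = M \<or> J = carrier (K\<lparr>carrier := V\<rparr>)" if "ideal J (K\<lparr>carrier := V\<rparr>)" "M \<subseteq> J" for J
    using that proper_ideal_V by auto
qed

lemma local_ring_V: "local_ring (K\<lparr>carrier := V\<rparr>) M"
proof -
  have "J = M" if J: "maximalideal J (K\<lparr>carrier := V\<rparr>)" for J
  proof -
    interpret J: maximalideal J "K\<lparr>carrier := V\<rparr>" by (rule J)
    have "J \<subseteq> M" using proper_ideal_V[OF J.is_ideal] J.I_notcarr by auto
    then have "M = J \<or> M = V"
      using J.I_maximal[OF ideal_M] M_V by auto
    then show "J = M" using V_one one_notin_M by auto
  qed
  then show ?thesis
    unfolding local_ring_def using V_cring maximalideal_M by blast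
qed

lemma nat_pow_unit_times_monomial:
  assumes "u \<in> carrier K"
  shows "(u \<otimes> monomial \<gamma>) [^] n = u [^] n \<otimes> monomial (\<lambda>k. int n * \<gamma> k)"
proof (induction n)
  case 0
  then show ?case using laurent_zero[of "\<lambda>_. 0" 0] by simp
next
  case (Suc n)
  have "monomial (\<lambda>k. int (Suc n) * \<gamma> k) = monomial (\<lambda>k. int n * \<gamma> k + \<gamma> k)"
    by (rule laurent_cong) (simp add: algebra_simps)
  also have "\<dots> = monomial (\<lambda>k. int n * \<gamma> k) \<otimes> monomial \<gamma>" by (rule laurent_add)
  finally show ?case
    using Suc assms laurent_carrier nat_pow_closed[OF assms, of n] by (simp add: m_ac)
qed

text \<open>
  The archimedean property of the order on exponents, transferred to \<open>V\<close>.  It leaves room for only one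
  nonzero prime ideal.
\<close>

lemma power_divisible:
  assumes a: "a \<in> M" "a \<noteq> \<zero>" and b: "b \<in> V" "b \<noteq> \<zero>"
  shows "\<exists>n. \<exists>c\<in>V. a [^] (n :: nat) = c \<otimes> b"
proof -
  obtain u \<gamma> w \<delta> where u: "u \<in> V - M" "a = u \<otimes> monomial \<gamma>" and w: "w \<in> V - M" "b = w \<otimes> monomial \<delta>"
    using field_unit_times_monomial[OF V_carrier[OF M_V[OF a(1)]] a(2)]
      field_unit_times_monomial[OF V_carrier[OF b(1)] b(2)]
    unfolding unit_times_monomial_def by blast
  have car: "u \<in> carrier K" "w \<in> carrier K" "inv w \<in> carrier K" and ww: "inv w \<otimes> w = \<one>"
    using u w V_carrier inv_in_V V_unit_nonzero[OF w(1)] Units_l_inv[of w] by auto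
  have "pos \<gamma>"
  proof (rule ccontr)
    assume "\<not> pos \<gamma>"
    then have "monomial \<gamma> = \<one> \<or> monomial (\<lambda>k. - \<gamma> k) \<in> V"
      using pos_trichotomy[of \<gamma>] laurent_zero monomial_in_M M_V by blast
    moreover have "monomial \<gamma> \<otimes> monomial (\<lambda>k. - \<gamma> k) = \<one>"
      unfolding laurent_add[symmetric] by (rule laurent_zero) simp
    ultimately have "\<exists>r\<in>V. monomial \<gamma> \<otimes> r = \<one>"
      using V_one l_one one_closed by metis
    then obtain r where r: "r \<in> V" "monomial \<gamma> \<otimes> r = \<one>" by blast
    have iu: "inv u \<otimes> u = \<one>" using V_unit_nonzero[OF u(1)] by (intro Units_l_inv) simp
    have iuV: "inv u \<in> V" using u inv_in_V by blast
    have "(r \<otimes> inv u) \<otimes> a = monomial \<gamma> \<otimes> r \<otimes> (inv u \<otimes> u)"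
      unfolding u(2) using V_carrier[OF r(1)] car laurent_carrier[of 0 \<gamma>] V_carrier[OF iuV]
      by (simp only: m_ac m_closed)
    then have "(r \<otimes> inv u) \<otimes> a = \<one>" using r iu by simp
    then show False using M_mult[OF V_mult[OF r(1) iuV] a(1)] one_notin_M by simp
  qed
  then obtain n where n: "pos (\<lambda>k. int n * \<gamma> k - \<delta> k)" using pos_archimedean by blast
  have un: "u [^] n \<in> V" using u by (induction n) (auto intro: V_one V_mult)
  let ?c = "u [^] n \<otimes> inv w \<otimes> monomial (\<lambda>k. int n * \<gamma> k - \<delta> k)"
  have "monomial (\<lambda>k. int n * \<gamma> k) = monomial (\<lambda>k. int n * \<gamma> k - \<delta> k) \<otimes> monomial \<delta>"
    unfolding laurent_add[symmetric] by simp
  then have "a [^] n = u [^] n \<otimes> (inv w \<otimes> w) \<otimes> (monomial (\<lambda>k. int n * \<gamma> k - \<delta> k) \<otimes> monomial \<delta>)"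
    unfolding u(2) nat_pow_unit_times_monomial[OF car(1)] using ww car by simp
  also have "\<dots> = ?c \<otimes> b"
    unfolding w(2) using car laurent_carrier V_carrier[OF un] by (simp only: m_ac m_closed)
  finally have "a [^] n = ?c \<otimes> b" .
  moreover have "inv w \<in> V" using w(1) inv_in_V by simp
  then have "?c \<in> V" using un M_V[OF monomial_in_M[OF n]] by (intro V_mult)
  ultimately show ?thesis by blast
qed

lemma primeideal_V:
  assumes P: "primeideal P (K\<lparr>carrier := V\<rparr>)" shows "P = {\<zero>} \<or> P = M"
proof -
  interpret P: primeideal P "K\<lparr>carrier := V\<rparr>" by (rule P)
  note P' = subring_idealD[OF P.is_ideal]
  have PM: "P \<subseteq> M" using proper_ideal_V[OF P.is_ideal] P.I_notcarr by auto
  have "M \<subseteq> P" if nz: "P \<noteq> {\<zero>}"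
  proof
    fix a assume a: "a \<in> M"
    obtain b where b: "b \<in> P" "b \<noteq> \<zero>" using nz P'(2) by blast
    show "a \<in> P"
    proof (cases "a = \<zero>")
      case False
      then obtain n c where "c \<in> V" "a [^] (n :: nat) = c \<otimes> b"
        using power_divisible[OF a False, of b] b P'(1) by blast
      then have "a [^] n \<in> P" using P'(4) b by simp
      then show "a \<in> P"
      proof (induction n)
        case 0
        then show ?case using PM one_notin_M by auto
      next
        case (Suc n)
        have "a [^] n \<in> V" using a M_V by (induction n) (auto intro: V_one V_mult)
        then show ?case using Suc P.I_prime[of "a [^] n" a] a M_V by auto
      qed
    qed (use P'(2) in simp)
  qed
  then show ?thesis using PM by blast
qed

lemma krull_dim_V: "krull_dim (K\<lparr>carrier := V\<rparr>) = 1"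
proof -
  let ?V = "K\<lparr>carrier := V\<rparr>"
  let ?chain = "\<lambda>n. \<exists>P :: nat \<Rightarrow> 'a set. (\<forall>i\<le>n. primeideal (P i) ?V) \<and> (\<forall>i<n. P i \<subset> P (Suc i))"
  interpret V: cring ?V by (rule V_cring)
  have "n \<le> 1" if chain: "?chain n" for n
  proof (rule ccontr)
    assume n: "\<not> n \<le> 1"
    obtain P where P: "\<And>i. i \<le> n \<Longrightarrow> primeideal (P i) ?V" "\<And>i. i < n \<Longrightarrow> P i \<subset> P (Suc i)"
      using chain by blast
    have "\<zero> \<in> P 0" using subring_idealD(2)[OF primeideal.axioms(1)[OF P(1)[of 0]]] by simp
    then have "P 1 \<noteq> {\<zero>}" "P 2 \<noteq> {\<zero>}" using P(2)[of 0] P(2)[of 1] n by (auto simp: numeral_2_eq_2)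
    then have "P 1 = M" "P 2 = M" using primeideal_V P(1)[of 1] P(1)[of 2] n by auto
    then show False using P(2)[of 1] n by (auto simp: numeral_2_eq_2)
  qed
  moreover have "?chain 1"
  proof (intro exI conjI allI impI)
    let ?P = "\<lambda>i :: nat. if i = 0 then {\<zero>} else M"
    have "primeideal {\<zero>} ?V"
    proof (rule primeidealI)
      show "ideal {\<zero>} ?V" using V.zeroideal by simp
      show "carrier ?V \<noteq> {\<zero>}" using V_one by auto
      show "a \<in> {\<zero>} \<or> b \<in> {\<zero>}"
        if "a \<in> carrier ?V" "b \<in> carrier ?V" "a \<otimes>\<^bsub>?V\<^esub> b \<in> {\<zero>}" for a b
        using that V_carrier integral by auto
    qed (rule V_cring)
    moreover have "primeideal M ?V" using V.maximalideal_prime[OF maximalideal_M] .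
    ultimately show "primeideal (?P i) ?V" for i by simp
    have "x 0 (dir 0) \<in> M" "x 0 (dir 0) \<noteq> \<zero>" using m_M[OF x_in_m[OF dir_in]] x_nonzero[OF dir_in] by blast+
    then show "?P i \<subset> ?P (Suc i)" if "i < 1" for i using that zero_in_M by auto
  qed
  ultimately have "krull_dim ?V = enat 1"
    unfolding krull_dim_def by (intro antisym SUP_least SUP_upper) auto
  then show ?thesis by (simp add: one_enat_def)
qed

lemma residue_V: "a \<in> V \<Longrightarrow> \<exists>r\<in>R 0. a \<ominus> r \<in> M"
proof -
  have "\<forall>a\<in>R i. \<exists>r\<in>R 0. a \<ominus> r \<in> M" for i
  proof (induction i)
    case 0
    show ?case
    proof
      fix a assume a: "a \<in> R 0"
      then have "a \<ominus> a = \<zero>" using R_carrier by (simp add: minus_eq r_neg)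
      then show "\<exists>r\<in>R 0. a \<ominus> r \<in> M" using a zero_in_M by (intro bexI[of _ a]) auto
    qed
  next
    case (Suc i)
    show ?case
    proof
      fix a assume a: "a \<in> R (Suc i)"
      then obtain b where b: "b \<in> R i" "a \<ominus> b \<in> m (Suc i)" using residue_Suc by blast
      then obtain r where r: "r \<in> R 0" "b \<ominus> r \<in> M" using Suc by blast
      have "a \<ominus> r = (a \<ominus> b) \<oplus> (b \<ominus> r)"
        using R_carrier[OF a] R_carrier[OF b(1)] R_carrier[OF r(1)] by algebra
      then show "\<exists>r\<in>R 0. a \<ominus> r \<in> M" using r b m_M M_add by metis
    qed
  qed
  then show "a \<in> V \<Longrightarrow> \<exists>r\<in>R 0. a \<ominus> r \<in> M" by (auto simp: V_def)
qed

lemma zero_dimensional_V: "zero_dimensional_over K V (R 0) (m 0)"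
proof -
  let ?V = "K\<lparr>carrier := V\<rparr>"
  let ?q = "\<lambda>r. M +>\<^bsub>?V\<^esub> r"
  interpret V: cring ?V by (rule V_cring)
  interpret M: maximalideal M ?V by (rule maximalideal_M)
  interpret k: field "?V Quot M" by (rule M.quotient_is_field[OF V_cring])
  have RV: "R 0 \<subseteq> V" using R_V by blast
  have "subring (R 0) ?V"
    using V.subring_iff[of "R 0"] RV subring_iff[OF subringE(1)[OF subring_R]] subring_R[of 0] by simp
  then have img: "subring (?q ` R 0) (?V Quot M)"
    by (rule ring_hom_ring.img_is_subring[OF M.rcos_ring_hom_ring])
  have "z \<in> ?q ` R 0" if z: "z \<in> carrier (?V Quot M)" for z
  proof -
    obtain a where a: "a \<in> V" "z = ?q a"
      using z by (auto simp: FactRing_def A_RCOSETS_def')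
    then obtain r where r: "r \<in> R 0" "a \<ominus> r \<in> M" using residue_V by blast
    have "\<ominus>\<^bsub>?V\<^esub> r = \<ominus> r"
      using V_carrier R_V[OF r(1)] V_uminus[OF R_V[OF r(1)]] R_carrier[OF r(1)]
      by (intro V.minus_equality) (auto simp: l_neg)
    then have "a \<ominus>\<^bsub>?V\<^esub> r \<in> M" using r(2) by (simp add: a_minus_def)
    then have "?q a = ?q r"
      using V.quotient_eq_iff_same_a_r_cos[OF ideal_M] a R_V[OF r(1)] by simp
    then show ?thesis using a r by blast
  qed
  then have "\<forall>z\<in>carrier (?V Quot M). ring.algebraic (?V Quot M) (?q ` R 0) z"
    using k.algebraic_self[OF img] unfolding over_def by blast
  moreover have "M \<inter> R 0 = m 0"
  proof
    show "M \<inter> R 0 \<subseteq> m 0" using Units_R_V by blast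
    show "m 0 \<subseteq> M \<inter> R 0" using m_M m_R by blast
  qed
  ultimately show ?thesis
    unfolding zero_dimensional_over_def Let_def using local_ring_V RV by blast
qed

section \<open>The value group\<close>

text \<open>
  The value group is treated as an abstract quotient \<open>h\<close> of the multiplicative group by the units of
  \<open>V\<close>, so that the statement applies both to the quotient group itself and to the image of a valuation.
  Each class contains a Laurent monomial, whose exponents are unique because a nontrivial Laurent
  monomial is not a unit; these exponents are the coordinates with respect to the classes of the
  variables.
\<close>

lemma value_map_basis:
  assumes G: "comm_group G" and h: "h \<in> hom (units_of K) G"
    and onto: "h ` carrier (units_of K) = carrier G"
    and ker: "\<And>a. a \<in> carrier (units_of K) \<Longrightarrow> h a = \<one>\<^bsub>G\<^esub> \<longleftrightarrow> a \<in> V - M"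
  shows "rationally_independent G I (\<lambda>k. h (x 0 k)) \<and> has_rational_rank G (card I)"
proof -
  interpret G: comm_group G by (rule G)
  interpret h: group_hom "units_of K" G h
    using h by (intro group_hom.intro group_hom_axioms.intro) (auto simp: H.is_group)
  have mono_onto: "\<exists>\<gamma>. g = h (monomial \<gamma>)" if g: "g \<in> carrier G" for g
  proof -
    obtain a where a: "a \<in> carrier (units_of K)" "g = h a" using g onto by blast
    then obtain u \<gamma> where u: "u \<in> V - M" "a = u \<otimes> monomial \<gamma>"
      using field_unit_times_monomial[of a] unfolding unit_times_monomial_def by auto
    have "u \<in> carrier (units_of K)" using V_unit_nonzero u by blast
    then have "h a = h (monomial \<gamma>)"
      using h.hom_mult[of u "monomial \<gamma>"] laurent_unit ker[of u] u h.hom_closed by simp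
    then show ?thesis using a by blast
  qed
  have mono_unique: "\<gamma> k = \<delta> k" if eq: "h (monomial \<gamma>) = h (monomial \<delta>)" and k: "k \<in> I" for \<gamma> \<delta> k
  proof -
    have "monomial \<gamma> = monomial (\<lambda>k. \<gamma> k - \<delta> k) \<otimes> monomial \<delta>"
      unfolding laurent_add[symmetric] by simp
    then have "h (monomial \<gamma>) = h (monomial (\<lambda>k. \<gamma> k - \<delta> k)) \<otimes>\<^bsub>G\<^esub> h (monomial \<delta>)"
      using h.hom_mult laurent_unit by simp
    then have "h (monomial (\<lambda>k. \<gamma> k - \<delta> k)) = \<one>\<^bsub>G\<^esub>"
      using eq h.hom_closed[OF laurent_unit] G.r_cancel_one' by metis
    then have "monomial (\<lambda>k. \<gamma> k - \<delta> k) \<in> V - M" using ker laurent_unit by blast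
    then show ?thesis using laurent_unit_imp_zero k by force
  qed
  define \<phi> where "\<phi> = (\<lambda>k g. (SOME \<gamma>. g = h (monomial \<gamma>)) k)"
  have \<phi>: "g = h (monomial (\<lambda>k. \<phi> k g))" if "g \<in> carrier G" for g
    unfolding \<phi>_def using someI_ex[OF mono_onto[OF that]] .
  have \<phi>_eq: "\<phi> k (h (monomial \<gamma>)) = \<gamma> k" if "k \<in> I" for k \<gamma>
    using mono_unique[OF \<phi>[symmetric] that] h.hom_closed[OF laurent_unit] by simp
  let ?e = "\<lambda>k. h (x 0 k)"
  have e: "?e \<in> I \<rightarrow> carrier G" using x_unit h.hom_closed by blast
  have mult: "\<phi> k (g \<otimes>\<^bsub>G\<^esub> g') = \<phi> k g + \<phi> k g'"
    if "k \<in> I" "g \<in> carrier G" "g' \<in> carrier G" for k g g'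
  proof -
    have "g \<otimes>\<^bsub>G\<^esub> g' = h (monomial (\<lambda>k. \<phi> k g)) \<otimes>\<^bsub>G\<^esub> h (monomial (\<lambda>k. \<phi> k g'))"
      using \<phi> that by simp
    also have "\<dots> = h (monomial (\<lambda>k. \<phi> k g + \<phi> k g'))"
      using h.hom_mult[OF laurent_unit laurent_unit] by (simp add: laurent_add)
    finally show ?thesis using \<phi>_eq[OF \<open>k \<in> I\<close>] by simp
  qed
  have unit: "\<phi> k (?e l) = (if k = l then 1 else 0)" if "k \<in> I" "l \<in> I" for k l
    using \<phi>_eq[OF \<open>k \<in> I\<close>, of "\<lambda>k. if k = l then 1 else 0"] laurent_single_1[OF \<open>l \<in> I\<close>, of 0] by simp
  have basis: "g = laurent_monomial G I ?e (\<lambda>k. \<phi> k g)" if "g \<in> carrier G" for g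
  proof -
    have "g = h (monomial (\<lambda>k. \<phi> k g))" using \<phi>[OF that] .
    also have "\<dots> = laurent_monomial G I (\<lambda>k. h (x 0 k)) (\<lambda>k. \<phi> k g)"
      unfolding laurent_def by (rule H.laurent_monomial_hom[OF G h x_units finite_I])
    finally show ?thesis .
  qed
  show ?thesis
    using G.free_basis_rationally_independent[OF finite_I e mult unit basis]
      G.free_basis_rational_rank[OF finite_I e mult unit basis] by blast
qed

lemma units_V_subgroup: "subgroup (V - M) (units_of K)"
proof
  show "V - M \<subseteq> carrier (units_of K)" using V_unit_nonzero by blast
  interpret V: ring "K\<lparr>carrier := V\<rparr>" by (rule V_ring)
  show "a \<otimes>\<^bsub>units_of K\<^esub> b \<in> V - M" if "a \<in> V - M" "b \<in> V - M" for a b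
    using V.Units_m_closed[of a b] that unfolding Units_V by simp
  show "\<one>\<^bsub>units_of K\<^esub> \<in> V - M" using V_one one_notin_M by simp
  show "inv\<^bsub>units_of K\<^esub> a \<in> V - M" if a: "a \<in> V - M" for a
  proof -
    have "a \<in> Units K" using V_unit_nonzero[OF a] by simp
    moreover from this have "inv a \<notin> M"
      using M_mult[of a "inv a"] a one_notin_M Units_r_inv by auto
    ultimately show ?thesis using a inv_in_V by (simp add: units_of_inv del: field_Units)
  qed
qed

lemma rational_rank_value_group_of_ring: "has_rational_rank (value_group_of_ring K V) (card I)"
proof -
  \<comment> \<open>Two constants \<open>mult_of\<close> with the same definition exist; the value group is formed with the one
    of \<open>Ring_Divisibility\<close>.\<close>
  have K: "Ring_Divisibility.mult_of K = units_of K"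
    by (simp add: Ring_Divisibility.mult_of_def units_of_def)
  have G: "value_group_of_ring K V = units_of K Mod (V - M)"
    by (simp add: value_group_of_ring_def Units_V K)
  have normal: "V - M \<lhd> units_of K"
    using H.normal_iff_subgroup units_V_subgroup by blast
  have ker: "V - M #>\<^bsub>units_of K\<^esub> a = V - M \<longleftrightarrow> a \<in> V - M" if "a \<in> carrier (units_of K)" for a
    using H.coset_join1[OF _ that units_V_subgroup] H.coset_join2[OF that units_V_subgroup] by blast
  show ?thesis unfolding G
    using value_map_basis[OF H.abelian_FactGroup[OF units_V_subgroup] normal.r_coset_hom_Mod[OF normal]]
      ker by (simp add: carrier_FactGroup del: units_of_carrier)
qed

lemma associated_valuation_zero_iff:
  fixes v :: "'a \<Rightarrow> 'g :: linordered_ab_group_add"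
  assumes "valuation_associated_to K V v" and a: "a \<in> carrier K - {\<zero>}"
  shows "v a = 0 \<longleftrightarrow> a \<in> V - M"
proof -
  have v: "valuation K v" and V: "V = {a \<in> carrier K. a = \<zero> \<or> 0 \<le> v a}"
    using assms by (auto simp: valuation_associated_to_def)
  have ia: "inv a \<in> carrier K - {\<zero>}" and aia: "a \<otimes> inv a = \<one>"
    using a Units_inv_Units[of a] Units_r_inv[of a] by auto
  have V_iff: "b \<in> V \<longleftrightarrow> 0 \<le> v b" if "b \<in> carrier K - {\<zero>}" for b using that by (auto simp: V)
  have "a \<in> V - M \<longleftrightarrow> a \<in> V \<and> inv a \<in> V"
    using inv_in_V M_mult[of "inv a" a] one_notin_M aia a ia m_comm[of a "inv a"] by auto
  then show ?thesis using V_iff[OF a] V_iff[OF ia] valuation_inv[OF v a] by auto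
qed

lemma value_group_basis:
  fixes v :: "'a \<Rightarrow> 'g :: linordered_ab_group_add"
  assumes "valuation_associated_to K V v"
  shows "rationally_independent (value_group K v) I (\<lambda>k. v (x 0 k)) \<and>
    has_rational_rank (value_group K v) (card I)"
proof (rule value_map_basis)
  have v: "valuation K v" and V: "V = {a \<in> carrier K. a = \<zero> \<or> 0 \<le> v a}"
    using assms by (auto simp: valuation_associated_to_def)
  let ?G = "value_group K v"
  have closed: "a \<otimes> b \<in> carrier K - {\<zero>}" if "a \<in> carrier K - {\<zero>}" "b \<in> carrier K - {\<zero>}" for a b
    using that integral by auto
  show "comm_group ?G"
  proof (rule comm_groupI)
    show "g \<otimes>\<^bsub>?G\<^esub> h \<in> carrier ?G" if gh: "g \<in> carrier ?G" "h \<in> carrier ?G" for g h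
    proof -
      obtain a b where ab: "a \<in> carrier K - {\<zero>}" "b \<in> carrier K - {\<zero>}" "g = v a" "h = v b"
        using gh by (auto simp: value_group_def)
      then have "g \<otimes>\<^bsub>?G\<^esub> h = v (a \<otimes> b)" using valuation_mult[OF v] by (simp add: value_group_def)
      then show ?thesis using closed[OF ab(1,2)] by (simp add: value_group_def)
    qed
    show "\<one>\<^bsub>?G\<^esub> \<in> carrier ?G"
      using valuation_one[OF v] by (auto simp: value_group_def intro!: image_eqI[of _ _ \<one>])
    show "\<exists>h\<in>carrier ?G. h \<otimes>\<^bsub>?G\<^esub> g = \<one>\<^bsub>?G\<^esub>" if g: "g \<in> carrier ?G" for g
    proof -
      obtain a where a: "a \<in> carrier K - {\<zero>}" "g = v a" using g by (auto simp: value_group_def)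
      then have "inv a \<in> carrier K - {\<zero>}" using Units_inv_Units[of a] by simp
      then have "v (inv a) \<in> carrier ?G" by (auto simp: value_group_def)
      moreover have "v (inv a) \<otimes>\<^bsub>?G\<^esub> g = \<one>\<^bsub>?G\<^esub>"
        using a valuation_inv[OF v] by (simp add: value_group_def)
      ultimately show ?thesis by blast
    qed
  qed (auto simp: value_group_def add.assoc add.commute)
  show "v \<in> hom (units_of K) ?G"
    using valuation_mult[OF v] by (intro homI) (auto simp: value_group_def)
  show "v ` carrier (units_of K) = carrier ?G" by (simp add: value_group_def)
  show "v a = \<one>\<^bsub>?G\<^esub> \<longleftrightarrow> a \<in> V - M" if "a \<in> carrier (units_of K)" for a
    using associated_valuation_zero_iff[OF assms, of a] that by (simp add: value_group_def)
qed

lemma finprod_eq_monomial: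
  "finprod K (\<lambda>k. x 0 k [^] (\<alpha> k :: nat)) I = monomial (\<lambda>k. int (\<alpha> k))"
proof -
  have "finprod K (\<lambda>k. x 0 k [^] \<alpha> k) J = laurent_monomial (units_of K) J (x 0) (\<lambda>k. int (\<alpha> k))"
    if "J \<subseteq> I" for J
    using finite_subset[OF that finite_I] that
  proof (induction J)
    case empty
    then show ?case using H.laurent_monomial_zero[of "{}" "\<lambda>k. int (\<alpha> k)" "x 0"] by simp
  next
    case (insert k J)
    have units: "x 0 \<in> insert k J \<rightarrow> carrier (units_of K)" using insert.prems x_unit by blast
    have "(\<lambda>k. x 0 k [^] \<alpha> k) \<in> J \<rightarrow> carrier K" "x 0 k [^] \<alpha> k \<in> carrier K"
      using insert.prems x_carrier by auto
    then show ?case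
      using H.laurent_monomial_remove[OF units, of k "\<lambda>k. int (\<alpha> k)"] insert
      by (simp add: int_pow_int nat_pow_units_of)
  qed
  then show ?thesis unfolding laurent_def by blast
qed

text \<open>
  Unit coefficients have value zero, and two monomials of equal value have a unit as their quotient,
  hence the same exponents.
\<close>

lemma value_of_monomial_sum:
  fixes v :: "'a \<Rightarrow> 'g :: linordered_ab_group_add"
  assumes v: "valuation_associated_to K V v" and fin: "finite G" "G \<noteq> {}"
    and G: "G \<subseteq> {finprod K (\<lambda>k. x 0 k [^] \<alpha> k) I | \<alpha> :: 'i \<Rightarrow> nat. True}"
    and \<mu>: "\<mu> \<in> G \<rightarrow> V - M"
  shows "v (\<Oplus>g\<in>G. \<mu> g \<otimes> g) = Min (v ` G)"
proof -
  have vK: "valuation K v" using v by (simp add: valuation_associated_to_def)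
  have mon: "\<exists>\<gamma>. g = monomial \<gamma>" if "g \<in> G" for g
    using that G finprod_eq_monomial by blast
  have g_unit: "g \<in> carrier K - {\<zero>}" if gG: "g \<in> G" for g
  proof -
    obtain \<gamma> where "g = monomial \<gamma>" using mon[OF gG] by blast
    then show ?thesis using laurent_carrier[of 0 \<gamma>] laurent_nonzero[of 0 \<gamma>] by simp
  qed
  have \<mu>_unit: "\<mu> g \<in> carrier K - {\<zero>}" if "g \<in> G" for g
    using V_unit_nonzero[of "\<mu> g"] \<mu> that by auto
  have v_term: "v (\<mu> g \<otimes> g) = v g" if "g \<in> G" for g
  proof -
    have "\<mu> g \<in> V - M" using \<mu> that by blast
    then have "v (\<mu> g) = 0" using associated_valuation_zero_iff[OF v \<mu>_unit[OF that]] by blast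
    then show ?thesis using valuation_mult[OF vK \<mu>_unit[OF that] g_unit[OF that]] by simp
  qed
  have inj: "inj_on v G"
  proof (rule inj_onI)
    fix g g' assume g: "g \<in> G" "g' \<in> G" "v g = v g'"
    obtain \<gamma> \<delta> where gd: "g = monomial \<gamma>" "g' = monomial \<delta>" using mon g by metis
    let ?q = "monomial (\<lambda>k. \<gamma> k - \<delta> k)"
    have q: "?q \<in> carrier K - {\<zero>}" using laurent_carrier laurent_nonzero by blast
    have "g = ?q \<otimes> g'" unfolding gd laurent_add[symmetric] by simp
    then have "v g = v ?q + v g'" using valuation_mult[OF vK q g_unit[OF g(2)]] by simp
    then have "?q \<in> V - M" using g(3) associated_valuation_zero_iff[OF v q] by simp
    then have "\<forall>k\<in>I. \<gamma> k - \<delta> k = 0" by (rule laurent_unit_imp_zero)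
    then show "g = g'" unfolding gd by (intro laurent_cong) simp
  qed
  have "inj_on (v \<circ> (\<lambda>g. \<mu> g \<otimes> g)) G"
    using inj v_term by (simp add: inj_on_def)
  moreover have "(\<lambda>g. \<mu> g \<otimes> g) \<in> G \<rightarrow> carrier K - {\<zero>}"
    using g_unit \<mu>_unit integral by fastforce
  ultimately have "v (\<Oplus>g\<in>G. \<mu> g \<otimes> g) = Min (v ` (\<lambda>g. \<mu> g \<otimes> g) ` G)"
    using valuation_finsum_distinct[OF vK fin] by blast
  also have "v ` (\<lambda>g. \<mu> g \<otimes> g) ` G = v ` G" using v_term by (auto simp: image_image)
  finally show ?thesis .
qed

lemma Units_R_subset: "Units (K\<lparr>carrier := R i\<rparr>) \<subseteq> V - M"
  unfolding Units_V[symmetric] using R_V by (auto simp: Units_def)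

end

section \<open>Monomial local quadratic transformations\<close>

text \<open>
  The last conclusion says that the residue field does not grow.  With \<open>B\<close> the algebra that is localized
  and \<open>P\<close> its ideal generated by the new variables, the elements of \<open>B\<close> that are congruent modulo \<open>P\<close>
  to an element of \<open>A\<close> form a subring \<open>E\<close>.  It contains \<open>A\<close> and all quotients \<open>a \<otimes> inv (x k)\<close> with
  \<open>a \<in> m\<close>, because such a quotient is a combination of \<open>1\<close> and new variables with coefficients in \<open>A\<close>;
  so \<open>E = B\<close>.  A denominator \<open>s \<notin> P\<close> is congruent to some \<open>t \<in> A\<close> outside \<open>m\<close>, which is a unit of \<open>A\<close>;
  hence fractions are congruent to elements of \<open>A\<close> as well.
\<close>

lemma (in field) monomial_lqt_step:
  assumes A: "subring A R" and m: "ideal m (R\<lparr>carrier := A\<rparr>)" "\<one> \<notin> m"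
    and inv: "\<forall>a \<in> A - m. inv a \<in> A"
    and m_gen: "m = Idl\<^bsub>R\<lparr>carrier := A\<rparr>\<^esub> (x ` {1..d})" and x: "x ` {1..d} \<subseteq> A"
    and lqt: "monomial_lqt R d k A m x A' x'"
    and A': "ring (R\<lparr>carrier := A'\<rparr>)"
  shows "subring A' R" "A \<subseteq> A'" "x' ` {1..d} \<subseteq> A'"
    "\<And>a. a \<in> A' \<Longrightarrow> \<exists>r\<in>A. a \<ominus> r \<in> Idl\<^bsub>R\<lparr>carrier := A'\<rparr>\<^esub> (x' ` {1..d})"
proof -
  let ?I = "{1..d}"
  note sA = subringE[OF A]
  note m' = subring_idealD[OF m(1)]
  have Aring: "ring (R\<lparr>carrier := A\<rparr>)" using A subring_iff[OF sA(1)] by simp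
  have xm: "x l \<in> m" if "l \<in> ?I" for l
    using ring.genideal_self[OF Aring, of "x ` ?I"] x that unfolding m_gen by auto
  have k: "k \<in> ?I" and xk0: "x k \<noteq> \<zero>" and x'k: "x' k = x k"
    and x'l: "\<And>l. l \<in> ?I \<Longrightarrow> l \<noteq> k \<Longrightarrow> x' l = x l \<otimes> inv (x k)"
    using lqt by (auto simp: monomial_lqt_def)
  have xk: "x k \<in> A" "x k \<in> carrier R" using x k sA(1) by blast+
  then have xk_unit: "x k \<in> Units R" using xk0 field_Units by simp
  have ixk: "inv (x k) \<in> carrier R" using xk_unit by simp
  define S where "S = A \<union> {a \<otimes> inv (x k) | a. a \<in> m}"
  define B where "B = generate_ring R S"
  define P where "P = Idl\<^bsub>R\<lparr>carrier := B\<rparr>\<^esub> (x' ` ?I)"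
  have A'_eq: "A' = {b \<otimes> inv s | b s. b \<in> B \<and> s \<in> B - P}"
    using lqt by (simp add: monomial_lqt_def Let_def localization_at_def B_def S_def P_def)
  have S: "S \<subseteq> carrier R" using sA(1) m'(1) ixk by (auto simp: S_def)
  have B: "subring B R" unfolding B_def by (rule generate_ring_is_subring[OF S])
  note sB = subringE[OF B]
  have SB: "S \<subseteq> B" unfolding B_def by (auto intro: generate_ring.incl)
  then have AB: "A \<subseteq> B" by (auto simp: S_def)
  have x'B: "x' l \<in> B" if "l \<in> ?I" for l
  proof (cases "l = k")
    case True
    then show ?thesis using x'k xk AB by auto
  next
    case False
    then have "x' l \<in> S" using x'l[OF that] xm[OF that] by (auto simp: S_def)
    then show ?thesis using SB by blast
  qed
  have Bring: "ring (R\<lparr>carrier := B\<rparr>)" using B subring_iff[OF sB(1)] by simp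
  have P: "ideal P (R\<lparr>carrier := B\<rparr>)"
    unfolding P_def using x'B by (intro ring.genideal_ideal[OF Bring]) auto
  note P' = subring_idealD[OF P]
  have x'P: "x' l \<in> P" if "l \<in> ?I" for l
    using ring.genideal_self[OF Bring, of "x' ` ?I"] x'B that unfolding P_def by (simp add: image_subset_iff)
  have nonP: "s \<in> Units R" if "s \<in> B - P" for s
    using that P'(2) sB(1) field_Units by auto
  have "A' \<subseteq> carrier R"
    unfolding A'_eq using sB(1) nonP by auto
  then show A'_sub: "subring A' R" using A' subring_iff by simp
  note sA' = subringE[OF A'_sub]
  \<comment> \<open>The localization is a ring, so it has an element and some denominator is not in \<open>P\<close>.\<close>
  have P1: "\<one> \<notin> P"
  proof
    assume "\<one> \<in> P"
    then have "b \<in> P" if "b \<in> B" for b using P'(4)[OF that] that sB(1) by fastforce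
    then show False using sA'(2) unfolding A'_eq by blast
  qed
  have BA': "B \<subseteq> A'"
  proof
    fix b assume "b \<in> B"
    moreover have "b = b \<otimes> inv \<one>" using \<open>b \<in> B\<close> sB(1) by auto
    ultimately show "b \<in> A'" unfolding A'_eq using P1 sB(3) by blast
  qed
  show "A \<subseteq> A'" using AB BA' by blast
  show x'A': "x' ` ?I \<subseteq> A'" using x'B BA' by blast
  have inv_s: "inv s \<in> A'" if "s \<in> B - P" for s
  proof -
    have "inv s = \<one> \<otimes> inv s" using nonP[OF that] by simp
    then show ?thesis unfolding A'_eq using that sB(3) by blast
  qed
  define Q where "Q = Idl\<^bsub>R\<lparr>carrier := A'\<rparr>\<^esub> (x' ` ?I)"
  have Q: "ideal Q (R\<lparr>carrier := A'\<rparr>)"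
    unfolding Q_def using x'A' by (intro ring.genideal_ideal[OF A']) auto
  note Q' = subring_idealD[OF Q]
  have "P \<subseteq> Q \<inter> B"
    unfolding P_def
  proof (rule ring.genideal_minimal[OF Bring])
    show "ideal (Q \<inter> B) (R\<lparr>carrier := B\<rparr>)"
      using Q'(2-4) sB(2,6,7) BA' by (intro subring_idealI[OF B]) auto
    show "x' ` ?I \<subseteq> Q \<inter> B"
      using x'B ring.genideal_self[OF A', of "x' ` ?I"] x'A' by (auto simp: Q_def)
  qed
  then have PQ: "P \<subseteq> Q" by blast
  have mP: "m \<subseteq> P"
  proof -
    have "x l \<in> P" if l: "l \<in> ?I" for l
    proof (cases "l = k")
      case True
      then show ?thesis using x'P[OF k] x'k by simp
    next
      case False
      have "x l \<in> carrier R" using x l sA(1) by blast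
      then have "x l = x k \<otimes> x' l"
        unfolding x'l[OF l False] using xk(2) ixk xk_unit by (simp add: m_lcomm[of "x k"])
      then show ?thesis using P'(4)[OF _ x'P[OF l], of "x k"] xk(1) AB by auto
    qed
    then have "m \<subseteq> P \<inter> A"
      unfolding m_gen using P'(2-4) sA(2,6,7) AB x
      by (intro ring.genideal_minimal[OF Aring] subring_idealI[OF A]) auto
    then show ?thesis by blast
  qed
  define E where "E = {b \<in> B. \<exists>r\<in>A. b \<ominus> r \<in> P}"
  have EI: "r \<oplus> p \<in> E" if "r \<in> A" "p \<in> P" for r p
  proof -
    have "r \<in> carrier R" "p \<in> carrier R" using that sA(1) P'(1) sB(1) by auto
    then have "(r \<oplus> p) \<ominus> r = p" by algebra
    moreover have "r \<oplus> p \<in> B" using that AB P'(1) sB(7) by blast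
    ultimately show ?thesis using that by (auto simp: E_def intro!: bexI[of _ r])
  qed
  have ED: "\<exists>r p. r \<in> A \<and> p \<in> P \<and> r \<in> carrier R \<and> p \<in> carrier R \<and> b = r \<oplus> p" if b: "b \<in> E" for b
  proof -
    obtain r where r: "r \<in> A" "b \<ominus> r \<in> P" "b \<in> B" using b by (auto simp: E_def)
    have car: "r \<in> carrier R" "b \<ominus> r \<in> carrier R" "b \<in> carrier R"
      using r sA(1) P'(1) sB(1) by auto
    have "b = r \<oplus> (b \<ominus> r)" using car(1,3) by algebra
    then show ?thesis using r car by blast
  qed
  have AE: "A \<subseteq> E" using EI[OF _ P'(2)] sA(1) by fastforce
  have E_add: "b \<oplus> c \<in> E" if bc: "b \<in> E" "c \<in> E" for b c
  proof -
    obtain r p where b: "r \<in> A" "p \<in> P" "r \<in> carrier R" "p \<in> carrier R" "b = r \<oplus> p"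
      using ED[OF bc(1)] by blast
    obtain s q where c: "s \<in> A" "q \<in> P" "s \<in> carrier R" "q \<in> carrier R" "c = s \<oplus> q"
      using ED[OF bc(2)] by blast
    have "b \<oplus> c = (r \<oplus> s) \<oplus> (p \<oplus> q)" unfolding b(5) c(5) using b(3,4) c(3,4) by algebra
    then show ?thesis using EI[OF sA(7)[OF b(1) c(1)] P'(3)[OF b(2) c(2)]] by simp
  qed
  have E_mult: "b \<otimes> c \<in> E" if bc: "b \<in> E" "c \<in> E" for b c
  proof -
    obtain r p where b: "r \<in> A" "p \<in> P" "r \<in> carrier R" "p \<in> carrier R" "b = r \<oplus> p"
      using ED[OF bc(1)] by blast
    obtain s q where c: "s \<in> A" "q \<in> P" "s \<in> carrier R" "q \<in> carrier R" "c = s \<oplus> q"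
      using ED[OF bc(2)] by blast
    have "b \<otimes> c = (r \<otimes> s) \<oplus> (r \<otimes> q \<oplus> c \<otimes> p)"
      unfolding b(5) c(5) using b(3,4) c(3,4) by algebra
    moreover have "r \<otimes> q \<oplus> c \<otimes> p \<in> P"
      using b c bc(2) AB by (intro P'(3) P'(4)) (auto simp: E_def)
    ultimately show ?thesis using EI[OF sA(6)[OF b(1) c(1)]] by simp
  qed
  have E: "subring E R"
  proof (rule subringI)
    show "E \<subseteq> carrier R" using sB(1) by (auto simp: E_def)
    show "\<one> \<in> E" using AE sA(3) by blast
    show "\<ominus> b \<in> E" if b: "b \<in> E" for b
    proof -
      have "\<ominus> \<one> \<otimes> b \<in> E" using AE sA(3,5) b E_mult by blast
      moreover have "b \<in> carrier R" using b sB(1) by (auto simp: E_def)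
      ultimately show ?thesis by (simp add: l_minus)
    qed
  qed (use E_add E_mult in blast)+
  have "m \<subseteq> {a \<in> A. a \<otimes> inv (x k) \<in> E}"
    unfolding m_gen
  proof (rule ring.genideal_minimal[OF Aring])
    show "ideal {a \<in> A. a \<otimes> inv (x k) \<in> E} (R\<lparr>carrier := A\<rparr>)"
    proof (rule subring_idealI[OF A])
      show "\<zero> \<in> {a \<in> A. a \<otimes> inv (x k) \<in> E}" using sA(2) AE ixk by auto
      show "a \<oplus> b \<in> {a \<in> A. a \<otimes> inv (x k) \<in> E}"
        if ab: "a \<in> {a \<in> A. a \<otimes> inv (x k) \<in> E}" "b \<in> {a \<in> A. a \<otimes> inv (x k) \<in> E}" for a b
      proof -
        have "a \<in> carrier R" "b \<in> carrier R" using ab sA(1) by auto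
        then have "(a \<oplus> b) \<otimes> inv (x k) = a \<otimes> inv (x k) \<oplus> b \<otimes> inv (x k)"
          using ixk by (simp add: l_distr)
        then show ?thesis using ab E_add sA(7) by auto
      qed
      show "r \<otimes> a \<in> {a \<in> A. a \<otimes> inv (x k) \<in> E}"
        if ra: "r \<in> A" "a \<in> {a \<in> A. a \<otimes> inv (x k) \<in> E}" for r a
      proof -
        have "a \<in> carrier R" "r \<in> carrier R" using ra sA(1) by auto
        then have "(r \<otimes> a) \<otimes> inv (x k) = r \<otimes> (a \<otimes> inv (x k))"
          using ixk by (simp add: m_assoc)
        then show ?thesis using ra E_mult AE sA(6) by auto
      qed
    qed auto
    have "x l \<otimes> inv (x k) \<in> E" if l: "l \<in> ?I" for l
    proof (cases "l = k")
      case True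
      then show ?thesis using xk_unit AE sA(3) by auto
    next
      case False
      have "\<zero> \<oplus> x' l \<in> E" using EI[OF sA(2) x'P[OF l]] .
      moreover have "x' l \<in> carrier R" using x'B[OF l] sB(1) by blast
      ultimately show ?thesis using x'l[OF l False] by simp
    qed
    then show "x ` ?I \<subseteq> {a \<in> A. a \<otimes> inv (x k) \<in> E}" using x by auto
  qed
  then have "S \<subseteq> E" using AE by (auto simp: S_def)
  then have BE: "B \<subseteq> E" unfolding B_def by (rule generate_ring_min_subring1[OF S E])
  fix a assume "a \<in> A'"
  then obtain b s where bs: "b \<in> B" "s \<in> B - P" "a = b \<otimes> inv s" unfolding A'_eq by blast
  obtain r p where b: "r \<in> A" "p \<in> P" "r \<in> carrier R" "p \<in> carrier R" "b = r \<oplus> p"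
    using ED BE bs(1) by blast
  obtain t q where s: "t \<in> A" "q \<in> P" "t \<in> carrier R" "q \<in> carrier R" "s = t \<oplus> q"
    using ED[of s] BE bs(2) by blast
  have t: "t \<notin> m"
  proof
    assume "t \<in> m"
    then have "s \<in> P" unfolding s(5) using mP s(2) by (intro P'(3)) auto
    then show False using bs(2) by blast
  qed
  then have it: "inv t \<in> A" "inv t \<in> carrier R" using inv s(1) t sA(1) by blast+
  have tt: "t \<otimes> inv t = \<one>"
    using t m'(2) s(3) field_Units by (intro Units_r_inv) auto
  have is_car: "inv s \<in> carrier R" and ss: "(t \<oplus> q) \<otimes> inv s = \<one>"
    using nonP[OF bs(2)] s(5) by auto
  have "a \<ominus> r \<otimes> inv t = (p \<otimes> inv s) \<otimes> (t \<otimes> inv t) \<oplus> (r \<otimes> inv s) \<otimes> (t \<otimes> inv t)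
      \<ominus> (r \<otimes> inv t) \<otimes> ((t \<oplus> q) \<otimes> inv s)"
    unfolding tt ss bs(3) b(5) using b(3,4) it is_car by (simp add: l_distr a_comm minus_eq)
  also have "\<dots> = (inv s \<otimes> inv t) \<otimes> (t \<otimes> p \<oplus> (\<ominus> \<one> \<otimes> r) \<otimes> q)"
    using b(3,4) s(3,4) it(2) is_car by algebra
  also have "\<dots> \<in> Q"
  proof (rule Q'(4))
    show "inv s \<otimes> inv t \<in> A'" using inv_s[OF bs(2)] it AB BA' sA'(6) by blast
    have "\<ominus> \<one> \<otimes> r \<in> B" using b(1) AB sA(3,5,6) by blast
    then have "t \<otimes> p \<oplus> (\<ominus> \<one> \<otimes> r) \<otimes> q \<in> P"
      using b s AB by (intro P'(3) P'(4)) auto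
    then show "t \<otimes> p \<oplus> (\<ominus> \<one> \<otimes> r) \<otimes> q \<in> Q" using PQ by blast
  qed
  finally have "a \<ominus> r \<otimes> inv t \<in> Q" .
  then show "\<exists>r\<in>A. a \<ominus> r \<in> Idl\<^bsub>R\<lparr>carrier := A'\<rparr>\<^esub> (x' ` ?I)"
    using sA(6)[OF b(1) it(1)] unfolding Q_def by blast
qed

theorem corollary5p6:
  fixes K :: "('a, 'b) ring_scheme"
    and R :: "nat \<Rightarrow> 'a set" and m :: "nat \<Rightarrow> 'a set" and x :: "nat \<Rightarrow> nat \<Rightarrow> 'a"
    and V :: "'a set" and d :: nat
  assumes "field K"
    and "d \<ge> 2"
    and "fraction_field_of K (R 0)"
    and "x 0 \<in> {1..d} \<rightarrow> R 0"
    and "krull_dim (K\<lparr>carrier := R 0\<rparr>) = enat d"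
    and "\<And>i. regular_local_ring (K\<lparr>carrier := R i\<rparr>) (m i)"
    and "\<And>i. m i = Idl\<^bsub>K\<lparr>carrier := R i\<rparr>\<^esub> (x i ` {1..d})"
    and "\<And>i. \<exists>k\<in>{1..d}. monomial_lqt K d k (R i) (m i) (x i) (R (Suc i)) (x (Suc i))"
    and "\<And>k. k \<in> {1..d} \<Longrightarrow>
           infinite {i. monomial_lqt K d k (R i) (m i) (x i) (R (Suc i)) (x (Suc i))}"
    and "V = (\<Union>i. R i)"
  shows "valuation_subring K V \<and> krull_dim (K\<lparr>carrier := V\<rparr>) = 1 \<and>
    has_rational_rank (value_group_of_ring K V) d \<and>
    zero_dimensional_over K V (R 0) (m 0) \<and>
    (\<forall>v :: 'a \<Rightarrow> 'g :: linordered_ab_group_add. valuation_associated_to K V v \<longrightarrow>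
       has_rational_rank (value_group K v) d \<and>
       rationally_independent (value_group K v) {1..d} (\<lambda>k. v (x 0 k)) \<and>
       monomial_valuation K (R 0) d (x 0) v)"
proof -
  interpret K: field K by (rule assms)
  let ?I = "{1..d}"
  let ?lqt = "\<lambda>k i. monomial_lqt K d k (R i) (m i) (x i) (R (Suc i)) (x (Suc i))"
  have reg: "local_ring (K\<lparr>carrier := R i\<rparr>) (m i)" "noetherian_ring (K\<lparr>carrier := R i\<rparr>)" for i
    using assms(6)[of i] by (auto simp: regular_local_ring_def)
  then have R_ring: "ring (K\<lparr>carrier := R i\<rparr>)" for i
    using noetherian_ring.axioms(1) by blast
  \<comment> \<open>A step has only one direction: with two directions, the quotient of one variable by another one
    would be that variable itself, so that the other variable would be \<open>1\<close>.  Hence the chosen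
    directions recur, too.\<close>
  define dir where "dir = (\<lambda>i. SOME k. k \<in> ?I \<and> ?lqt k i)"
  have dir: "dir i \<in> ?I" "?lqt (dir i) i" for i
    using someI_ex[of "\<lambda>k. k \<in> ?I \<and> ?lqt k i"] assms(8)[of i] unfolding dir_def by blast+
  note step = K.monomial_lqt_step[OF _ _ _ _ assms(7) _ dir(2) R_ring]
  have R_x: "subring (R i) K \<and> x i ` ?I \<subseteq> R i" for i
  proof (induction i)
    case 0
    then show ?case using assms(3,4) by (auto simp: fraction_field_of_def)
  next
    case (Suc i)
    note loc = K.local_subringD[OF conjunct1[OF Suc] reg]
    show ?case using step(1,3)[OF conjunct1[OF Suc] loc conjunct2[OF Suc]] by blast
  qed
  note R_sub = R_x[THEN conjunct1] and x_R = R_x[THEN conjunct2]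
  note loc = K.local_subringD[OF R_sub reg]
  note step = step[OF R_sub loc x_R]
  have x_m: "x i k \<in> m i" if "k \<in> ?I" for i k
    using ring.genideal_self[OF R_ring, of "x i ` ?I" i] x_R[of i] that assms(7)[of i] by auto
  have dir_unique: "dir i = k" if k: "?lqt k i" for i k
  proof (rule ccontr)
    assume ne: "dir i \<noteq> k"
    let ?l = "dir i"
    have kI: "k \<in> ?I" and xk: "x i k \<noteq> \<zero>\<^bsub>K\<^esub>" "x (Suc i) k = x i k"
      using k by (auto simp: monomial_lqt_def)
    have xl: "x i ?l \<noteq> \<zero>\<^bsub>K\<^esub>" "x (Suc i) k = x i k \<otimes>\<^bsub>K\<^esub> inv\<^bsub>K\<^esub> x i ?l"
      using dir(2)[of i] ne kI by (auto simp: monomial_lqt_def)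
    have car: "x i k \<in> carrier K" "x i ?l \<in> carrier K"
      using x_R[of i] subringE(1)[OF R_sub[of i]] kI dir(1)[of i] by blast+
    have unit: "x i ?l \<in> Units K" using car xl K.field_Units by simp
    then have "x i k \<otimes>\<^bsub>K\<^esub> inv\<^bsub>K\<^esub> x i ?l = x i k \<otimes>\<^bsub>K\<^esub> \<one>\<^bsub>K\<^esub>"
      using xk xl car by simp
    then have "inv\<^bsub>K\<^esub> x i ?l = \<one>\<^bsub>K\<^esub>"
      using K.m_lcancel[OF xk(1) car(1)] unit by simp
    then have "x i ?l = \<one>\<^bsub>K\<^esub>" using K.Units_r_inv[OF unit] car by simp
    then show False using x_m[OF dir(1), of i i] loc(2) by simp
  qed
  interpret blow_up_directions ?I dir
  proof
    show "infinite {n. dir n = k}" if "k \<in> ?I" for k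
      using infinite_super[OF _ assms(9)[OF that], of "{n. dir n = k}"] dir_unique by blast
  qed (use dir in auto)
  interpret M: monomial_sequence K ?I dir R m x
  proof (intro monomial_sequence.intro monomial_sequence_axioms.intro)
    show "field K" "blow_up_directions ?I dir" by unfold_locales
    show "J \<supseteq> m i" if "ideal J (K\<lparr>carrier := R i\<rparr>)" "x i ` ?I \<subseteq> J" for i J
      unfolding assms(7)[of i] using that by (rule ring.genideal_minimal[OF R_ring])
    show "x i (dir i) \<noteq> \<zero>\<^bsub>K\<^esub>" "x (Suc i) (dir i) = x i (dir i)" for i
      using dir(2)[of i] by (auto simp: monomial_lqt_def)
    show "x (Suc i) k = x i k \<otimes>\<^bsub>K\<^esub> inv\<^bsub>K\<^esub> x i (dir i)" if "k \<in> ?I" "k \<noteq> dir i" for i k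
      using dir(2)[of i] that by (auto simp: monomial_lqt_def)
    show "\<exists>a\<in>R 0. \<exists>b\<in>R 0 - {\<zero>\<^bsub>K\<^esub>}. f = a \<otimes>\<^bsub>K\<^esub> inv\<^bsub>K\<^esub> b" if "f \<in> carrier K" for f
      using assms(3) that by (auto simp: fraction_field_of_def)
    show "\<exists>r\<in>R i. a \<ominus>\<^bsub>K\<^esub> r \<in> m (Suc i)" if "a \<in> R (Suc i)" for a i
      using step(4)[OF that] assms(7)[of "Suc i"] by simp
  qed (use R_sub loc x_m step(2) reg in blast)+
  have V: "M.V = V" unfolding M.V_def assms(10) ..
  show ?thesis
  proof (intro conjI allI impI)
    show "valuation_subring K V" using M.valuation_subring_V V by simp
    show "krull_dim (K\<lparr>carrier := V\<rparr>) = 1" using M.krull_dim_V V by simp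
    show "has_rational_rank (value_group_of_ring K V) d"
      using M.rational_rank_value_group_of_ring V by simp
    show "zero_dimensional_over K V (R 0) (m 0)" using M.zero_dimensional_V V by simp
    fix v :: "'a \<Rightarrow> 'g" assume "valuation_associated_to K V v"
    then have v: "valuation_associated_to K M.V v" using V by simp
    show "has_rational_rank (value_group K v) d"
      "rationally_independent (value_group K v) {1..d} (\<lambda>k. v (x 0 k))"
      using M.value_group_basis[OF v] by auto
    show "monomial_valuation K (R 0) d (x 0) v"
      unfolding monomial_valuation_def
    proof (intro ballI allI impI)
      fix f G \<mu>
      assume *: "finite G \<and> G \<noteq> {} \<and> G \<subseteq> monomials K d (x 0) \<and>
        \<mu> \<in> G \<rightarrow> Units (K\<lparr>carrier := R 0\<rparr>) \<and> f = (\<Oplus>\<^bsub>K\<^esub>g\<in>G. \<mu> g \<otimes>\<^bsub>K\<^esub> g)"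
      then have "\<mu> \<in> G \<rightarrow> M.V - M.M" using M.Units_R_subset[of 0] by blast
      then show "v f = Min (v ` G)"
        using M.value_of_monomial_sum[OF v, of G \<mu>] * unfolding monomials_def by blast
    qed
  qed
qed

end
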